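(* Let $\mu\in\mathbb{Z}^r$, and let $\lambda\in A^{(n)}$ and $w^{(n)}\in W^{(n)}_{\mathrm{Cox}}$ be the unique pair with $w^{(n)}\lambda=\mu$ and $w^{(n)}$ of minimal length; write a reduced expression $w^{(n)}=s^{(n)}_{i_1}\cdots s^{(n)}_{i_\ell}$, $\vec w=(i_1,\dots,i_\ell)$. For an alcove walk $p$ choose a reduced expression $\phi(p)=s_{u_{p,1}}\cdots s_{u_{p,t}}$ and put $\Sigma(p)=\prod_{a=1}^{t}\sigma\big((\lambda,s_{u_{p,t}}\cdots s_{u_{p,a+1}}\alpha_{u_{p,a}})\big)$. Let $\widetilde p$ be the unique unfolded walk in $\mathcal{B}(\vec w)$. Then the limits $E^{(n)}_\mu(x;0,k)=\lim_{q\to0}E^{(n)}_\mu$ and $E^{(n)}_\mu(x;\infty,k)=\lim_{q\to\infty}E^{(n)}_\mu$ (taken coefficientwise) are well-defined, and \[\Sigma(\widetilde p)\,E^{(n)}_\mu(x;0,k)=\sum_{p\in\mathcal{B}^+(\vec w)}x^{n\,\mathrm{wt}(p)+\phi(p)\lambda}\,\Sigma(p)\,(k^{-1}-k)^{|f^+(p)|},\] \[\Sigma(\widetilde p)\,E^{(n)}_\mu(x;\infty,k)=\sum_{p\in\mathcal{B}^-(\vec w)}x^{n\,\mathrm{wt}(p)+\phi(p)\lambda}\,\Sigma(p)\,(k-k^{-1})^{|f^-(p)|},\] where $\mathcal{B}^+(\vec w)$ (resp. $\mathcal{B}^-(\vec w)$) is the set of walks in $\mathcal{B}(\vec w)$ all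 of whose folds are positive (resp. negative).
   Context: Fix integers $r\ge2$, $n\ge1$. Notation: $\epsilon_i$ standard basis of $\mathbb{R}^r$, $(\cdot,\cdot)$ standard inner product, $\Phi=\{\epsilon_i-\epsilon_j:i\ne j\}$, $\Phi_+=\{\epsilon_i-\epsilon_j:i<j\}$, $\alpha_i=\epsilon_i-\epsilon_{i+1}$, $\theta=\epsilon_1-\epsilon_r$, $Q=\mathbb{Z}\Phi$; $S_r$ permutes coordinates, $s_i=(i\ i+1)$, $s_\theta$ swaps coordinates $1,r$. Groups: $W_{\mathrm{Cox}}=Q\rtimes S_r$ and $W^{(n)}_{\mathrm{Cox}}=nQ\rtimes S_r$ acting on $\mathbb{R}^r$ by affine maps ($\tau(\beta)$ = translation); $W_{\mathrm{Cox}}$ is Coxeter with generators $s_1,\dots,s_{r-1},s_0=\tau(\theta)s_\theta$, $W^{(n)}_{\mathrm{Cox}}$ with $s_i^{(n)}=s_i$, $s_0^{(n)}=\tau(n\theta)s_\theta$. $A^{(n)}=\{\lambda\in\mathbb{Z}^r:\lambda_1\ge\dots\ge\lambda_r,\lambda_1-\lambda_r\le n\}$. Alcove walks: hyperplanes $\{v:(\alpha,v)+s=0\}$ ($\alpha\in\Phi_+,s\in\mathbb{Z}$) cut $\mathbb{R}^r$ into alcoves; $\mathcal{A}=\{v:v_1>\dots>v_r,v_1-v_r<1\}$; $u\mapsto u\mathcal{A}$ identifies $W_{\mathrm{Cox}}$ with alcoves. $v$ is on the positive side of $\{(\alpha,v)+s=0\}$ ($\alpha\in\Phi_+$) if $(\alpha,v)+s>0$.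 An alcove walk of type $\vec w=(i_1,\dots,i_\ell)$ starting at $u\in W_{\mathrm{Cox}}$ is $p=(A_0,\dots,A_\ell)$, $A_0=u$, $A_j\in\{A_{j-1},A_{j-1}s_{i_j}\}$. Fold at $j$ if $A_j=A_{j-1}$; positive if $A_{j-1}$ lies on the positive side of the hyperplane separating $A_{j-1}$ and $A_{j-1}s_{i_j}$, negative otherwise; $f^\pm(p)$ the sets of positive/negative fold steps. $\mathcal{B}(\vec w)$ = walks of type $\vec w$ starting at $1$ (i.e. at $\mathcal{A}$). $A_\ell=\tau(\mathrm{wt}(p))\phi(p)$, $\mathrm{wt}(p)\in Q$, $\phi(p)\in S_r$. Parameters: $k$, $G_j$ with $G_0=k$, $G_jG_{-j}=1$, $G_j$ depending only on $j$ mod $n$ ($G_{n/2}=\pm1$ fixed if $n$ even); $k,q,G_1,\dots,G_{\lfloor(n-1)/2\rfloor}$ independent indeterminates, $\mathbb{F}^{(n)}=\mathbb{C}(k,G_1,\dots,G_{\lfloor(n-1)/2\rfloor})(q)$. $\sigma(a)=k^{-1}$ if $a\in n\mathbb{Z}_{>0}$, else $G_a$. $\gamma(n\epsilon_i;\lambda)=q^{-\lambda_i}\prod_{\alpha\in\Phi_+}\sigma((\lambda,\alpha))^{(\epsilon_i,\alpha)}$. On $\mathbb{F}^{(n)}[x^{\pm1}]$ ($x^\mu=\prod x_i^{\mu_i}$), with $t_n(j)=j-r_n(j)$, $r_n(j)\in\{0,\dots,n-1\}$ the residue mod $n$: $T_ix^\lambda=(k-k^{-1})\frac{1-x^{-t_n((\lambda,\alpha_i))\alpha_i}}{1-x^{n\alpha_i}}x^\lambda+G_{(\lambda,\alpha_i)}x^{s_i\lambda}$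 ($1\le i\le r-1$, invertible), $\omega x^\lambda=q^{-\lambda_r}x^{(\lambda_r,\lambda_1,\dots,\lambda_{r-1})}$, $Y_i=T_{i-1}^{-1}\cdots T_1^{-1}\omega T_{r-1}\cdots T_i$. $E^{(n)}_\mu$ is the unique Laurent polynomial with coefficient $1$ at $x^\mu$ and $Y_iE^{(n)}_\mu=\gamma(n\epsilon_i;\mu)E^{(n)}_\mu$ for all $i$. Its coefficients are rational functions of $q$ over $\mathbb{C}(k,G_1,\dots)$; the limits are taken in $q$ for each coefficient. *)

theory Defs
  imports
    Complex_Main
    "HOL-Library.Poly_Mapping"
    "HOL-Computational_Algebra.Polynomial"
    "HOL-Computational_Algebra.Fraction_Field"
    "HOL-Combinatorics.Permutations"
begin

section \<open>Vectors, roots and the affine Weyl groups\<close>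

text \<open>
  A vector of \<open>\<int>\<^sup>r\<close> or \<open>\<real>\<^sup>r\<close> is a finitely supported function on \<open>nat\<close> whose support is contained in
  \<open>{1..r}\<close>. Integral weights are thereby a linearly ordered abelian group, so that
  \<open>(nat \<Rightarrow>\<^sub>0 int) \<Rightarrow>\<^sub>0 'f\<close> (the group algebra) is an integral domain of Laurent polynomials. Roots and
  actions are polymorphic in the scalars in order to serve both \<open>\<int>\<^sup>r\<close> and \<open>\<real>\<^sup>r\<close>.
\<close>

type_synonym weight = "nat \<Rightarrow>\<^sub>0 int"

definition vecs :: "nat \<Rightarrow> (nat \<Rightarrow>\<^sub>0 'a::zero) set" where
  "vecs r = {v. Poly_Mapping.keys v \<subseteq> {1..r}}"

definition unit_vec :: "nat \<Rightarrow> (nat \<Rightarrow>\<^sub>0 'a::zero_neq_one)" where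
  "unit_vec i = Poly_Mapping.single i 1"

definition ip :: "(nat \<Rightarrow>\<^sub>0 'a::comm_ring_1) \<Rightarrow> (nat \<Rightarrow>\<^sub>0 'a) \<Rightarrow> 'a" where
  "ip u v = (\<Sum>i\<in>Poly_Mapping.keys u. Poly_Mapping.lookup u i * Poly_Mapping.lookup v i)"

definition scale :: "int \<Rightarrow> weight \<Rightarrow> weight" where
  "scale c v = Poly_Mapping.map ((*) c) v"

definition eroot :: "nat \<Rightarrow> nat \<Rightarrow> (nat \<Rightarrow>\<^sub>0 'a::comm_ring_1)" where
  "eroot i j = unit_vec i - unit_vec j"

definition roots :: "nat \<Rightarrow> (nat \<Rightarrow>\<^sub>0 'a::comm_ring_1) set" where
  "roots r = {eroot i j | i j. i \<in> {1..r} \<and> j \<in> {1..r} \<and> i \<noteq> j}"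

definition pos_roots :: "nat \<Rightarrow> (nat \<Rightarrow>\<^sub>0 'a::comm_ring_1) set" where
  "pos_roots r = {eroot i j | i j. i \<in> {1..r} \<and> j \<in> {1..r} \<and> i < j}"

definition simple_root :: "nat \<Rightarrow> (nat \<Rightarrow>\<^sub>0 'a::comm_ring_1)" where
  "simple_root i = eroot i (Suc i)"

definition root_lattice :: "nat \<Rightarrow> weight set" where
  "root_lattice r = {\<Sum>\<alpha>\<in>roots r. scale (c \<alpha>) \<alpha> | c. True}"

text \<open>\<open>w\<close> sends \<open>\<epsilon>\<^sub>i\<close> to \<open>\<epsilon>\<^bsub>w(i)\<^esub>\<close>, i.e. \<open>(w v)\<^sub>i\<close> is the coordinate of \<open>v\<close> at \<open>w\<inverse>(i)\<close>.\<close>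

definition perm_act :: "(nat \<Rightarrow> nat) \<Rightarrow> (nat \<Rightarrow>\<^sub>0 'a::zero) \<Rightarrow> (nat \<Rightarrow>\<^sub>0 'a)" where
  "perm_act w v = Poly_Mapping.map_key (inv w) v"

definition simple_refl :: "nat \<Rightarrow> nat \<Rightarrow> nat" where
  "simple_refl i = transpose i (Suc i)"

text \<open>The pair \<open>(\<beta>, w)\<close> stands for \<open>\<tau>(\<beta>) w\<close>.\<close>

type_synonym aff = "weight \<times> (nat \<Rightarrow> nat)"

definition aff_one :: aff where
  "aff_one = (0, id)"

definition aff_mult :: "aff \<Rightarrow> aff \<Rightarrow> aff" where
  "aff_mult u v = (fst u + perm_act (snd u) (fst v), snd u \<circ> snd v)"

definition aff_act :: "aff \<Rightarrow> (nat \<Rightarrow>\<^sub>0 'a::ring_1) \<Rightarrow> (nat \<Rightarrow>\<^sub>0 'a)" where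
  "aff_act u v = Poly_Mapping.map of_int (fst u) + perm_act (snd u) v"

text \<open>\<open>aff_weyl m r\<close> is \<open>m Q \<rtimes> S\<^sub>r\<close>; \<open>m = 1\<close> gives \<open>W\<^sub>C\<^sub>o\<^sub>x\<close> and \<open>m = n\<close> its metaplectic version.\<close>

definition aff_weyl :: "nat \<Rightarrow> nat \<Rightarrow> aff set" where
  "aff_weyl m r = {(scale (int m) \<beta>, w) | \<beta> w. \<beta> \<in> root_lattice r \<and> w permutes {1..r}}"

definition aff_gen :: "nat \<Rightarrow> nat \<Rightarrow> nat \<Rightarrow> aff" where
  "aff_gen m r i =
     (if i = 0 then (scale (int m) (eroot 1 r), transpose 1 r) else (0, simple_refl i))"

definition word_prod :: "('g \<Rightarrow> 'g \<Rightarrow> 'g) \<Rightarrow> 'g \<Rightarrow> (nat \<Rightarrow> 'g) \<Rightarrow> nat list \<Rightarrow> 'g" where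
  "word_prod mul one s ws = foldr (\<lambda>i. mul (s i)) ws one"

definition word_length :: "('g \<Rightarrow> 'g \<Rightarrow> 'g) \<Rightarrow> 'g \<Rightarrow> (nat \<Rightarrow> 'g) \<Rightarrow> nat set \<Rightarrow> 'g \<Rightarrow> nat" where
  "word_length mul one s I g =
     (LEAST l. \<exists>ws. set ws \<subseteq> I \<and> word_prod mul one s ws = g \<and> length ws = l)"

definition reduced_word ::
    "('g \<Rightarrow> 'g \<Rightarrow> 'g) \<Rightarrow> 'g \<Rightarrow> (nat \<Rightarrow> 'g) \<Rightarrow> nat set \<Rightarrow> nat list \<Rightarrow> 'g \<Rightarrow> bool" where
  "reduced_word mul one s I ws g \<longleftrightarrow>
     set ws \<subseteq> I \<and> word_prod mul one s ws = g \<and> length ws = word_length mul one s I g"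

definition aff_length :: "nat \<Rightarrow> nat \<Rightarrow> aff \<Rightarrow> nat" where
  "aff_length m r = word_length aff_mult aff_one (aff_gen m r) {0..<r}"

definition aff_reduced :: "nat \<Rightarrow> nat \<Rightarrow> nat list \<Rightarrow> aff \<Rightarrow> bool" where
  "aff_reduced m r = reduced_word aff_mult aff_one (aff_gen m r) {0..<r}"

definition sym_reduced :: "nat \<Rightarrow> nat list \<Rightarrow> (nat \<Rightarrow> nat) \<Rightarrow> bool" where
  "sym_reduced r = reduced_word (\<circ>) id simple_refl {1..<r}"

definition fund_weights :: "nat \<Rightarrow> nat \<Rightarrow> weight set" where
  "fund_weights r n = {\<nu> \<in> vecs r.
     (\<forall>i\<in>{1..<r}. Poly_Mapping.lookup \<nu> i \<ge> Poly_Mapping.lookup \<nu> (Suc i)) \<and>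
     Poly_Mapping.lookup \<nu> 1 - Poly_Mapping.lookup \<nu> r \<le> int n}"


section \<open>Alcove walks\<close>

definition fund_alcove :: "nat \<Rightarrow> (nat \<Rightarrow>\<^sub>0 real) set" where
  "fund_alcove r = {v \<in> vecs r.
     (\<forall>i\<in>{1..<r}. Poly_Mapping.lookup v i > Poly_Mapping.lookup v (Suc i)) \<and>
     Poly_Mapping.lookup v 1 - Poly_Mapping.lookup v r < 1}"

definition alcove :: "nat \<Rightarrow> aff \<Rightarrow> (nat \<Rightarrow>\<^sub>0 real) set" where
  "alcove r u = aff_act u ` fund_alcove r"

definition on_pos_side :: "(nat \<Rightarrow>\<^sub>0 real) \<Rightarrow> int \<Rightarrow> (nat \<Rightarrow>\<^sub>0 real) set \<Rightarrow> bool" where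
  "on_pos_side \<alpha> s X \<longleftrightarrow> (\<forall>v\<in>X. ip \<alpha> v + of_int s > 0)"

definition on_neg_side :: "(nat \<Rightarrow>\<^sub>0 real) \<Rightarrow> int \<Rightarrow> (nat \<Rightarrow>\<^sub>0 real) set \<Rightarrow> bool" where
  "on_neg_side \<alpha> s X \<longleftrightarrow> (\<forall>v\<in>X. ip \<alpha> v + of_int s < 0)"

definition separates ::
    "(nat \<Rightarrow>\<^sub>0 real) \<Rightarrow> int \<Rightarrow> (nat \<Rightarrow>\<^sub>0 real) set \<Rightarrow> (nat \<Rightarrow>\<^sub>0 real) set \<Rightarrow> bool" where
  "separates \<alpha> s X Y \<longleftrightarrow>
     (on_pos_side \<alpha> s X \<and> on_neg_side \<alpha> s Y) \<or> (on_neg_side \<alpha> s X \<and> on_pos_side \<alpha> s Y)"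

definition alcove_walks :: "nat \<Rightarrow> nat list \<Rightarrow> aff \<Rightarrow> aff list set" where
  "alcove_walks r ws u = {p. length p = Suc (length ws) \<and> p ! 0 = u \<and>
     (\<forall>j\<in>{1..length ws}. p ! j \<in> {p ! (j - 1), aff_mult (p ! (j - 1)) (aff_gen 1 r (ws ! (j - 1)))})}"

definition folds :: "nat list \<Rightarrow> aff list \<Rightarrow> nat set" where
  "folds ws p = {j \<in> {1..length ws}. p ! j = p ! (j - 1)}"

definition pos_folds :: "nat \<Rightarrow> nat list \<Rightarrow> aff list \<Rightarrow> nat set" where
  "pos_folds r ws p = {j \<in> folds ws p. \<exists>\<alpha>\<in>pos_roots r. \<exists>s.
     separates \<alpha> s (alcove r (p ! (j - 1)))
       (alcove r (aff_mult (p ! (j - 1)) (aff_gen 1 r (ws ! (j - 1))))) \<and>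
     on_pos_side \<alpha> s (alcove r (p ! (j - 1)))}"

definition neg_folds :: "nat \<Rightarrow> nat list \<Rightarrow> aff list \<Rightarrow> nat set" where
  "neg_folds r ws p = folds ws p - pos_folds r ws p"

definition base_walks :: "nat \<Rightarrow> nat list \<Rightarrow> aff list set" where
  "base_walks r ws = alcove_walks r ws aff_one"

definition pos_walks :: "nat \<Rightarrow> nat list \<Rightarrow> aff list set" where
  "pos_walks r ws = {p \<in> base_walks r ws. folds ws p \<subseteq> pos_folds r ws p}"

definition neg_walks :: "nat \<Rightarrow> nat list \<Rightarrow> aff list set" where
  "neg_walks r ws = {p \<in> base_walks r ws. folds ws p \<subseteq> neg_folds r ws p}"

definition wt :: "aff list \<Rightarrow> weight" where
  "wt p = fst (last p)"

definition dir :: "aff list \<Rightarrow> (nat \<Rightarrow> nat)" where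
  "dir p = snd (last p)"


section \<open>Parameters\<close>

text \<open>
  \<open>'v ratfun\<close> is the field \<open>\<complex>(X\<^sub>v : v \<in> 'v)\<close>. The field \<open>\<complex>(k, G\<^sub>1, \<dots>, G\<^sub>m)\<close> with
  \<open>m = \<lfloor>(n - 1)/2\<rfloor>\<close> is obtained for an index type \<open>'v\<close> with exactly \<open>m + 1\<close> elements, enumerated
  by a bijection \<open>e\<close> from \<open>{0..m}\<close>. The order on \<open>'v\<close> is only needed by the library for the
  polynomial ring to be an instance of an integral domain.
\<close>

type_synonym 'v ratfun = "(('v \<Rightarrow>\<^sub>0 nat) \<Rightarrow>\<^sub>0 complex) fract"

definition indet :: "'v::linorder \<Rightarrow> 'v ratfun" where
  "indet v = Fract (Poly_Mapping.single (Poly_Mapping.single v 1) 1) 1"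

text \<open>
  The relation \<open>G\<^sub>j G\<^bsub>-j\<^esub> = 1\<close> is imposed for \<open>j\<close> not divisible by \<open>n\<close> only (it would contradict
  \<open>G\<^sub>0 = k\<close> otherwise). For even \<open>n\<close> it yields \<open>G\<^bsub>n/2\<^esub> = \<plusminus>1\<close>, with a sign left arbitrary.
\<close>

definition metaplectic_params :: "nat \<Rightarrow> (nat \<Rightarrow> 'v::linorder) \<Rightarrow> (int \<Rightarrow> 'v ratfun) \<Rightarrow> bool" where
  "metaplectic_params n e G \<longleftrightarrow>
     bij_betw e {0..(n - 1) div 2} UNIV \<and>
     (\<forall>j\<in>{0..(n - 1) div 2}. G (int j) = indet (e j)) \<and>
     (\<forall>j. \<not> int n dvd j \<longrightarrow> G j * G (- j) = 1) \<and>
     (\<forall>i j. i mod int n = j mod int n \<longrightarrow> G i = G j)"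

definition \<sigma> :: "nat \<Rightarrow> (int \<Rightarrow> 'a::field) \<Rightarrow> int \<Rightarrow> 'a" where
  "\<sigma> n G a = (if a > 0 \<and> int n dvd a then inverse (G 0) else G a)"

text \<open>For a field \<open>'a\<close>, the field \<open>'a(q)\<close> is \<open>'a poly fract\<close>.\<close>

definition const :: "'a::field \<Rightarrow> 'a poly fract" where
  "const c = Fract [:c:] 1"

definition qvar :: "'a::field poly fract" where
  "qvar = Fract [:0, 1:] 1"

definition \<gamma> :: "nat \<Rightarrow> nat \<Rightarrow> (int \<Rightarrow> 'a::field) \<Rightarrow> nat \<Rightarrow> weight \<Rightarrow> 'a poly fract" where
  "\<gamma> r n G i \<nu> = qvar powi (- Poly_Mapping.lookup \<nu> i) *
     (\<Prod>\<alpha>\<in>pos_roots r. const (\<sigma> n G (ip \<nu> \<alpha>)) powi (ip (unit_vec i) \<alpha>))"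


section \<open>Metaplectic nonsymmetric Macdonald polynomials\<close>

type_synonym 'f laurent = "weight \<Rightarrow>\<^sub>0 'f"

definition laurent_ring :: "nat \<Rightarrow> 'f::field laurent set" where
  "laurent_ring r = {f. Poly_Mapping.keys f \<subseteq> vecs r}"

definition xpow :: "weight \<Rightarrow> 'f::field laurent" where
  "xpow \<nu> = Poly_Mapping.single \<nu> 1"

definition lsmult :: "'f::field \<Rightarrow> 'f laurent \<Rightarrow> 'f laurent" where
  "lsmult c f = Poly_Mapping.single 0 c * f"

definition lin_ext :: "(weight \<Rightarrow> 'f::field laurent) \<Rightarrow> 'f laurent \<Rightarrow> 'f laurent" where
  "lin_ext F f = (\<Sum>\<nu>\<in>Poly_Mapping.keys f. lsmult (Poly_Mapping.lookup f \<nu>) (F \<nu>))"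

text \<open>The quotient \<open>f / g\<close> when \<open>g \<noteq> 0\<close> divides \<open>f\<close>.\<close>

definition exact_quot :: "'f::field laurent \<Rightarrow> 'f laurent \<Rightarrow> 'f laurent" where
  "exact_quot f g = (THE h. h * g = f)"

definition T :: "nat \<Rightarrow> (int \<Rightarrow> 'a::field) \<Rightarrow> nat \<Rightarrow> 'a poly fract laurent \<Rightarrow> 'a poly fract laurent" where
  "T n G i = lin_ext (\<lambda>\<nu>.
     let a = ip \<nu> (simple_root i); t = a - a mod int n in
     lsmult (const (G 0 - inverse (G 0)))
       (exact_quot (1 - xpow (scale (- t) (simple_root i))) (1 - xpow (scale (int n) (simple_root i)))
        * xpow \<nu>)
     + lsmult (const (G a)) (xpow (perm_act (simple_refl i) \<nu>)))"

definition T_inv :: "nat \<Rightarrow> nat \<Rightarrow> (int \<Rightarrow> 'a::field) \<Rightarrow> nat \<Rightarrow>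
    'a poly fract laurent \<Rightarrow> 'a poly fract laurent" where
  "T_inv r n G i = the_inv_into (laurent_ring r) (T n G i)"

text \<open>\<open>(\<nu>\<^sub>1, \<dots>, \<nu>\<^sub>r)\<close> becomes \<open>(\<nu>\<^sub>r, \<nu>\<^sub>1, \<dots>, \<nu>\<^bsub>r-1\<^esub>)\<close>.\<close>

definition rotate_weight :: "nat \<Rightarrow> weight \<Rightarrow> weight" where
  "rotate_weight r = perm_act (\<lambda>i. if i = r then 1 else if i \<in> {1..<r} then Suc i else i)"

definition omega :: "nat \<Rightarrow> 'a::field poly fract laurent \<Rightarrow> 'a poly fract laurent" where
  "omega r = lin_ext (\<lambda>\<nu>. lsmult (qvar powi (- Poly_Mapping.lookup \<nu> r)) (xpow (rotate_weight r \<nu>)))"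

definition Y :: "nat \<Rightarrow> nat \<Rightarrow> (int \<Rightarrow> 'a::field) \<Rightarrow> nat \<Rightarrow>
    'a poly fract laurent \<Rightarrow> 'a poly fract laurent" where
  "Y r n G i f = fold (T_inv r n G) [1..<i] (omega r (fold (T n G) [i..<r] f))"

definition E_poly :: "nat \<Rightarrow> nat \<Rightarrow> (int \<Rightarrow> 'a::field) \<Rightarrow> weight \<Rightarrow> 'a poly fract laurent" where
  "E_poly r n G \<mu> = (THE f. f \<in> laurent_ring r \<and> Poly_Mapping.lookup f \<mu> = 1 \<and>
     (\<forall>i\<in>{1..r}. Y r n G i f = lsmult (\<gamma> r n G i \<mu>) f))"


section \<open>Limits in q\<close>

text \<open>
  Values of a rational function \<open>f \<in> 'a(q)\<close> at \<open>q = 0\<close> and \<open>q = \<infinity>\<close>; the limit exists iff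
  \<open>f\<close> is regular at that point.
\<close>

definition lim_q_0 :: "'a::field poly fract \<Rightarrow> 'a \<Rightarrow> bool" where
  "lim_q_0 f c \<longleftrightarrow> (\<exists>a b. poly b 0 \<noteq> 0 \<and> f = Fract a b \<and> c = poly a 0 / poly b 0)"

definition lim_q_inf :: "'a::field poly fract \<Rightarrow> 'a \<Rightarrow> bool" where
  "lim_q_inf f c \<longleftrightarrow> (\<exists>a b. b \<noteq> 0 \<and> f = Fract a b \<and> degree a \<le> degree b \<and>
     c = coeff a (degree b) / coeff b (degree b))"

lemma lim_q_0_unique:
  assumes "lim_q_0 f c" "lim_q_0 f d"
  shows "c = d"
proof -
  obtain a b where 1: "poly b 0 \<noteq> 0" "f = Fract a b" "c = poly a 0 / poly b 0"
    using assms(1) unfolding lim_q_0_def by blast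
  obtain a' b' where 2: "poly b' 0 \<noteq> 0" "f = Fract a' b'" "d = poly a' 0 / poly b' 0"
    using assms(2) unfolding lim_q_0_def by blast
  have "b \<noteq> 0" "b' \<noteq> 0" using 1 2 by auto
  then have "a * b' = a' * b" using 1(2) 2(2) by (simp add: eq_fract)
  then have "poly a 0 * poly b' 0 = poly a' 0 * poly b 0" by (metis poly_mult)
  then show ?thesis unfolding 1(3) 2(3) using 1(1) 2(1) by (simp add: frac_eq_eq)
qed

lemma lim_q_inf_unique:
  assumes "lim_q_inf f c" "lim_q_inf f d"
  shows "c = d"
proof -
  obtain a b where 1: "b \<noteq> 0" "f = Fract a b" "degree a \<le> degree b"
      "c = coeff a (degree b) / coeff b (degree b)"
    using assms(1) unfolding lim_q_inf_def by blast
  obtain a' b' where 2: "b' \<noteq> 0" "f = Fract a' b'" "degree a' \<le> degree b'"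
      "d = coeff a' (degree b') / coeff b' (degree b')"
    using assms(2) unfolding lim_q_inf_def by blast
  have top: "coeff (p * q) (m + l) = coeff p m * coeff q l"
    if "degree p \<le> m" "degree q \<le> l" for p q :: "'a poly" and m l
  proof -
    have "coeff p i * coeff q (m + l - i) = 0" if "i \<noteq> m" "i \<le> m + l" for i
      using that \<open>degree p \<le> m\<close> \<open>degree q \<le> l\<close>
      by (cases "i < m") (auto intro: coeff_eq_0)
    then have "(\<Sum>i\<le>m + l. coeff p i * coeff q (m + l - i)) = (\<Sum>i\<in>{m}. coeff p i * coeff q (m + l - i))"
      by (intro sum.mono_neutral_right) auto
    then show ?thesis by (simp add: coeff_mult)
  qed
  have "a * b' = a' * b" using 1 2 by (simp add: eq_fract)
  then have "coeff a (degree b) * coeff b' (degree b') = coeff a' (degree b') * coeff b (degree b)"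
    using top[of a "degree b" b' "degree b'"] top[of a' "degree b'" b "degree b"] 1(3) 2(3)
    by (simp add: add.commute)
  then show ?thesis unfolding 1(4) 2(4) using 1(1) 2(1) by (simp add: frac_eq_eq)
qed

definition coeff_lim_0 :: "'a::field poly fract laurent \<Rightarrow> 'a laurent \<Rightarrow> bool" where
  "coeff_lim_0 f g \<longleftrightarrow> (\<forall>\<nu>. lim_q_0 (Poly_Mapping.lookup f \<nu>) (Poly_Mapping.lookup g \<nu>))"

definition coeff_lim_inf :: "'a::field poly fract laurent \<Rightarrow> 'a laurent \<Rightarrow> bool" where
  "coeff_lim_inf f g \<longleftrightarrow> (\<forall>\<nu>. lim_q_inf (Poly_Mapping.lookup f \<nu>) (Poly_Mapping.lookup g \<nu>))"


section \<open>Data of the formula\<close>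

definition minimal_pair :: "nat \<Rightarrow> nat \<Rightarrow> weight \<Rightarrow> weight \<Rightarrow> aff \<Rightarrow> bool" where
  "minimal_pair r n \<mu> \<nu> w \<longleftrightarrow>
     \<nu> \<in> fund_weights r n \<and> w \<in> aff_weyl n r \<and> aff_act w \<nu> = \<mu> \<and>
     (\<forall>w'\<in>aff_weyl n r. aff_act w' \<nu> = \<mu> \<longrightarrow> aff_length n r w \<le> aff_length n r w')"

text \<open>
  For \<open>us = [u\<^sub>1, \<dots>, u\<^sub>t]\<close>, the factor of \<open>u\<^sub>a\<close> (at list position \<open>a - 1\<close>) is
  \<open>\<sigma>((\<nu>, s\<^bsub>u\<^sub>t\<^esub> \<dots> s\<^bsub>u\<^sub>a\<^sub>+\<^sub>1\<^esub> \<alpha>\<^bsub>u\<^sub>a\<^esub>))\<close>.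
\<close>

definition Sigma_word :: "nat \<Rightarrow> (int \<Rightarrow> 'a::field) \<Rightarrow> weight \<Rightarrow> nat list \<Rightarrow> 'a" where
  "Sigma_word n G \<nu> us = (\<Prod>a<length us.
     \<sigma> n G (ip \<nu> (perm_act (word_prod (\<circ>) id simple_refl (rev (drop (Suc a) us)))
                   (simple_root (us ! a)))))"

end

theory Submission
  imports Defs
begin

text \<open>
  Put \<open>g = x\<^sub>1\<^sup>n T\<^sub>1 \<cdots> T\<^bsub>r-1\<^esub>\<close> and \<open>T\<^sub>0 = g T\<^bsub>r-1\<^esub> g\<inverse>\<close>; none of \<open>T\<^sub>0, \<dots>, T\<^bsub>r-1\<^esub>\<close> involves
  \<open>q\<close>. For a suitable scalar \<open>c\<close>, a rational function of a ratio of eigenvalues of the \<open>Y\<^sub>j\<close>, the operator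
  \<open>T\<^sub>i + c\<close> maps common eigenvectors of the \<open>Y\<^sub>j\<close> to common eigenvectors. Hence a multiple of \<open>E\<^sub>\<mu>\<close> is
  \<open>(T\<^bsub>i(1)\<^esub> + c\<^sub>1) \<cdots> (T\<^bsub>i(l)\<^esub> + c\<^sub>l) x\<^sup>\<lambda>\<close>. Expanding this product in the basis \<open>x\<^bsup>n\<beta>\<^esup> T\<^sub>v\<close> of the
  affine Hecke algebra gives a sum over alcove walks in which a positive fold at \<open>j\<close> contributes \<open>c\<^sub>j\<close> and
  a negative one \<open>c\<^sub>j + k - k\<inverse>\<close>. As \<open>c\<^sub>j\<close> tends to \<open>k\<inverse> - k\<close> for \<open>q \<rightarrow> 0\<close> and to \<open>0\<close> for
  \<open>q \<rightarrow> \<infinity>\<close>, only folds of one sign survive in each limit. Minimality of \<open>w\<close> ensures that only the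
  unfolded walk contributes to \<open>x\<^sup>\<mu>\<close>, so the multiple is \<open>\<Sigma>\<close> of that walk; comparing powers of \<open>q\<close> in
  the eigenvalues shows that the eigenvector is unique.
\<close>

text \<open>The two eigenvalues that enter the step with generator s_i have ratio C q^(-d), where C
  is free of q and d is the value at the current weight of the affine root of s_i. The eigenvector
  condition forces c = (k - k^(-1)) C / (q^d - C), so d > 0 decides both limits. Minimality of w is
  thus used at every letter and not only for the top coefficient: an exchange argument for words
  acting on the starting weight gives d > 0 throughout.

  The quotient in T_i depends on exponents modulo n, which obscures the Hecke relations. They are,
  however, compatible with multiplication by x_j^n; this reduces them to exponents in [0,n), where
  the quotient is 0 or 1 and T_i is a two by two matrix.

  The values of \<sigma> jump between 0 and n, so the eigenvalues are permuted by a generator only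
  off its wall. Uniqueness is not visible from a single eigenvector: eigenvectors are produced for
  every weight, shown to span, and separated by their eigenvalues.\<close>

notation Poly_Mapping.lookup (infixl "\<cdot>" 90)

section \<open>Coordinates, pairings and the action of permutations on vectors\<close>

lemma lookup_unit_vec: "unit_vec i \<cdot> j = (if j = i then 1 else 0)"
  by (simp add: unit_vec_def lookup_single when_def)

lemma lookup_eroot: "eroot i j \<cdot> l = (if l = i then 1 else 0) - (if l = j then 1 else 0)"
  by (simp add: eroot_def lookup_minus lookup_unit_vec)

lemma lookup_simple_root:
  "simple_root i \<cdot> l = (if l = i then 1 else 0) - (if l = Suc i then 1 else 0)"
  by (simp add: simple_root_def lookup_eroot)

lemma lookup_scale [simp]: "scale c v \<cdot> i = c * v \<cdot> i"
  by (simp add: scale_def Poly_Mapping.map.rep_eq when_def)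

lemma scale_add: "scale c (u + v) = scale c u + scale c v"
  by (rule poly_mapping_eqI) (simp add: lookup_add algebra_simps)

lemma scale_add_left: "scale (a + b) v = scale a v + scale b v"
  by (rule poly_mapping_eqI) (simp add: lookup_add algebra_simps)

lemma scale_1 [simp]: "scale 1 v = v"
  by (rule poly_mapping_eqI) simp

lemma scale_0_left [simp]: "scale 0 v = 0"
  by (rule poly_mapping_eqI) simp

lemma scale_0_right [simp]: "scale c 0 = 0"
  by (rule poly_mapping_eqI) simp

lemma scale_minus_left: "scale (- c) v = - scale c v"
  by (rule poly_mapping_eqI) simp

lemma ip_eq_sum:
  assumes "finite A" "Poly_Mapping.keys u \<subseteq> A"
  shows "ip u v = (\<Sum>i\<in>A. u \<cdot> i * v \<cdot> i)"
  unfolding ip_def using assms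
  by (intro sum.mono_neutral_left) (auto simp: in_keys_iff)

lemma ip_eroot_right: "ip v (eroot i j) = v \<cdot> i - v \<cdot> j"
proof -
  have "ip v (eroot i j) = (\<Sum>l\<in>Poly_Mapping.keys v \<union> {i, j}. v \<cdot> l * eroot i j \<cdot> l)"
    by (rule ip_eq_sum) auto
  also have "\<dots> = (\<Sum>l\<in>Poly_Mapping.keys v \<union> {i, j}. (if l = i then v \<cdot> l else 0) - (if l = j then v \<cdot> l else 0))"
    by (intro sum.cong) (auto simp: lookup_eroot algebra_simps)
  also have "\<dots> = v \<cdot> i - v \<cdot> j"
    by (simp add: sum_subtractf)
  finally show ?thesis .
qed

lemma ip_commute: "ip u v = ip v u"
  using ip_eq_sum[of "Poly_Mapping.keys u \<union> Poly_Mapping.keys v" u v]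
    ip_eq_sum[of "Poly_Mapping.keys u \<union> Poly_Mapping.keys v" v u]
  by (simp add: mult.commute)

lemma ip_eroot_left: "ip (eroot i j) v = v \<cdot> i - v \<cdot> j"
  by (subst ip_commute) (rule ip_eroot_right)

lemma ip_simple_root: "ip v (simple_root i) = v \<cdot> i - v \<cdot> Suc i"
  by (simp add: simple_root_def ip_eroot_right)

lemma lookup_perm_act:
  assumes "bij w"
  shows "perm_act w v \<cdot> i = v \<cdot> inv w i"
  using assms by (simp add: perm_act_def Poly_Mapping.map_key.rep_eq bij_imp_bij_inv bij_is_inj)

lemma bij_simple_refl [simp]: "bij (simple_refl i)"
  by (simp add: simple_refl_def)

lemma inv_simple_refl [simp]: "inv (simple_refl i) = simple_refl i"
  by (simp add: simple_refl_def)

lemma simple_refl_simple_refl [simp]: "simple_refl i (simple_refl i x) = x"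
  by (simp add: simple_refl_def)

lemma simple_refl_apply:
  "simple_refl i x = (if x = i then Suc i else if x = Suc i then i else x)"
  by (simp add: simple_refl_def transpose_def)

lemma lookup_perm_act_simple_refl [simp]: "perm_act (simple_refl i) v \<cdot> j = v \<cdot> simple_refl i j"
  by (simp add: lookup_perm_act)

lemma perm_act_simple_refl_eq:
  "perm_act (simple_refl i) v = v - scale (v \<cdot> i - v \<cdot> Suc i) (simple_root i)"
  by (rule poly_mapping_eqI) (auto simp: lookup_minus lookup_simple_root simple_refl_apply)

lemma perm_act_id [simp]: "perm_act id v = v"
  by (rule poly_mapping_eqI) (simp add: lookup_perm_act)

lemma perm_act_comp:
  assumes "bij w" "bij w'"
  shows "perm_act (w \<circ> w') v = perm_act w (perm_act w' v)"
  using assms by (intro poly_mapping_eqI) (simp add: lookup_perm_act bij_comp o_inv_distrib)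

lemma perm_act_add: "bij w \<Longrightarrow> perm_act w (u + v) = perm_act w u + perm_act w v"
  by (intro poly_mapping_eqI) (simp add: lookup_perm_act lookup_add)

lemma perm_act_0: "bij w \<Longrightarrow> perm_act w 0 = 0"
  by (intro poly_mapping_eqI) (simp add: lookup_perm_act)

lemma perm_act_scale: "bij w \<Longrightarrow> perm_act w (scale c v) = scale c (perm_act w v)"
  by (intro poly_mapping_eqI) (simp add: lookup_perm_act)

lemma inv_eq_iff_eq: "bij w \<Longrightarrow> inv w x = y \<longleftrightarrow> x = w y"
  by (metis bij_inv_eq_iff)

lemma perm_act_unit_vec: "bij w \<Longrightarrow> perm_act w (unit_vec i) = unit_vec (w i)"
  by (rule poly_mapping_eqI) (simp add: lookup_perm_act lookup_unit_vec inv_eq_iff_eq)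

lemma perm_act_eroot: "bij w \<Longrightarrow> perm_act w (eroot i j) = eroot (w i) (w j)"
  by (rule poly_mapping_eqI) (simp add: lookup_perm_act lookup_eroot inv_eq_iff_eq)

lemma vecs_iff: "v \<in> vecs r \<longleftrightarrow> (\<forall>i. i \<notin> {1..r} \<longrightarrow> v \<cdot> i = 0)"
  by (auto simp: vecs_def in_keys_iff)

lemma perm_act_vecs: "w permutes {1..r} \<Longrightarrow> v \<in> vecs r \<Longrightarrow> perm_act w v \<in> vecs r"
  using permutes_not_in[OF permutes_inv, of w "{1..r}"]
  by (auto simp: vecs_iff lookup_perm_act permutes_bij)

lemma vecs_add: "u \<in> vecs r \<Longrightarrow> v \<in> vecs r \<Longrightarrow> (u + v :: nat \<Rightarrow>\<^sub>0 'a::comm_monoid_add) \<in> vecs r"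
  by (simp add: vecs_iff lookup_add)

lemma vecs_scale: "v \<in> vecs r \<Longrightarrow> scale c v \<in> vecs r"
  by (simp add: vecs_iff)

lemma simple_refl_permutes: "i \<in> {1..<r} \<Longrightarrow> simple_refl i permutes {1..r}"
  unfolding simple_refl_def by (rule permutes_swap_id) auto

section \<open>Linear operators on Laurent polynomials\<close>

lemma lookup_lsmult [simp]: "lsmult c f \<cdot> \<nu> = c * f \<cdot> \<nu>"
  unfolding lsmult_def mult_map_scale_conv_mult[symmetric]
  by (simp add: Poly_Mapping.map.rep_eq when_def)

lemma lookup_xpow: "xpow \<nu> \<cdot> \<kappa> = (if \<kappa> = \<nu> then 1 else 0)"
  by (simp add: xpow_def lookup_single when_def)

lemma lsmult_add_right: "lsmult c (f + g) = lsmult c f + lsmult c g"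
  by (simp add: lsmult_def algebra_simps)

lemma lsmult_diff_right: "lsmult c (f - g) = lsmult c f - lsmult c g"
  by (simp add: lsmult_def algebra_simps)

lemma lsmult_add_left: "lsmult (a + b) f = lsmult a f + lsmult b f"
  by (simp add: lsmult_def algebra_simps single_add)

lemma lsmult_diff_left: "lsmult (a - b) f = lsmult a f - lsmult b f"
  by (simp add: lsmult_def algebra_simps single_diff)

lemma lsmult_lsmult [simp]: "lsmult a (lsmult b f) = lsmult (a * b) f"
  by (simp add: lsmult_def mult_single mult.assoc[symmetric])

lemma lsmult_1 [simp]: "lsmult 1 f = f"
  by (simp add: lsmult_def)

lemma lsmult_0_left [simp]: "lsmult 0 f = 0"
  by (simp add: lsmult_def)

lemma lsmult_0_right [simp]: "lsmult c 0 = 0"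
  by (simp add: lsmult_def)

lemma lsmult_mult_right: "f * lsmult c g = lsmult c (f * g)"
  by (simp add: lsmult_def mult.left_commute)

lemma lsmult_sum_right: "lsmult c (sum f A) = (\<Sum>a\<in>A. lsmult c (f a))"
  by (simp add: lsmult_def sum_distrib_left)

lemma lsmult_cancel: "c \<noteq> 0 \<Longrightarrow> lsmult c f = lsmult c g \<longleftrightarrow> f = g"
  by (auto simp: poly_mapping_eq_iff fun_eq_iff)

lemma xpow_mult: "xpow a * xpow b = xpow (a + b)"
  by (simp add: xpow_def mult_single)

lemma xpow_mult_assoc: "xpow a * (xpow b * f) = xpow (a + b) * f"
  by (simp add: xpow_mult mult.assoc[symmetric])

lemma xpow_0 [simp]: "xpow 0 = 1"
  by (simp add: xpow_def)

lemma laurent_expand: "f = (\<Sum>\<nu>\<in>Poly_Mapping.keys f. lsmult (f \<cdot> \<nu>) (xpow \<nu>))"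
proof (rule poly_mapping_eqI)
  fix \<kappa>
  have "(\<Sum>\<nu>\<in>Poly_Mapping.keys f. lsmult (f \<cdot> \<nu>) (xpow \<nu>)) \<cdot> \<kappa> =
      (\<Sum>\<nu>\<in>Poly_Mapping.keys f. if \<nu> = \<kappa> then f \<cdot> \<nu> else 0)"
    unfolding lookup_sum by (intro sum.cong) (auto simp: lookup_xpow)
  also have "\<dots> = f \<cdot> \<kappa>"
    by (simp add: in_keys_iff)
  finally show "f \<cdot> \<kappa> = (\<Sum>\<nu>\<in>Poly_Mapping.keys f. lsmult (f \<cdot> \<nu>) (xpow \<nu>)) \<cdot> \<kappa>" ..
qed

text \<open>A predicate on plain functions: the operators are defined through \<open>lin_ext\<close>
  on Laurent polynomials with arbitrary exponents, so no carrier appears in the relations between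
  them.\<close>

definition lin :: "('f::field laurent \<Rightarrow> 'f laurent) \<Rightarrow> bool" where
  "lin F \<longleftrightarrow> (\<forall>f g. F (f + g) = F f + F g) \<and> (\<forall>c f. F (lsmult c f) = lsmult c (F f))"

lemma linI:
  "(\<And>f g. F (f + g) = F f + F g) \<Longrightarrow> (\<And>c f. F (lsmult c f) = lsmult c (F f)) \<Longrightarrow> lin F"
  by (simp add: lin_def)

lemma lin_add: "lin F \<Longrightarrow> F (f + g) = F f + F g"
  and lin_scale: "lin F \<Longrightarrow> F (lsmult c f) = lsmult c (F f)"
  by (simp_all add: lin_def)

lemma lin_0: "lin F \<Longrightarrow> F 0 = 0"
  using lin_scale[of F 0 0] by simp

lemma lin_diff: "lin F \<Longrightarrow> F (f - g) = F f - F g"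
  using lin_add[of F "f - g" g] by (simp add: algebra_simps)

lemma lin_sum: "lin F \<Longrightarrow> F (sum h A) = (\<Sum>a\<in>A. F (h a))"
  by (induction A rule: infinite_finite_induct) (simp_all add: lin_0 lin_add)

lemma lin_id: "lin (\<lambda>f. f)"
  by (rule linI) simp_all

lemma lin_plus: "lin F \<Longrightarrow> lin H \<Longrightarrow> lin (\<lambda>f. F f + H f)"
  by (rule linI) (simp_all add: lin_add lin_scale lsmult_add_right algebra_simps)

lemma lin_minus: "lin F \<Longrightarrow> lin H \<Longrightarrow> lin (\<lambda>f. F f - H f)"
  by (rule linI) (simp_all add: lin_add lin_scale lsmult_diff_right algebra_simps)

lemma lin_lsmult: "lin F \<Longrightarrow> lin (\<lambda>f. lsmult c (F f))"
  by (rule linI) (simp_all add: lin_add lin_scale lsmult_add_right mult.commute)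

lemma lin_mult: "lin F \<Longrightarrow> lin (\<lambda>f. g * F f)"
  by (rule linI) (simp_all add: lin_add lin_scale algebra_simps lsmult_mult_right)

lemma lin_compose: "lin F \<Longrightarrow> lin H \<Longrightarrow> lin (\<lambda>f. F (H f))"
  by (rule linI) (simp_all add: lin_add lin_scale)

lemma lin_ext_xpow [simp]: "lin_ext F (xpow \<nu>) = F \<nu>"
  by (simp add: lin_ext_def xpow_def)

lemma lin_lin_ext: "lin (lin_ext F)"
proof (rule linI)
  have expand: "lin_ext F f = (\<Sum>\<nu>\<in>A. lsmult (f \<cdot> \<nu>) (F \<nu>))"
    if "finite A" "Poly_Mapping.keys f \<subseteq> A" for A f
    unfolding lin_ext_def using that by (intro sum.mono_neutral_left) (auto simp: in_keys_iff)
  show "lin_ext F (f + g) = lin_ext F f + lin_ext F g" for f g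
    using expand[of "Poly_Mapping.keys f \<union> Poly_Mapping.keys g" "f + g"]
      expand[of "Poly_Mapping.keys f \<union> Poly_Mapping.keys g" f]
      expand[of "Poly_Mapping.keys f \<union> Poly_Mapping.keys g" g] Poly_Mapping.keys_add[of f g]
    by (simp add: lookup_add lsmult_add_left sum.distrib)
  show "lin_ext F (lsmult c f) = lsmult c (lin_ext F f)" for c f
  proof -
    have "Poly_Mapping.keys (lsmult c f) \<subseteq> Poly_Mapping.keys f"
      by (auto simp: in_keys_iff)
    from expand[OF _ this] show ?thesis
      by (simp add: lsmult_sum_right lin_ext_def)
  qed
qed

lemma lin_eqI:
  assumes "lin F" "lin H" "\<And>\<nu>. F (xpow \<nu>) = H (xpow \<nu>)"
  shows "F f = H f"
proof -
  have "F f = (\<Sum>\<nu>\<in>Poly_Mapping.keys f. lsmult (f \<cdot> \<nu>) (F (xpow \<nu>)))" if "lin F" for F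
    using arg_cong[OF laurent_expand, of F f] that by (simp add: lin_sum lin_scale)
  from this[OF assms(1)] this[OF assms(2)] show ?thesis by (simp add: assms(3))
qed

text \<open>
  An operator that intertwines the multiplications by \<open>x\<^sub>j\<^sup>n\<close> with invertible operators is
  determined by its values on one monomial per residue class of the exponents.
\<close>

lemma lin_vanish:
  fixes D :: "'f::field laurent \<Rightarrow> 'f laurent" and n :: nat
  assumes "finite J" "lin D" "n \<ge> 1"
    and shift: "\<And>j. j \<in> J \<Longrightarrow>
      \<exists>c \<beta>. c \<noteq> 0 \<and> (\<forall>f. D (xpow (scale (int n) (unit_vec j)) * f) = lsmult c (xpow \<beta> * D f))"
    and window: "\<And>\<nu>. (\<And>j. j \<in> J \<Longrightarrow> 0 \<le> \<nu> \<cdot> j \<and> \<nu> \<cdot> j < int n) \<Longrightarrow> D (xpow \<nu>) = 0"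
  shows "D f = 0"
proof -
  define e where "e j = scale (int n) (unit_vec j)" for j
  \<comment> \<open>Multiplication by a monomial and by a nonzero scalar is injective, so vanishing
    is unaffected by a shift by n in a coordinate of \<open>J\<close>.\<close>
  have step: "D (xpow (\<nu> + e j)) = 0 \<longleftrightarrow> D (xpow \<nu>) = 0" if j: "j \<in> J" for j \<nu>
  proof -
    obtain c \<beta> where c: "c \<noteq> 0" and D: "\<And>f. D (xpow (e j) * f) = lsmult c (xpow \<beta> * D f)"
      using shift[OF j] unfolding e_def by blast
    have "xpow \<beta> * g = 0 \<longleftrightarrow> g = 0" for g :: "'f laurent"
      by (simp add: xpow_def) (metis single_one lookup_single_eq lookup_zero zero_neq_one)
    moreover have "D (xpow (\<nu> + e j)) = lsmult c (xpow \<beta> * D (xpow \<nu>))"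
      using D[of "xpow \<nu>"] by (simp add: xpow_mult add.commute)
    ultimately show ?thesis
      using lsmult_cancel[OF c, of _ 0] by simp
  qed
  have steps: "D (xpow (\<nu> + scale m (e j))) = 0 \<longleftrightarrow> D (xpow \<nu>) = 0" if j: "j \<in> J" for j \<nu> m
  proof (induction m rule: int_induct[where k = 0])
    case (step1 i)
    have "\<nu> + scale (i + 1) (e j) = (\<nu> + scale i (e j)) + e j"
      by (simp add: scale_add_left add.assoc)
    then show ?case using step1 step[OF j] by metis
  next
    case (step2 i)
    have "\<nu> + scale i (e j) = (\<nu> + scale (i - 1) (e j)) + e j"
      using scale_add_left[of "i - 1" 1 "e j"] by (simp add: add.assoc)
    then show ?case using step2 step[OF j] by metis
  qed simp
  have "D (xpow \<nu>) = 0" for \<nu>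
  proof -
    \<comment> \<open>The coordinates in \<open>J\<close> are reduced modulo n one at a time; a
      shift in coordinate \<open>a\<close> leaves the others alone, so the window condition
      accumulates.\<close>
    have "\<exists>\<nu>'. (D (xpow \<nu>') = 0 \<longleftrightarrow> D (xpow \<nu>) = 0) \<and> (\<forall>j\<in>A. 0 \<le> \<nu>' \<cdot> j \<and> \<nu>' \<cdot> j < int n)"
      if "A \<subseteq> J" for A
      using finite_subset[OF that \<open>finite J\<close>] that
    proof (induction A rule: finite_induct)
      case (insert a A)
      then obtain \<nu>' where \<nu>': "D (xpow \<nu>') = 0 \<longleftrightarrow> D (xpow \<nu>) = 0"
          "\<forall>j\<in>A. 0 \<le> \<nu>' \<cdot> j \<and> \<nu>' \<cdot> j < int n"
        by auto
      let ?\<kappa> = "\<nu>' + scale (- (\<nu>' \<cdot> a div int n)) (e a)"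
      have "?\<kappa> \<cdot> a = \<nu>' \<cdot> a mod int n"
        by (simp add: lookup_add e_def lookup_unit_vec minus_div_mult_eq_mod[symmetric])
      moreover have "?\<kappa> \<cdot> j = \<nu>' \<cdot> j" if "j \<noteq> a" for j
        using that by (simp add: lookup_add e_def lookup_unit_vec)
      moreover have "D (xpow ?\<kappa>) = 0 \<longleftrightarrow> D (xpow \<nu>) = 0"
        using steps[of a \<nu>' "- (\<nu>' \<cdot> a div int n)"] insert.prems \<nu>'(1) by blast
      moreover have "0 \<le> \<nu>' \<cdot> a mod int n \<and> \<nu>' \<cdot> a mod int n < int n"
        using \<open>n \<ge> 1\<close> by simp
      ultimately have "0 \<le> ?\<kappa> \<cdot> j \<and> ?\<kappa> \<cdot> j < int n" if "j \<in> insert a A" for j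
        using \<nu>'(2) that by (cases "j = a") simp_all
      with \<open>D (xpow ?\<kappa>) = 0 \<longleftrightarrow> D (xpow \<nu>) = 0\<close> show ?case by blast
    qed auto
    from this[of J] window show ?thesis by blast
  qed
  then show ?thesis
    by (rule lin_eqI[where H = "\<lambda>f. 0", rotated 2]) (use \<open>lin D\<close> in \<open>auto intro: linI\<close>)
qed

section \<open>Scalars free of q, and exact quotients of Laurent polynomials\<close>

lemma const_diff: "const (a - b) = const a - const b"
  by (simp add: const_def)

lemma const_mult: "const (a * b) = const a * const b"
  by (simp add: const_def mult.commute)

lemma const_0 [simp]: "const 0 = 0"
  by (simp add: const_def Zero_fract_def)

lemma const_1 [simp]: "const 1 = 1"
  by (simp add: const_def One_fract_def one_pCons)

lemma const_eq_iff [simp]: "const a = const b \<longleftrightarrow> a = b"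
  by (simp add: const_def eq_fract)

lemma const_eq_0_iff [simp]: "const a = 0 \<longleftrightarrow> a = 0"
  using const_eq_iff[of a 0] by simp

lemma const_inverse: "const (inverse a) = inverse (const a)"
proof (cases "a = 0")
  case False
  then have "const a * const (inverse a) = 1"
    by (simp flip: const_mult)
  then show ?thesis by (metis inverse_unique)
qed simp

lemma const_prod: "const (prod f A) = (\<Prod>a\<in>A. const (f a))"
  by (induction A rule: infinite_finite_induct) (simp_all add: const_mult)

text \<open>Laurent polynomials over a field form an integral domain, so a nonzero divisor
  determines the quotient and the definite description is legitimate.\<close>

lemma exact_quot_eqI:
  fixes f g h :: "'f::field laurent"
  assumes "g \<noteq> 0" "h * g = f"
  shows "exact_quot f g = h"
  unfolding exact_quot_def using assms by (intro the_equality) auto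

text \<open>The quotient \<open>(1 - x\<^bsup>-t\<alpha>\<^esup>) / (1 - x\<^bsup>n\<alpha>\<^esup>)\<close> in the definition of \<^const>\<open>T\<close>.\<close>

definition div_diff :: "nat \<Rightarrow> nat \<Rightarrow> int \<Rightarrow> 'f::field laurent" where
  "div_diff n i t = exact_quot (1 - xpow (scale (- t) (simple_root i)))
     (1 - xpow (scale (int n) (simple_root i)))"

lemma one_minus_xpow_simple_root:
  assumes "n \<ge> 1"
  shows "(1 - xpow (scale (int n) (simple_root i)) :: 'f::field laurent) \<noteq> 0"
proof
  assume "(1 - xpow (scale (int n) (simple_root i)) :: 'f laurent) = 0"
  then have "(xpow 0 :: 'f laurent) = xpow (scale (int n) (simple_root i))" by simp
  then have "scale (int n) (simple_root i) \<cdot> i = 0"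
    unfolding xpow_def by (metis (no_types, lifting) lookup_single_eq lookup_single_not_eq lookup_zero zero_neq_one)
  then show False using assms by (simp add: lookup_simple_root)
qed

text \<open>For t = nm the quotient is a finite geometric sum up to sign. Induction on m in both
  directions from 0 replaces the explicit sum, whose shape depends on the sign of m; each step
  multiplies the previous quotient by a monomial and corrects by a monomial.\<close>

lemma div_diff_mult:
  assumes "n \<ge> 1"
  shows "div_diff n i (int n * m) * (1 - xpow (scale (int n) (simple_root i))) =
    (1 - xpow (scale (- (int n * m)) (simple_root i)) :: 'f::field laurent)"
proof -
  let ?\<alpha> = "scale (int n) (simple_root i)"
  have ex: "\<exists>h::'f laurent. h * (1 - xpow ?\<alpha>) = 1 - xpow (scale (- m) ?\<alpha>)"
  proof (induction m rule: int_induct[where k = 0])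
    case base
    show ?case by (intro exI[of _ 0]) simp
  next
    case (step1 i)
    then obtain h :: "'f laurent" where h: "h * (1 - xpow ?\<alpha>) = 1 - xpow (scale (- i) ?\<alpha>)" by blast
    have "(xpow (- ?\<alpha>) * h - xpow (- ?\<alpha>)) * (1 - xpow ?\<alpha>) =
        xpow (- ?\<alpha>) * (h * (1 - xpow ?\<alpha>)) - xpow (- ?\<alpha>) + xpow (- ?\<alpha>) * xpow ?\<alpha>"
      by (simp add: algebra_simps)
    also have "\<dots> = 1 - xpow (- ?\<alpha> + scale (- i) ?\<alpha>)"
      unfolding h by (simp add: right_diff_distrib xpow_mult)
    also have "- ?\<alpha> + scale (- i) ?\<alpha> = scale (- (i + 1)) ?\<alpha>"
      by (rule poly_mapping_eqI) (simp add: lookup_add lookup_minus algebra_simps)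
    finally show ?case by blast
  next
    case (step2 i)
    then obtain h :: "'f laurent" where h: "h * (1 - xpow ?\<alpha>) = 1 - xpow (scale (- i) ?\<alpha>)" by blast
    have "(xpow ?\<alpha> * h + 1) * (1 - xpow ?\<alpha>) = xpow ?\<alpha> * (h * (1 - xpow ?\<alpha>)) + 1 - xpow ?\<alpha>"
      by (simp add: algebra_simps)
    also have "\<dots> = 1 - xpow (?\<alpha> + scale (- i) ?\<alpha>)"
      unfolding h by (simp add: right_diff_distrib xpow_mult)
    also have "?\<alpha> + scale (- i) ?\<alpha> = scale (- (i - 1)) ?\<alpha>"
      by (rule poly_mapping_eqI) (simp add: lookup_add lookup_minus algebra_simps)
    finally show ?case by blast
  qed
  have "scale (- m) ?\<alpha> = scale (- (int n * m)) (simple_root i)"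
    by (rule poly_mapping_eqI) simp
  with ex show ?thesis
    unfolding div_diff_def using exact_quot_eqI[OF one_minus_xpow_simple_root[OF assms]] by metis
qed

lemma div_diff_eqI:
  assumes "n \<ge> 1"
    and "h * (1 - xpow (scale (int n) (simple_root i))) =
      (1 - xpow (scale (- t) (simple_root i)) :: 'f::field laurent)"
  shows "div_diff n i t = h"
  unfolding div_diff_def by (rule exact_quot_eqI[OF one_minus_xpow_simple_root[OF assms(1)] assms(2)])

lemma div_diff_0: "n \<ge> 1 \<Longrightarrow> div_diff n i 0 = 0"
  by (rule div_diff_eqI) simp_all

lemma div_diff_minus: "n \<ge> 1 \<Longrightarrow> div_diff n i (- int n) = 1"
  by (rule div_diff_eqI) simp_all

text \<open>Raising the exponent of x_i by n raises t by n; this recursion is the source of the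
  correction term when T_i passes x_i^n.\<close>

lemma div_diff_shift:
  assumes "n \<ge> 1" "int n dvd t"
  shows "div_diff n i (t + int n) =
    xpow (- scale (int n) (simple_root i)) * (div_diff n i t :: 'f::field laurent)
      - xpow (- scale (int n) (simple_root i))"
proof (rule div_diff_eqI[OF assms(1)])
  let ?\<alpha> = "scale (int n) (simple_root i)"
  from assms obtain m where t: "t = int n * m" by blast
  have "(xpow (- ?\<alpha>) * div_diff n i t - xpow (- ?\<alpha>)) * (1 - xpow ?\<alpha>) =
      xpow (- ?\<alpha>) * (div_diff n i t * (1 - xpow ?\<alpha>)) - xpow (- ?\<alpha>)
        + (xpow (- ?\<alpha>) * xpow ?\<alpha> :: 'f laurent)"
    by (simp add: algebra_simps)
  also have "\<dots> = 1 - xpow (- ?\<alpha> + scale (- t) (simple_root i))"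
    unfolding t div_diff_mult[OF assms(1)] by (simp add: right_diff_distrib xpow_mult)
  also have "- ?\<alpha> + scale (- t) (simple_root i) = scale (- (t + int n)) (simple_root i)"
    by (rule poly_mapping_eqI) (simp add: lookup_add lookup_minus algebra_simps)
  finally show "(xpow (- ?\<alpha>) * div_diff n i t - xpow (- ?\<alpha>)) * (1 - xpow ?\<alpha>) =
      (1 - xpow (scale (- (t + int n)) (simple_root i)) :: 'f laurent)" .
qed

lemma div_diff_n: "n \<ge> 1 \<Longrightarrow> div_diff n i (int n) = - xpow (- scale (int n) (simple_root i))"
  using div_diff_shift[of n 0 i] by (simp add: div_diff_0)

lemma xpow_perm_act_simple_refl_add:
  "xpow (perm_act (simple_refl i) (u + v)) =
    xpow (perm_act (simple_refl i) u) * xpow (perm_act (simple_refl i) v)"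
  by (simp add: perm_act_add xpow_mult)

section \<open>The operators T_i over a field of parameters: Bernstein relations and values on
  monomials\<close>

locale metaplectic =
  fixes r n :: nat and G :: "int \<Rightarrow> 'a::field"
  assumes r2: "r \<ge> 2" and n1: "n \<ge> 1"
    and G0: "G 0 \<noteq> 0"
    and G_inverse: "\<not> int n dvd j \<Longrightarrow> G j * G (- j) = 1"
    and G_cong: "i mod int n = j mod int n \<Longrightarrow> G i = G j"
begin

definition kap :: "'a poly fract" where
  "kap = const (G 0 - inverse (G 0))"

abbreviation TT :: "nat \<Rightarrow> 'a poly fract laurent \<Rightarrow> 'a poly fract laurent" where
  "TT \<equiv> T n G"

abbreviation en :: "nat \<Rightarrow> weight" where
  "en j \<equiv> scale (int n) (unit_vec j)"

lemma lin_T: "lin (TT i)"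
  unfolding T_def by (rule lin_lin_ext)

lemmas lin_intros = lin_compose[OF lin_T] lin_mult lin_plus lin_minus lin_lsmult lin_id

lemmas T_add = lin_add[OF lin_T] and T_scale = lin_scale[OF lin_T] and T_diff = lin_diff[OF lin_T]

lemma T_xpow:
  "TT i (xpow \<nu>) =
    (let a = \<nu> \<cdot> i - \<nu> \<cdot> Suc i in
     lsmult kap (div_diff n i (a - a mod int n) * xpow \<nu>) +
     lsmult (const (G a)) (xpow (perm_act (simple_refl i) \<nu>)))"
  by (simp add: T_def Let_def ip_simple_root kap_def div_diff_def)

lemma G_add_n: "G (a + int n) = G a"
  by (rule G_cong) simp

lemma G_diff_n: "G (a - int n) = G a"
  by (rule G_cong) (metis minus_mod_self2)

lemma xpow_en_simple_root:
  "xpow (- scale (int n) (simple_root i)) * xpow (en i) = xpow (en (Suc i))"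
  "xpow (scale (int n) (simple_root i)) * xpow (en (Suc i)) = xpow (en i)"
proof -
  have "- scale (int n) (simple_root i) + en i = en (Suc i)"
    by (rule poly_mapping_eqI) (auto simp: lookup_add lookup_minus lookup_simple_root lookup_unit_vec)
  moreover have "scale (int n) (simple_root i) + en (Suc i) = en i"
    by (rule poly_mapping_eqI) (auto simp: lookup_add lookup_minus lookup_simple_root lookup_unit_vec)
  ultimately show "xpow (- scale (int n) (simple_root i)) * xpow (en i) = xpow (en (Suc i))"
    "xpow (scale (int n) (simple_root i)) * xpow (en (Suc i)) = xpow (en i)"
    by (simp_all only: xpow_mult)
qed

lemma perm_act_simple_refl_en [simp]:
  "perm_act (simple_refl i) (en j) = en (simple_refl i j)"
  by (simp add: perm_act_scale perm_act_unit_vec)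

text \<open>A Bernstein relation; with T_i^(-1) = T_i - \<open>kap\<close> it reads T_i x_i^n =
  x_{i+1}^n T_i^(-1). On a monomial, \<open>G\<close> is unchanged by periodicity and the quotient
  changes by its recursion.\<close>

lemma T_en: "TT i (xpow (en i) * f) = xpow (en (Suc i)) * TT i f - lsmult kap (xpow (en (Suc i)) * f)"
proof (rule lin_eqI[where F = "\<lambda>f. TT i (xpow (en i) * f)"
      and H = "\<lambda>f. xpow (en (Suc i)) * TT i f - lsmult kap (xpow (en (Suc i)) * f)"])
  fix \<nu> :: weight
  define a where "a = \<nu> \<cdot> i - \<nu> \<cdot> Suc i"
  have *: "a + int n - (a + int n) mod int n = (a - a mod int n) + int n" by simp
  have "TT i (xpow (en i + \<nu>)) = lsmult kap (div_diff n i (a + int n - (a + int n) mod int n) * xpow (en i + \<nu>))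
      + lsmult (const (G (a + int n))) (xpow (perm_act (simple_refl i) (en i + \<nu>)))"
    unfolding T_xpow Let_def by (simp add: a_def lookup_add lookup_unit_vec algebra_simps)
  also have "\<dots> = xpow (en (Suc i)) * TT i (xpow \<nu>) - lsmult kap (xpow (en (Suc i)) * xpow \<nu>)"
    unfolding * div_diff_shift[OF n1 dvd_minus_mod] G_add_n xpow_perm_act_simple_refl_add T_xpow Let_def
      a_def[symmetric]
    unfolding xpow_mult[symmetric] lsmult_def xpow_en_simple_root(1)[of i, symmetric]
    by (simp add: algebra_simps simple_refl_apply xpow_en_simple_root(1)[of i, symmetric])
  finally show "TT i (xpow (en i) * xpow \<nu>) = \<dots>"
    by (simp add: xpow_mult)
qed (intro lin_intros)+

text \<open>The companion T_i^(-1) x_{i+1}^n = x_i^n T_i, from the same recursion read backwards,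
  from t to t - n.\<close>

lemma T_en_Suc: "TT i (xpow (en (Suc i)) * f) = xpow (en i) * TT i f + lsmult kap (xpow (en (Suc i)) * f)"
proof (rule lin_eqI[where F = "\<lambda>f. TT i (xpow (en (Suc i)) * f)"
      and H = "\<lambda>f. xpow (en i) * TT i f + lsmult kap (xpow (en (Suc i)) * f)"])
  fix \<nu> :: weight
  define a where "a = \<nu> \<cdot> i - \<nu> \<cdot> Suc i"
  have *: "a - int n - (a - int n) mod int n = (a - a mod int n) - int n"
    using minus_mod_self2[of a "int n"] by simp
  have dv: "int n dvd a - a mod int n - int n" by (simp add: dvd_minus_mod)
  have "TT i (xpow (en (Suc i) + \<nu>)) =
      lsmult kap (div_diff n i (a - int n - (a - int n) mod int n) * xpow (en (Suc i) + \<nu>))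
      + lsmult (const (G (a - int n))) (xpow (perm_act (simple_refl i) (en (Suc i) + \<nu>)))"
    unfolding T_xpow Let_def by (simp add: a_def lookup_add lookup_unit_vec algebra_simps)
  moreover have "div_diff n i (a - a mod int n - int n) =
      xpow (scale (int n) (simple_root i)) * (div_diff n i (a - a mod int n) :: 'a poly fract laurent) + 1"
    using div_diff_shift[OF n1 dv, of i, where 'f = "'a poly fract"]
    by (simp add: right_diff_distrib xpow_mult_assoc xpow_mult)
  ultimately have "TT i (xpow (en (Suc i) + \<nu>)) =
      xpow (en i) * TT i (xpow \<nu>) + lsmult kap (xpow (en (Suc i)) * xpow \<nu>)"
    unfolding * G_diff_n xpow_perm_act_simple_refl_add T_xpow Let_def a_def[symmetric]
    unfolding xpow_mult[symmetric] lsmult_def xpow_en_simple_root(2)[of i, symmetric]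
    by (simp add: algebra_simps simple_refl_apply xpow_en_simple_root(2)[of i, symmetric])
  then show "TT i (xpow (en (Suc i)) * xpow \<nu>) =
      xpow (en i) * TT i (xpow \<nu>) + lsmult kap (xpow (en (Suc i)) * xpow \<nu>)"
    by (simp add: xpow_mult)
qed (intro lin_intros)+

text \<open>Such an exponent is fixed by s_i and does not change the pairing with the simple root,
  on which both parts of T_i depend.\<close>

lemma T_xpow_mult:
  assumes "\<beta> \<cdot> i = \<beta> \<cdot> Suc i"
  shows "TT i (xpow \<beta> * f) = xpow \<beta> * TT i f"
proof (rule lin_eqI[where F = "\<lambda>f. TT i (xpow \<beta> * f)" and H = "\<lambda>f. xpow \<beta> * TT i f"])
  fix \<nu> :: weight
  have "perm_act (simple_refl i) \<beta> = \<beta>"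
    using assms by (simp add: perm_act_simple_refl_eq)
  then have "TT i (xpow (\<beta> + \<nu>)) = xpow \<beta> * TT i (xpow \<nu>)"
    unfolding T_xpow Let_def xpow_perm_act_simple_refl_add
    by (simp add: lookup_add assms algebra_simps xpow_mult[symmetric] lsmult_mult_right)
  then show "TT i (xpow \<beta> * xpow \<nu>) = xpow \<beta> * TT i (xpow \<nu>)"
    by (simp add: xpow_mult)
qed (intro lin_intros)+

lemma T_en_other: "j \<noteq> i \<Longrightarrow> j \<noteq> Suc i \<Longrightarrow> TT i (xpow (en j) * f) = xpow (en j) * TT i f"
  by (rule T_xpow_mult) (simp add: lookup_unit_vec)

text \<open>For a pairing in [-n,n) the number t is -n or 0 and the quotient is 1 or 0. This is the
  two by two matrix to which the relations are reduced.\<close>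

lemma T_window:
  assumes "- int n \<le> \<nu> \<cdot> i - \<nu> \<cdot> Suc i" "\<nu> \<cdot> i - \<nu> \<cdot> Suc i < int n"
  shows "TT i (xpow \<nu>) = lsmult (if \<nu> \<cdot> i < \<nu> \<cdot> Suc i then kap else 0) (xpow \<nu>) +
    lsmult (const (G (\<nu> \<cdot> i - \<nu> \<cdot> Suc i))) (xpow (perm_act (simple_refl i) \<nu>))"
proof (cases "\<nu> \<cdot> i < \<nu> \<cdot> Suc i")
  case True
  define a where "a = \<nu> \<cdot> i - \<nu> \<cdot> Suc i"
  have "a mod int n = (a + int n) mod int n" by simp
  also have "\<dots> = a + int n"
    using True assms by (intro mod_pos_pos_trivial) (auto simp: a_def)
  finally have "a - a mod int n = - int n" by simp
  then show ?thesis
    using True by (simp add: T_xpow Let_def a_def div_diff_minus[OF n1])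
next
  case False
  then have "(\<nu> \<cdot> i - \<nu> \<cdot> Suc i) mod int n = \<nu> \<cdot> i - \<nu> \<cdot> Suc i"
    using assms by (intro mod_pos_pos_trivial) auto
  then show ?thesis
    using False by (simp add: T_xpow Let_def div_diff_0[OF n1])
qed

text \<open>The boundary value n explains the special case in \<sigma>: there the quotient is -x^(-n
  \<alpha>), so it contributes to the same monomial as the reflected term, and k - (k - k^(-1)) =
  k^(-1).\<close>

lemma T_dominant:
  assumes "0 \<le> \<nu> \<cdot> i - \<nu> \<cdot> Suc i" "\<nu> \<cdot> i - \<nu> \<cdot> Suc i \<le> int n"
  shows "TT i (xpow \<nu>) = lsmult (const (\<sigma> n G (\<nu> \<cdot> i - \<nu> \<cdot> Suc i))) (xpow (perm_act (simple_refl i) \<nu>))"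
proof (cases "\<nu> \<cdot> i - \<nu> \<cdot> Suc i = int n")
  case True
  have 1: "xpow (perm_act (simple_refl i) \<nu>) = xpow (- scale (int n) (simple_root i)) * xpow \<nu>"
    by (simp add: perm_act_simple_refl_eq True xpow_mult)
  have "G (int n) = G 0" using G_add_n[of 0] by simp
  then show ?thesis
    unfolding T_xpow Let_def True 1
    using n1 by (simp add: div_diff_n kap_def \<sigma>_def const_diff lsmult_diff_left lsmult_def single_diff
        algebra_simps)
next
  case False
  with assms n1 have "\<sigma> n G (\<nu> \<cdot> i - \<nu> \<cdot> Suc i) = G (\<nu> \<cdot> i - \<nu> \<cdot> Suc i)"
    by (auto simp: \<sigma>_def dest: zdvd_imp_le)
  then show ?thesis
    using assms False n1 by (subst T_window) auto
qed

end

section \<open>Hecke relations and the operator omega\<close>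

lemma single_0_mult: "Poly_Mapping.single 0 (a * b) = Poly_Mapping.single 0 a * (Poly_Mapping.single 0 b :: 'f::field laurent)"
  by (simp add: mult_single)

text \<open>Scalars are moved into the Laurent ring, so that identities mixing scalars and monomials
  become identities of commutative algebra.\<close>

lemmas lsmult_ring = lsmult_def single_0_mult single_add single_diff single_uminus

lemma qvar_nonzero [simp]: "qvar \<noteq> (0 :: 'a::field poly fract)"
  by (simp add: qvar_def Zero_fract_def eq_fract)

lemma bij_rotate:
  assumes "r \<ge> 1"
  shows "bij (\<lambda>i. if i = r then 1 else if i \<in> {1..<r} then Suc i else i)"
    and "inv (\<lambda>i. if i = r then 1 else if i \<in> {1..<r} then Suc i else i) =
      (\<lambda>i. if i = 1 then r else if i \<in> {1<..r} then i - 1 else i)"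
proof -
  let ?f = "\<lambda>i. if i = r then 1 else if i \<in> {1..<r} then Suc i else i"
  let ?g = "\<lambda>i. if i = 1 then r else if i \<in> {1<..r} then i - 1 else i"
  have gf: "?g \<circ> ?f = id" and fg: "?f \<circ> ?g = id"
    using assms by (auto simp: fun_eq_iff)
  show "bij ?f" by (rule o_bij[OF gf fg])
  show "inv ?f = ?g" by (rule inv_unique_comp[OF fg gf])
qed

lemma lookup_rotate_weight:
  "r \<ge> 1 \<Longrightarrow> rotate_weight r v \<cdot> j = v \<cdot> (if j = 1 then r else if j \<in> {1<..r} then j - 1 else j)"
  unfolding rotate_weight_def using bij_rotate[of r] by (simp add: lookup_perm_act)

lemma rotate_weight_add: "r \<ge> 1 \<Longrightarrow> rotate_weight r (u + v) = rotate_weight r u + rotate_weight r v"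
  by (rule poly_mapping_eqI) (simp add: lookup_rotate_weight lookup_add)

context metaplectic
begin

definition Ti :: "nat \<Rightarrow> 'a poly fract laurent \<Rightarrow> 'a poly fract laurent" where
  "Ti i f = TT i f - lsmult kap f"

abbreviation om :: "'a poly fract laurent \<Rightarrow> 'a poly fract laurent" where
  "om \<equiv> omega r"

lemma lin_Ti: "lin (Ti i)"
  unfolding Ti_def[abs_def] by (intro lin_minus lin_T lin_lsmult lin_id)

lemmas Ti_scale = lin_scale[OF lin_Ti]

lemma lin_om: "lin om"
  unfolding omega_def by (rule lin_lin_ext)

lemmas om_add = lin_add[OF lin_om] and om_scale = lin_scale[OF lin_om]
  and om_diff = lin_diff[OF lin_om]

lemmas lin_op_intros = lin_intros lin_compose[OF lin_om] lin_compose[OF lin_Ti]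

lemma om_xpow: "om (xpow \<nu>) = lsmult (qvar powi (- \<nu> \<cdot> r)) (xpow (rotate_weight r \<nu>))"
  by (simp add: omega_def)

lemma om_xpow_mult:
  "om (xpow \<beta> * f) = lsmult (qvar powi (- \<beta> \<cdot> r)) (xpow (rotate_weight r \<beta>) * om f)"
proof (rule lin_eqI[where F = "\<lambda>f. om (xpow \<beta> * f)"
      and H = "\<lambda>f. lsmult (qvar powi (- \<beta> \<cdot> r)) (xpow (rotate_weight r \<beta>) * om f)"])
  fix \<nu> :: weight
  have "(qvar :: 'a poly fract) powi (- (\<beta> + \<nu>) \<cdot> r) = qvar powi (- \<beta> \<cdot> r) * qvar powi (- \<nu> \<cdot> r)"
    by (simp add: lookup_add power_int_add[symmetric])
  then have "om (xpow (\<beta> + \<nu>)) =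
      lsmult (qvar powi (- \<beta> \<cdot> r)) (xpow (rotate_weight r \<beta>) * om (xpow \<nu>))"
    unfolding om_xpow using r2 by (simp add: rotate_weight_add xpow_mult[symmetric] lsmult_mult_right)
  then show "om (xpow \<beta> * xpow \<nu>) =
      lsmult (qvar powi (- \<beta> \<cdot> r)) (xpow (rotate_weight r \<beta>) * om (xpow \<nu>))"
    by (simp add: xpow_mult)
qed (intro lin_op_intros lin_om lin_id)+

lemma rotate_weight_en: "j \<in> {1..<r} \<Longrightarrow> rotate_weight r (en j) = en (Suc j)"
  using r2 by (intro poly_mapping_eqI) (auto simp: lookup_rotate_weight lookup_unit_vec)

lemma rotate_weight_en_r: "rotate_weight r (en r) = en 1"
  using r2 by (intro poly_mapping_eqI) (auto simp: lookup_rotate_weight lookup_unit_vec)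

lemma om_en: "j \<in> {1..<r} \<Longrightarrow> om (xpow (en j) * f) = xpow (en (Suc j)) * om f"
  by (simp add: om_xpow_mult rotate_weight_en lookup_unit_vec)

lemma om_en_r: "om (xpow (en r) * f) = lsmult (qvar powi (- int n)) (xpow (en 1) * om f)"
  by (simp add: om_xpow_mult rotate_weight_en_r lookup_unit_vec)

definition gg :: "int \<Rightarrow> 'a poly fract" where
  "gg d = const (G d)"

lemma gg_inverse:
  assumes "0 \<le> a" "a < int n" "0 \<le> b" "b < int n" "a \<noteq> b"
  shows "gg (a - b) * gg (b - a) = 1"
proof -
  have "\<not> int n dvd a - b"
    using assms by (metis mod_eq_dvd_iff mod_pos_pos_trivial)
  from G_inverse[OF this] show ?thesis
    by (simp add: gg_def flip: const_mult)
qed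

lemma kap_eq: "kap = gg 0 - inverse (gg 0)"
  by (simp add: kap_def gg_def const_diff const_inverse)

lemma gg_0_nonzero: "gg 0 \<noteq> 0"
  using G0 by (simp add: gg_def)

lemma kap_gg: "kap * gg 0 = gg 0 * gg 0 - 1"
  using gg_0_nonzero by (simp add: kap_eq algebra_simps)

lemma T_win:
  assumes "0 \<le> \<nu> \<cdot> i" "\<nu> \<cdot> i < int n" "0 \<le> \<nu> \<cdot> Suc i" "\<nu> \<cdot> Suc i < int n"
  shows "TT i (xpow \<nu>) = lsmult (if \<nu> \<cdot> i < \<nu> \<cdot> Suc i then kap else 0) (xpow \<nu>) +
    lsmult (gg (\<nu> \<cdot> i - \<nu> \<cdot> Suc i)) (xpow (perm_act (simple_refl i) \<nu>))"
  unfolding gg_def using assms by (intro T_window) auto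

lemma perm_act_simple_refl_fixed:
  "\<nu> \<cdot> i = \<nu> \<cdot> Suc i \<Longrightarrow> perm_act (simple_refl i) \<nu> = \<nu>"
  by (rule poly_mapping_eqI) (simp add: simple_refl_apply)

text \<open>The defect commutes with x_i^n and x_{i+1}^n, so exponents in the window suffice. If the
  two entries agree, T_i acts as k, and k^2 = (k - k^(-1)) k + 1. Otherwise exactly one of the two
  monomials has diagonal entry \<open>kap\<close>, and the off-diagonal entries multiply to
  1.\<close>

lemma T_quadratic: "TT i (TT i f) = lsmult kap (TT i f) + f"
proof -
  let ?D = "\<lambda>f. TT i (TT i f) - lsmult kap (TT i f) - f"
  have "?D f = 0"
  proof (rule lin_vanish[where J = "{i, Suc i}" and D = ?D and n = n])
    show "lin ?D" by (intro lin_op_intros lin_T)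
  next
    fix j assume "j \<in> {i, Suc i}"
    moreover have "?D (xpow (en i) * f) = lsmult 1 (xpow (en i) * ?D f)" for f
      by (simp add: T_en T_en_Suc T_add T_diff T_scale) (simp add: lsmult_ring algebra_simps)
    moreover have "?D (xpow (en (Suc i)) * f) = lsmult 1 (xpow (en (Suc i)) * ?D f)" for f
      by (simp add: T_en T_en_Suc T_add T_diff T_scale) (simp add: lsmult_ring algebra_simps)
    ultimately show "\<exists>c \<beta>. c \<noteq> 0 \<and> (\<forall>f. ?D (xpow (en j) * f) = lsmult c (xpow \<beta> * ?D f))"
      by (metis insert_iff one_neq_zero singletonD)
  next
    fix \<nu> :: weight
    assume "\<And>j. j \<in> {i, Suc i} \<Longrightarrow> 0 \<le> \<nu> \<cdot> j \<and> \<nu> \<cdot> j < int n"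
    then have b: "0 \<le> \<nu> \<cdot> i" "\<nu> \<cdot> i < int n" "0 \<le> \<nu> \<cdot> Suc i" "\<nu> \<cdot> Suc i < int n" by auto
    let ?s = "perm_act (simple_refl i) \<nu>"
    have s: "perm_act (simple_refl i) ?s = \<nu>"
      by (rule poly_mapping_eqI) simp
    note 1 = T_win[OF b] and 2 = T_win[of ?s i]
    show "?D (xpow \<nu>) = 0"
    proof (cases "\<nu> \<cdot> i = \<nu> \<cdot> Suc i")
      case True
      then show ?thesis
        using 1 by (simp add: perm_act_simple_refl_fixed T_scale kap_gg lsmult_diff_left)
    next
      case False
      have g: "gg (\<nu> \<cdot> i - \<nu> \<cdot> Suc i) * gg (\<nu> \<cdot> Suc i - \<nu> \<cdot> i) = 1"
        using b False by (intro gg_inverse) auto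
      show ?thesis
        using 1 2 b False
        by (cases "\<nu> \<cdot> i < \<nu> \<cdot> Suc i")
          (simp_all add: s simple_refl_apply T_scale T_add lsmult_add_right g mult.commute)
    qed
  qed (use n1 in auto)
  then show ?thesis by (simp add: algebra_simps)
qed

lemma Ti_T [simp]: "Ti i (TT i f) = f"
  by (simp add: Ti_def T_quadratic)

lemma T_Ti [simp]: "TT i (Ti i f) = f"
  by (simp add: Ti_def T_diff T_scale T_quadratic)

text \<open>Moving x_i^n through the commutator leaves x_{i+1}^n on the left, since the correction
  terms cancel. On the window s_i and s_j touch disjoint pairs of entries.\<close>

lemma T_commute:
  assumes "Suc i < j"
  shows "TT i (TT j f) = TT j (TT i f)"
proof -
  let ?D = "\<lambda>f. TT i (TT j f) - TT j (TT i f)"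
  have "?D f = 0"
  proof (rule lin_vanish[where J = "{i, Suc i, j, Suc j}" and D = ?D and n = n])
    show "lin ?D" by (intro lin_op_intros lin_T)
  next
    fix l assume "l \<in> {i, Suc i, j, Suc j}"
    moreover have "?D (xpow (en i) * f) = lsmult 1 (xpow (en (Suc i)) * ?D f)" for f
      using assms by (simp add: T_en T_en_Suc T_en_other T_add T_diff T_scale) (simp add: lsmult_ring algebra_simps)
    moreover have "?D (xpow (en (Suc i)) * f) = lsmult 1 (xpow (en i) * ?D f)" for f
      using assms by (simp add: T_en T_en_Suc T_en_other T_add T_diff T_scale) (simp add: lsmult_ring algebra_simps)
    moreover have "?D (xpow (en j) * f) = lsmult 1 (xpow (en (Suc j)) * ?D f)" for f
      using assms by (simp add: T_en T_en_Suc T_en_other T_add T_diff T_scale) (simp add: lsmult_ring algebra_simps)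
    moreover have "?D (xpow (en (Suc j)) * f) = lsmult 1 (xpow (en j) * ?D f)" for f
      using assms by (simp add: T_en T_en_Suc T_en_other T_add T_diff T_scale) (simp add: lsmult_ring algebra_simps)
    ultimately show "\<exists>c \<beta>. c \<noteq> 0 \<and> (\<forall>f. ?D (xpow (en l) * f) = lsmult c (xpow \<beta> * ?D f))"
      by (metis insert_iff one_neq_zero singletonD)
  next
    fix \<nu> :: weight
    assume "\<And>l. l \<in> {i, Suc i, j, Suc j} \<Longrightarrow> 0 \<le> \<nu> \<cdot> l \<and> \<nu> \<cdot> l < int n"
    then have b: "0 \<le> \<nu> \<cdot> i" "\<nu> \<cdot> i < int n" "0 \<le> \<nu> \<cdot> Suc i" "\<nu> \<cdot> Suc i < int n"
        "0 \<le> \<nu> \<cdot> j" "\<nu> \<cdot> j < int n" "0 \<le> \<nu> \<cdot> Suc j" "\<nu> \<cdot> Suc j < int n" by auto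
    have s: "perm_act (simple_refl i) (perm_act (simple_refl j) \<nu>) = perm_act (simple_refl j) (perm_act (simple_refl i) \<nu>)"
      using assms by (intro poly_mapping_eqI) (simp add: simple_refl_apply)
    show "?D (xpow \<nu>) = 0"
      using assms b by (simp add: T_win T_add T_scale simple_refl_apply s lsmult_add_right algebra_simps)
  qed (use n1 in auto)
  then show ?thesis by simp
qed

text \<open>The rotation carries positions i, i+1 to i+1, i+2, and the power of q depends only on
  the last entry, which s_i leaves alone.\<close>

lemma om_T:
  assumes "1 \<le> i" "Suc i < r"
  shows "om (TT i f) = TT (Suc i) (om f)"
proof -
  let ?D = "\<lambda>f. om (TT i f) - TT (Suc i) (om f)"
  have "?D f = 0"
  proof (rule lin_vanish[where J = "{i, Suc i}" and D = ?D and n = n])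
    show "lin ?D" by (intro lin_op_intros lin_T lin_om)
  next
    fix j assume "j \<in> {i, Suc i}"
    moreover have "?D (xpow (en i) * f) = lsmult 1 (xpow (en (Suc (Suc i))) * ?D f)" for f
      using assms by (simp add: T_en T_en_Suc T_add T_diff T_scale om_en om_diff om_add om_scale)
        (simp add: lsmult_ring algebra_simps)
    moreover have "?D (xpow (en (Suc i)) * f) = lsmult 1 (xpow (en (Suc i)) * ?D f)" for f
      using assms by (simp add: T_en T_en_Suc T_add T_diff T_scale om_en om_diff om_add om_scale)
        (simp add: lsmult_ring algebra_simps)
    ultimately show "\<exists>c \<beta>. c \<noteq> 0 \<and> (\<forall>f. ?D (xpow (en j) * f) = lsmult c (xpow \<beta> * ?D f))"
      by (metis insert_iff one_neq_zero singletonD)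
  next
    fix \<nu> :: weight
    assume "\<And>j. j \<in> {i, Suc i} \<Longrightarrow> 0 \<le> \<nu> \<cdot> j \<and> \<nu> \<cdot> j < int n"
    then have b: "0 \<le> \<nu> \<cdot> i" "\<nu> \<cdot> i < int n" "0 \<le> \<nu> \<cdot> Suc i" "\<nu> \<cdot> Suc i < int n" by auto
    have s: "rotate_weight r (perm_act (simple_refl i) \<nu>) = perm_act (simple_refl (Suc i)) (rotate_weight r \<nu>)"
      using assms by (intro poly_mapping_eqI) (auto simp: simple_refl_apply lookup_rotate_weight)
    show "?D (xpow \<nu>) = 0"
      using assms b by (simp add: T_win T_add T_scale om_add om_scale om_xpow lookup_rotate_weight
          simple_refl_apply s lsmult_add_right algebra_simps)
  qed (use n1 in auto)
  then show ?thesis by simp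
qed

text \<open>A single rotation would separate the positions r-1 and r; two of them carry these to 1
  and 2. The accumulated power of q involves the sum of both entries and is therefore
  symmetric.\<close>

lemma om_om_T: "om (om (TT (r - 1) f)) = TT 1 (om (om f))"
proof -
  let ?D = "\<lambda>f. om (om (TT (r - 1) f)) - TT 1 (om (om f))"
  have r: "Suc (r - 1) = r" and r1: "r - 1 \<in> {1..<r}" "1 \<in> {1..<r}" using r2 by auto
  have s1: "Suc 1 = 2" by simp
  let ?q = "qvar powi (- int n)"
  have "?D f = 0"
  proof (rule lin_vanish[where J = "{r - 1, r}" and D = ?D and n = n])
    show "lin ?D" by (intro lin_op_intros lin_T lin_om)
  next
    fix j assume "j \<in> {r - 1, r}"
    note sh = T_en[of "r - 1", unfolded r] T_en_Suc[of "r - 1", unfolded r]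
      T_en[of 1, unfolded s1] T_en_Suc[of 1, unfolded s1]
      om_en[OF r1(1), unfolded r] om_en[OF r1(2), unfolded s1] om_en_r
    have "?D (xpow (en (r - 1)) * f) = lsmult ?q (xpow (en 2) * ?D f)" for f
      by (simp only: sh T_add T_diff T_scale om_diff om_add om_scale lsmult_mult_right lsmult_lsmult)
        (simp add: lsmult_ring algebra_simps)
    moreover have "?D (xpow (en r) * f) = lsmult ?q (xpow (en 1) * ?D f)" for f
      by (simp only: sh T_add T_diff T_scale om_diff om_add om_scale lsmult_mult_right lsmult_lsmult)
        (simp add: lsmult_ring algebra_simps)
    moreover have "?q \<noteq> (0 :: 'a poly fract)" by simp
    ultimately show "\<exists>c \<beta>. c \<noteq> 0 \<and> (\<forall>f. ?D (xpow (en j) * f) = lsmult c (xpow \<beta> * ?D f))"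
      using \<open>j \<in> {r - 1, r}\<close> by blast
  next
    fix \<nu> :: weight
    assume "\<And>j. j \<in> {r - 1, r} \<Longrightarrow> 0 \<le> \<nu> \<cdot> j \<and> \<nu> \<cdot> j < int n"
    then have b: "0 \<le> \<nu> \<cdot> (r - 1)" "\<nu> \<cdot> (r - 1) < int n" "0 \<le> \<nu> \<cdot> r" "\<nu> \<cdot> r < int n" by auto
    let ?s = "perm_act (simple_refl (r - 1)) \<nu>"
    let ?rr = "\<lambda>v. rotate_weight r (rotate_weight r v)"
    have rr: "?rr v \<cdot> k = v \<cdot> (if k = 1 then r - 1 else if k = 2 then r else if 2 < k \<and> k \<le> r then k - 2 else k)"
      for v :: weight and k
    proof -
      consider "k = 0" | "k = 1" | "k = 2" | "2 < k" "k \<le> r" | "r < k" "2 < k" by linarith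
      then show ?thesis
      proof cases
        case 4
        then obtain m where "k = Suc (Suc (Suc m))"
          by (metis Suc_diff_Suc numeral_2_eq_2 less_imp_Suc_add add_Suc)
        then show ?thesis using 4 r2 by (simp add: lookup_rotate_weight)
      qed (use r2 in \<open>simp_all add: lookup_rotate_weight\<close>)
    qed
    have s: "?rr ?s = perm_act (simple_refl 1) (?rr \<nu>)"
    proof (rule poly_mapping_eqI)
      fix k
      consider "k = 0" | "k = 1" | "k = 2" | "2 < k" "k \<le> r" | "r < k" "2 < k" by linarith
      then show "?rr ?s \<cdot> k = perm_act (simple_refl 1) (?rr \<nu>) \<cdot> k"
        unfolding lookup_perm_act_simple_refl rr
        by cases (use r2 in \<open>auto simp: simple_refl_apply\<close>)
    qed
    have c: "?rr v \<cdot> 1 = v \<cdot> (r - 1)" "?rr v \<cdot> 2 = v \<cdot> r" "rotate_weight r v \<cdot> r = v \<cdot> (r - 1)" for v :: weight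
      unfolding rr using r2 by (simp_all add: lookup_rotate_weight)
    have t: "?s \<cdot> r = \<nu> \<cdot> (r - 1)" "?s \<cdot> (r - 1) = \<nu> \<cdot> r"
      using r by (auto simp: simple_refl_apply)
    note w1 = T_win[of \<nu> "r - 1", unfolded r, OF b]
      and w2 = T_win[of "?rr \<nu>" 1, unfolded s1 c, OF b]
    show "?D (xpow \<nu>) = 0"
      unfolding om_xpow om_scale c lsmult_lsmult T_scale w1 w2 om_add om_scale s t
      by (simp add: lsmult_add_right algebra_simps)
  qed (use n1 in auto)
  then show ?thesis by simp
qed

end

context metaplectic
begin

text \<open>The shift conditions exchange the roles of i and i+2 and use the quadratic relation. On
  the window the monomials of an orbit of S_3 span an invariant space with explicit matrices, and
  the claim is a polynomial identity modulo G_d G_{-d} = 1 and k^2 = \<open>kap\<close> k + 1,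
  checked for each order and coincidence pattern of the three entries.\<close>

lemma T_braid: "TT i (TT (Suc i) (TT i f)) = TT (Suc i) (TT i (TT (Suc i) f))"
proof -
  let ?D = "\<lambda>f. TT i (TT (Suc i) (TT i f)) - TT (Suc i) (TT i (TT (Suc i) f))"
  have "?D f = 0"
  proof (rule lin_vanish[where J = "{i, Suc i, Suc (Suc i)}" and D = ?D and n = n])
    show "lin ?D" by (intro lin_op_intros lin_T)
  next
    fix l assume "l \<in> {i, Suc i, Suc (Suc i)}"
    moreover have "?D (xpow (en i) * f) = lsmult 1 (xpow (en (Suc (Suc i))) * ?D f)" for f
      by (simp add: T_en T_en_Suc T_en_other T_add T_diff T_scale T_quadratic)
        (simp add: lsmult_ring algebra_simps)
    moreover have "?D (xpow (en (Suc i)) * f) = lsmult 1 (xpow (en (Suc i)) * ?D f)" for f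
      by (simp add: T_en T_en_Suc T_en_other T_add T_diff T_scale T_quadratic)
        (simp add: lsmult_ring algebra_simps)
    moreover have "?D (xpow (en (Suc (Suc i))) * f) = lsmult 1 (xpow (en i) * ?D f)" for f
      by (simp add: T_en T_en_Suc T_en_other T_add T_diff T_scale T_quadratic)
        (simp add: lsmult_ring algebra_simps)
    ultimately show "\<exists>c \<beta>. c \<noteq> 0 \<and> (\<forall>f. ?D (xpow (en l) * f) = lsmult c (xpow \<beta> * ?D f))"
      by (metis insert_iff one_neq_zero singletonD)
  next
    fix \<nu> :: weight
    assume bb: "\<And>l. l \<in> {i, Suc i, Suc (Suc i)} \<Longrightarrow> 0 \<le> \<nu> \<cdot> l \<and> \<nu> \<cdot> l < int n"
    define a b c where "a = \<nu> \<cdot> i" "b = \<nu> \<cdot> Suc i" "c = \<nu> \<cdot> Suc (Suc i)"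
    have bd: "0 \<le> a" "a < int n" "0 \<le> b" "b < int n" "0 \<le> c" "c < int n"
      using bb unfolding a_b_c_def by auto
    let ?s = "perm_act (simple_refl i) :: weight \<Rightarrow> weight"
      and ?t = "perm_act (simple_refl (Suc i)) :: weight \<Rightarrow> weight"
    have ss: "?s (?s v) = v" "?t (?t v) = v" "?t (?s (?t v)) = ?s (?t (?s v))" for v
      by (rule poly_mapping_eqI; simp add: simple_refl_apply)+
    define x0 x1 x2 x12 x21 x121 where x: "x0 = (xpow \<nu> :: 'a poly fract laurent)"
      "x1 = (xpow (?s \<nu>) :: 'a poly fract laurent)" "x2 = (xpow (?t \<nu>) :: 'a poly fract laurent)"
      "x12 = (xpow (?s (?t \<nu>)) :: 'a poly fract laurent)" "x21 = (xpow (?t (?s \<nu>)) :: 'a poly fract laurent)"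
      "x121 = (xpow (?s (?t (?s \<nu>))) :: 'a poly fract laurent)"
    define w where "w a b = (if a < b then kap else 0)" for a b :: int
    note T = T_win[folded w_def]
    have T1: "TT i x0 = lsmult (w a b) x0 + lsmult (gg (a - b)) x1"
      "TT i x1 = lsmult (w b a) x1 + lsmult (gg (b - a)) x0"
      "TT i x2 = lsmult (w a c) x2 + lsmult (gg (a - c)) x12"
      "TT i x12 = lsmult (w c a) x12 + lsmult (gg (c - a)) x2"
      "TT i x21 = lsmult (w b c) x21 + lsmult (gg (b - c)) x121"
      "TT i x121 = lsmult (w c b) x121 + lsmult (gg (c - b)) x21"
      unfolding x by (subst T; use bd in \<open>simp add: a_b_c_def simple_refl_apply ss\<close>)+
    have T2: "TT (Suc i) x0 = lsmult (w b c) x0 + lsmult (gg (b - c)) x2"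
      "TT (Suc i) x1 = lsmult (w a c) x1 + lsmult (gg (a - c)) x21"
      "TT (Suc i) x2 = lsmult (w c b) x2 + lsmult (gg (c - b)) x0"
      "TT (Suc i) x12 = lsmult (w a b) x12 + lsmult (gg (a - b)) x121"
      "TT (Suc i) x21 = lsmult (w c a) x21 + lsmult (gg (c - a)) x1"
      "TT (Suc i) x121 = lsmult (w b a) x121 + lsmult (gg (b - a)) x12"
      unfolding x by (subst T; use bd in \<open>simp add: a_b_c_def simple_refl_apply ss\<close>)+
    \<comment> \<open>\<open>A\<close> embeds the scalars, so that the remaining identities live in
      one commutative ring.\<close>
    define A where "A = (Poly_Mapping.single 0 :: 'a poly fract \<Rightarrow> 'a poly fract laurent)"
    have A: "lsmult c f = A c * f" "A (c * d) = A c * A d" for c d f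
      by (simp_all add: A_def lsmult_def mult_single)
    have A1: "A 0 = 0" "A 1 = 1" by (simp_all add: A_def)
    have gi: "A (gg (d - e)) * A (gg (e - d)) = 1"
      if "0 \<le> d" "d < int n" "0 \<le> e" "e < int n" "d \<noteq> e" for d e
      using gg_inverse[OF that] A(2)[symmetric] A1 by simp
    have k: "A kap * A (gg 0) = A (gg 0) * A (gg 0) - 1"
    proof -
      have "A kap * A (gg 0) = A (gg 0 * gg 0 - 1)"
        by (simp only: A(2)[symmetric] kap_gg)
      also have "\<dots> = A (gg 0 * gg 0) - A 1"
        by (simp only: A_def single_diff)
      finally show ?thesis by (simp only: A(2) A1)
    qed
    have eq: "x1 = x0 \<and> x21 = x2 \<and> x121 = x12" if "a = b"
      unfolding x using that by (simp add: perm_act_simple_refl_fixed a_b_c_def ss(3)[symmetric])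
    have eq': "x2 = x0 \<and> x12 = x1 \<and> x121 = x21" if "b = c"
      unfolding x using that by (simp add: perm_act_simple_refl_fixed a_b_c_def ss(3)[symmetric])
    have eq'': "x21 = x1 \<and> x12 = x2 \<and> x121 = x0" if "a = c"
    proof -
      have "?s (?t (?s \<nu>)) = \<nu>" "?t (?s \<nu>) = ?s \<nu>" "?s (?t \<nu>) = ?t \<nu>"
        by (rule poly_mapping_eqI; use that in \<open>simp add: simple_refl_apply a_b_c_def\<close>)+
      then show ?thesis unfolding x by simp
    qed
    have e: "?D (xpow \<nu>) = 0 \<longleftrightarrow> TT i (TT (Suc i) (TT i x0)) = TT (Suc i) (TT i (TT (Suc i) x0))"
      unfolding x by simp
    note ex = T1 T2 T_add T_scale lsmult_add_right lsmult_lsmult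
    show "?D (xpow \<nu>) = 0"
    proof (cases "a = b")
      case ab: True
      show ?thesis
      proof (cases "b = c")
        case True
        then show ?thesis unfolding e ex unfolding A A1
          using ab eq eq' by (simp add: w_def A1 algebra_simps)
      next
        case False
        note g = gi[OF bd(3-6) False]
        show ?thesis unfolding e ex unfolding A A1
          using False by (cases "b < c"; simp add: w_def A1 ab eq[OF ab]; use g k in algebra)
      qed
    next
      case ab: False
      note g1 = gi[OF bd(1-4) ab]
      show ?thesis
      proof (cases "b = c")
        case True
        show ?thesis unfolding e ex unfolding A A1
          using ab by (cases "a < b"; simp add: w_def A1 eq'[OF True] True[symmetric]; use g1 k in algebra)
      next
        case bc: False
        note g2 = gi[OF bd(3-6) bc]
        show ?thesis
        proof (cases "a = c")
          case True
          show ?thesis unfolding e ex unfolding A A1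
          using ab bc by (cases "a < b"; simp add: w_def A1 eq''[OF True] True[symmetric]; use g1 g2 k in algebra)
        next
          case ac: False
          note g3 = gi[OF bd(1,2,5,6) ac]
          have w: "A (w d e) = (if d < e then A kap else 0)" for d e
            by (simp add: w_def A1)
          consider "a < b" "b < c" "a < c" | "a < b" "c < b" "a < c" | "a < b" "c < b" "c < a"
            | "b < a" "b < c" "a < c" | "b < a" "b < c" "c < a" | "b < a" "c < b" "c < a"
            using ab bc ac by linarith
          then show ?thesis unfolding e ex unfolding A A1
            by cases (simp add: w; use g1 g2 g3 k in algebra)+
        qed
      qed
    qed
  qed (use n1 in auto)
  then show ?thesis by simp
qed

end

section \<open>Cherednik operators and intertwiners\<close>

lemma fold_commute_op:
  assumes "\<And>j f. j \<in> set xs \<Longrightarrow> F j (H f) = H (F j f)"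
  shows "fold F xs (H f) = H (fold F xs f)"
  using assms by (induction xs arbitrary: f) simp_all

lemma foldr_fold_inverse:
  assumes "\<And>j f. j \<in> set xs \<Longrightarrow> F j (H j f) = f"
  shows "foldr F xs (fold H xs f) = f"
  using assms by (induction xs arbitrary: f) simp_all

lemma fold_foldr_inverse:
  assumes "\<And>j f. j \<in> set xs \<Longrightarrow> H j (F j f) = f"
  shows "fold H xs (foldr F xs f) = f"
  using assms by (induction xs arbitrary: f) simp_all

lemma upt_split_pair:
  assumes "a \<le> i" "Suc i < b"
  shows "[a..<b] = [a..<i] @ [i, Suc i] @ [Suc (Suc i)..<b]"
proof -
  have "[a..<b] = [a..<i] @ [i..<b]"
    using assms upt_add_eq_append[of a i "b - i"] by simp
  also have "[i..<b] = i # Suc i # [Suc (Suc i)..<b]"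
    using assms by (simp add: upt_conv_Cons)
  finally show ?thesis by simp
qed

lemma perm_act_inv:
  assumes "bij w"
  shows "perm_act w (perm_act (inv w) v) = v" "perm_act (inv w) (perm_act w v) = v"
proof -
  have "w (inv w x) = x" "inv w (w x) = x" for x
    using assms by (auto simp: bij_is_surj bij_is_inj surj_f_inv_f)
  then show "perm_act w (perm_act (inv w) v) = v" "perm_act (inv w) (perm_act w v) = v"
    using assms by (auto intro!: poly_mapping_eqI simp: lookup_perm_act bij_imp_bij_inv inv_inv_eq)
qed

lemma lin_fold: "(\<And>j. lin (F j)) \<Longrightarrow> lin (fold F xs)"
proof (induction xs)
  case (Cons x xs)
  have "lin (\<lambda>f. fold F xs (F x f))" by (rule lin_compose) (use Cons in auto)
  then show ?case by (simp add: comp_def)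
qed (simp add: lin_def)

lemma lin_foldr: "(\<And>j. lin (F j)) \<Longrightarrow> lin (foldr F xs)"
proof (induction xs)
  case (Cons x xs)
  have "lin (\<lambda>f. F x (foldr F xs f))" by (rule lin_compose) (use Cons in auto)
  then show ?case by (simp add: comp_def)
qed (simp add: lin_def)

context metaplectic
begin

text \<open>
  The Cherednik operators with \<open>T\<^sub>i\<inverse> = T\<^sub>i - (k - k\<inverse>)\<close>, which makes sense on all Laurent
  polynomials; \<open>\<Phi> = x\<^sub>1\<^sup>n \<omega>\<close> is the second intertwiner, and \<open>g = x\<^sub>1\<^sup>n T\<^sub>1 \<cdots> T\<^bsub>r-1\<^esub>\<close>
  satisfies \<open>\<Phi> = g Y\<^sub>r\<close>, so that \<open>T\<^sub>0 = g T\<^bsub>r-1\<^esub> g\<inverse>\<close> replaces \<open>\<Phi> T\<^bsub>r-1\<^esub> \<Phi>\<inverse>\<close> on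
  eigenvectors without involving \<open>q\<close>.
\<close>

definition Yop :: "nat \<Rightarrow> 'a poly fract laurent \<Rightarrow> 'a poly fract laurent" where
  "Yop i f = fold Ti [1..<i] (om (fold TT [i..<r] f))"

definition Phi :: "'a poly fract laurent \<Rightarrow> 'a poly fract laurent" where
  "Phi f = xpow (en 1) * om f"

definition gop :: "'a poly fract laurent \<Rightarrow> 'a poly fract laurent" where
  "gop f = xpow (en 1) * foldr TT [1..<r] f"

definition gopi :: "'a poly fract laurent \<Rightarrow> 'a poly fract laurent" where
  "gopi f = fold Ti [1..<r] (xpow (- en 1) * f)"

definition TA :: "nat \<Rightarrow> 'a poly fract laurent \<Rightarrow> 'a poly fract laurent" where
  "TA i f = (if i = 0 then gop (TT (r - 1) (gopi f)) else TT i f)"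

lemma lin_Yop: "lin (Yop i)"
  unfolding Yop_def[abs_def]
  by (intro lin_compose[OF lin_fold] lin_compose[OF lin_om] lin_fold lin_T lin_Ti)

lemma lin_Phi: "lin Phi"
  unfolding Phi_def[abs_def] by (intro lin_mult lin_om)

lemma lin_gop: "lin gop"
  unfolding gop_def[abs_def] by (intro lin_mult lin_foldr lin_T)

lemma lin_gopi: "lin gopi"
  unfolding gopi_def[abs_def] by (intro lin_compose[OF lin_fold] lin_mult lin_Ti lin_id)

lemma lin_TA: "lin (TA i)"
  unfolding TA_def[abs_def]
  by (cases "i = 0") (simp_all add: lin_T lin_compose[OF lin_gop lin_compose[OF lin_T lin_gopi]])

lemma gop_gopi [simp]: "gop (gopi f) = f"
  by (simp add: gop_def gopi_def foldr_fold_inverse xpow_mult_assoc)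

lemma gopi_gop [simp]: "gopi (gop f) = f"
  by (simp add: gop_def gopi_def fold_foldr_inverse xpow_mult_assoc)

lemma TA_quadratic: "TA i (TA i f) = lsmult kap (TA i f) + f"
  by (simp add: TA_def T_quadratic lin_add[OF lin_gop] lin_scale[OF lin_gop])

lemma T_commute': "Suc i < j \<or> Suc j < i \<Longrightarrow> TT i (TT j f) = TT j (TT i f)"
  using T_commute[of i j f] T_commute[of j i f] by metis

lemma Ti_T_commute: "Suc i < j \<or> Suc j < i \<Longrightarrow> Ti i (TT j f) = TT j (Ti i f)"
  using T_commute'[of i j f] by (simp add: Ti_def T_diff T_scale)

text \<open>The braid relation with inverses: a factor of index i+1 passes two consecutive inverse
  factors and comes out with index i.\<close>

lemma Ti_braid: "Ti (Suc i) (Ti i (TT (Suc i) f)) = TT i (Ti (Suc i) (Ti i f))"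
proof -
  define h where "h = Ti (Suc i) (Ti i f)"
  have "f = TT i (TT (Suc i) h)" by (simp add: h_def)
  then have "Ti (Suc i) (Ti i (TT (Suc i) f)) = Ti (Suc i) (Ti i (TT i (TT (Suc i) (TT i h))))"
    by (simp only: T_braid)
  then show ?thesis by (simp add: h_def)
qed

lemma Yop_T_same: "1 \<le> i \<Longrightarrow> i < r \<Longrightarrow> TT i (Yop (Suc i) (TT i f)) = Yop i f"
  by (simp add: Yop_def upt_conv_Cons[of i r])

text \<open>T_i passes the factors T_j, ..., T_{r-1}, becomes T_{i+1} when it crosses omega, and
  returns to T_i on crossing T_{i+1}^(-1) T_i^(-1).\<close>

lemma Yop_T_gt:
  assumes "1 \<le> i" "Suc i < j" "j \<le> r"
  shows "Yop j (TT i f) = TT i (Yop j f)"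
proof -
  define h where "h = om (fold TT [j..<r] f)"
  have "fold TT [j..<r] (TT i f) = TT i (fold TT [j..<r] f)"
    using assms by (intro fold_commute_op T_commute') auto
  then have "om (fold TT [j..<r] (TT i f)) = TT (Suc i) h"
    using assms by (simp add: om_T h_def)
  moreover have "fold Ti [1..<i] (TT (Suc i) h) = TT (Suc i) (fold Ti [1..<i] h)"
    by (intro fold_commute_op Ti_T_commute) auto
  moreover have "fold Ti [Suc (Suc i)..<j] (TT i f) = TT i (fold Ti [Suc (Suc i)..<j] f)" for f
    by (intro fold_commute_op Ti_T_commute) auto
  ultimately show ?thesis
    unfolding Yop_def h_def[symmetric] using upt_split_pair[of 1 i j] assms
    by (simp add: Ti_braid)
qed

text \<open>The mirror image: the braid relation lowers the index to i before omega, omega raises it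
  again, and the inverse factors have index below i.\<close>

lemma Yop_T_lt:
  assumes "1 \<le> j" "j \<le> i" "Suc i < r"
  shows "Yop j (TT (Suc i) f) = TT (Suc i) (Yop j f)"
proof -
  have "fold TT [j..<i] (TT (Suc i) f) = TT (Suc i) (fold TT [j..<i] f)"
    by (intro fold_commute_op T_commute') auto
  moreover have "fold TT [Suc (Suc i)..<r] (TT i f) = TT i (fold TT [Suc (Suc i)..<r] f)" for f
    by (intro fold_commute_op T_commute') auto
  ultimately have "fold TT [j..<r] (TT (Suc i) f) = TT i (fold TT [j..<r] f)"
    using upt_split_pair[of j i r] assms by (simp add: T_braid[symmetric])
  moreover have "fold Ti [1..<j] (TT (Suc i) f) = TT (Suc i) (fold Ti [1..<j] f)" for f
    using assms by (intro fold_commute_op Ti_T_commute) auto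
  ultimately show ?thesis
    using assms by (simp add: Yop_def om_T)
qed

lemma Ti_en: "Ti i (xpow (en (Suc i)) * f) = xpow (en i) * TT i f"
  by (simp add: Ti_def T_en_Suc)

lemma Ti_en_1: "1 < i \<Longrightarrow> Ti i (xpow (en 1) * f) = xpow (en 1) * Ti i f"
  by (simp add: Ti_def T_en_other lsmult_mult_right right_diff_distrib)

lemma om_Ti: "1 \<le> i \<Longrightarrow> Suc i < r \<Longrightarrow> om (Ti i f) = Ti (Suc i) (om f)"
  by (simp add: Ti_def om_T om_diff om_scale)

lemma om_fold_T:
  "1 \<le> i \<Longrightarrow> j < r \<Longrightarrow> om (fold TT [i..<j] f) = fold TT [Suc i..<Suc j] (om f)"
  by (induction j) (auto simp: om_T)

lemma om_fold_Ti:
  "1 \<le> i \<Longrightarrow> j < r \<Longrightarrow> om (fold Ti [i..<j] f) = fold Ti [Suc i..<Suc j] (om f)"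
  by (induction j) (auto simp: om_Ti)

text \<open>Since omega turns x_1^n into x_2^n, the factor T_1^(-1) restores x_1^n and leaves T_1.
  By the relation for omega squared this T_1 supplies the factor T_{r-1} that Y_{i+1} lacks in
  comparison with Y_i after the index shift.\<close>

lemma Yop_Phi:
  assumes "1 \<le> i" "i < r"
  shows "Yop (Suc i) (Phi f) = Phi (Yop i f)"
proof -
  have r: "r = Suc (r - 1)" and r1: "1 \<in> {1..<r}" using r2 by auto
  define h where "h = fold TT [i..<r - 1] f"
  define H where "H = om (fold TT [i..<r] f)"
  have "[i..<r] = [i..<r - 1] @ [r - 1]"
    using assms by (subst (1) r, subst upt_Suc) auto
  then have H: "H = om (TT (r - 1) h)" by (simp add: H_def h_def)
  have "fold TT [Suc i..<r] (xpow (en 1) * om f) = xpow (en 1) * fold TT [Suc i..<r] (om f)"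
    using assms by (intro fold_commute_op T_en_other) auto
  also have "fold TT [Suc i..<r] (om f) = om h"
    using om_fold_T[of i "r - 1" f] assms r by (simp add: h_def)
  finally have "om (fold TT [Suc i..<r] (Phi f)) = xpow (en (Suc 1)) * om (om h)"
    using om_en[OF r1] by (simp add: Phi_def)
  moreover have "Ti 1 (xpow (en (Suc 1)) * om (om h)) = xpow (en 1) * om H"
    by (simp only: Ti_en om_om_T[symmetric] H)
  moreover have "[1..<Suc i] = 1 # [Suc 1..<Suc i]"
    using assms by (intro upt_conv_Cons) auto
  ultimately have "Yop (Suc i) (Phi f) = fold Ti [Suc 1..<Suc i] (xpow (en 1) * om H)"
    by (simp add: Yop_def)
  also have "\<dots> = xpow (en 1) * fold Ti [Suc 1..<Suc i] (om H)"
    by (intro fold_commute_op Ti_en_1) auto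
  also have "fold Ti [Suc 1..<Suc i] (om H) = om (fold Ti [1..<i] H)"
    using assms by (intro om_fold_Ti[symmetric]) auto
  finally show ?thesis by (simp add: Phi_def Yop_def H_def)
qed

lemma fold_T_en: "1 \<le> m \<Longrightarrow> fold TT [1..<m] (xpow (en 1) * f) = xpow (en m) * fold Ti [1..<m] f"
proof (induction m rule: dec_induct)
  case (step m)
  have "TT m (xpow (en m) * g) = xpow (en (Suc m)) * Ti m g" for g
    by (simp add: T_en Ti_def right_diff_distrib lsmult_mult_right)
  with step show ?case by simp
qed simp

text \<open>The wrap-around case: all of T_1, ..., T_{r-1} turn into their inverses while x_1^n
  becomes x_r^n, and moving x_r^n through omega costs q^(-n).\<close>

lemma Yop_1_Phi: "Yop 1 (Phi f) = lsmult (qvar powi (- int n)) (Phi (Yop r f))"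
proof -
  have "Yop 1 (Phi f) = om (fold TT [1..<r] (xpow (en 1) * om f))"
    by (simp add: Yop_def Phi_def)
  also have "\<dots> = om (xpow (en r) * fold Ti [1..<r] (om f))"
    using r2 by (subst fold_T_en) auto
  finally show ?thesis by (simp add: Yop_def Phi_def om_en_r)
qed

lemma Phi_eq_gop: "Phi f = gop (Yop r f)"
  by (simp add: Phi_def gop_def Yop_def foldr_fold_inverse)

definition omi :: "'a poly fract laurent \<Rightarrow> 'a poly fract laurent" where
  "omi = lin_ext (\<lambda>\<nu>. lsmult (qvar powi (\<nu> \<cdot> 1))
     (xpow (perm_act (inv (\<lambda>i. if i = r then 1 else if i \<in> {1..<r} then Suc i else i)) \<nu>)))"

lemma lin_omi: "lin omi"
  unfolding omi_def by (rule lin_lin_ext)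

lemma om_omi [simp]: "om (omi f) = f" and omi_om [simp]: "omi (om f) = f"
proof -
  let ?\<rho> = "\<lambda>i. if i = r then 1 else if i \<in> {1..<r} then Suc i else i"
  have b: "bij ?\<rho>" and b': "bij (inv ?\<rho>)"
    using bij_rotate(1)[of r] r2 by (auto intro: bij_imp_bij_inv)
  have \<rho>: "rotate_weight r (perm_act (inv ?\<rho>) \<nu>) = \<nu>" "perm_act (inv ?\<rho>) (rotate_weight r \<nu>) = \<nu>"
    for \<nu> :: weight
    unfolding rotate_weight_def
    by (rule perm_act_inv[OF b])+
  have l: "perm_act (inv ?\<rho>) \<nu> \<cdot> r = \<nu> \<cdot> 1" for \<nu> :: weight
    using lookup_perm_act[OF b', of \<nu> r] inv_inv_eq[OF b] by simp
  have l': "rotate_weight r \<nu> \<cdot> 1 = \<nu> \<cdot> r" for \<nu> :: weight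
    using r2 by (simp add: lookup_rotate_weight)
  show "om (omi f) = f"
    by (rule lin_eqI[where F = "\<lambda>f. om (omi f)" and H = "\<lambda>f. f",
          OF lin_compose[OF lin_om lin_omi] lin_id])
      (simp add: omi_def om_scale om_xpow \<rho> l power_int_minus)
  show "omi (om f) = f"
    by (rule lin_eqI[where F = "\<lambda>f. omi (om f)" and H = "\<lambda>f. f",
          OF lin_compose[OF lin_omi lin_om] lin_id])
      (simp add: om_xpow lin_scale[OF lin_omi], simp add: omi_def \<rho> l'[simplified] power_int_minus)
qed

lemma Phi_surj: "\<exists>h. Phi h = f"
  by (rule exI[of _ "omi (xpow (- en 1) * f)"]) (simp add: Phi_def xpow_mult_assoc)

lemma Phi_inj: "Phi f = Phi h \<Longrightarrow> f = h"
proof -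
  assume "Phi f = Phi h"
  then have "xpow (- en 1) * (xpow (en 1) * om f) = xpow (- en 1) * (xpow (en 1) * om h)"
    by (simp add: Phi_def)
  then have "om f = om h" by (simp add: xpow_mult_assoc)
  then show ?thesis by (metis omi_om)
qed

text \<open>The span of f and T_i f is stable under Y_i and Y_{i+1}, with Y_{i+1} T_i f = y T_i^(-1)
  f. The coefficient of f is the one that diagonalises both operators.\<close>

lemma intertwiner:
  assumes i: "1 \<le> i" "i < r"
    and y: "Yop i f = lsmult y f" "Yop (Suc i) f = lsmult y' f" "y \<noteq> y'"
  defines "h \<equiv> TT i f + lsmult (kap * y / (y' - y)) f"
  shows "Yop i h = lsmult y' h" and "Yop (Suc i) h = lsmult y h"
proof -
  let ?c = "kap * y / (y' - y)"
  \<comment> \<open>The equation that determines the coefficient: comparison of the multiples of f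
    in Y_i h = y' h.\<close>
  have c: "?c * y' = kap * y + ?c * y"
    using y(3) by (simp add: field_simps)
  have s: "Yop (Suc i) (TT i f) = lsmult y (Ti i f)"
    using arg_cong[OF Yop_T_same[OF i, of f], of "Ti i"] by (simp add: y(1) Ti_scale)
  have t: "Yop i (TT i f) = lsmult (kap * y) f + lsmult y' (TT i f)"
    using Yop_T_same[OF i, of "TT i f"]
    by (simp add: T_quadratic lin_add[OF lin_Yop] lin_scale[OF lin_Yop] s y(2) T_add T_scale)
  show "Yop i h = lsmult y' h"
    unfolding h_def lin_add[OF lin_Yop] lin_scale[OF lin_Yop] t y(1) lsmult_add_right lsmult_lsmult
    using c by (simp add: mult.commute lsmult_add_left[symmetric] algebra_simps)
  show "Yop (Suc i) h = lsmult y h"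
    unfolding h_def lin_add[OF lin_Yop] lin_scale[OF lin_Yop] s y(2) lsmult_add_right lsmult_lsmult
      Ti_def lsmult_diff_right c
    by (simp add: mult.commute lsmult_add_left algebra_simps)
qed

end

section \<open>The eigenvalues and their behaviour under the generators\<close>

lemma eroot_eq_iff:
  assumes "a \<noteq> b" "c \<noteq> d"
  shows "(eroot a b :: weight) = eroot c d \<longleftrightarrow> a = c \<and> b = d"
proof
  assume "(eroot a b :: weight) = eroot c d"
  then have "(eroot a b :: weight) \<cdot> l = eroot c d \<cdot> l" for l by simp
  from this[of a] this[of b] show "a = c \<and> b = d"
    using assms by (auto simp: lookup_eroot split: if_splits)
qed simp

text \<open>Only roots that involve \<epsilon>_i pair nontrivially with it; the pairing is 1 if i is
  the first index and -1 if it is the second.\<close>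

lemma gamma_split:
  assumes "i \<in> {1..r}"
  shows "\<gamma> r n G i \<nu> = qvar powi (- \<nu> \<cdot> i) *
    const ((\<Prod>j\<in>{i<..r}. \<sigma> n G (\<nu> \<cdot> i - \<nu> \<cdot> j)) * (\<Prod>j\<in>{1..<i}. inverse (\<sigma> n G (\<nu> \<cdot> j - \<nu> \<cdot> i))))"
proof -
  define P where "P = {(a, b). a \<in> {1..r} \<and> b \<in> {1..r} \<and> a < b}"
  define F where "F = (\<lambda>\<alpha> :: weight. const (\<sigma> n G (ip \<nu> \<alpha>)) powi (ip (unit_vec i) \<alpha>))"
  have roots: "pos_roots r = (\<lambda>(a, b). eroot a b :: weight) ` P"
    by (auto simp: pos_roots_def P_def)
  have inj: "inj_on (\<lambda>(a, b). eroot a b :: weight) P"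
    by (auto simp: inj_on_def P_def eroot_eq_iff)
  have "finite P"
    by (rule finite_subset[of _ "{1..r} \<times> {1..r}"]) (auto simp: P_def)
  have "(\<Prod>\<alpha>\<in>pos_roots r. F \<alpha>) = (\<Prod>p\<in>P. F (eroot (fst p) (snd p)))"
    unfolding roots by (subst prod.reindex[OF inj]) (simp add: case_prod_beta comp_def)
  also have "\<dots> = (\<Prod>p\<in>Pair i ` {i<..r} \<union> (\<lambda>j. (j, i)) ` {1..<i}. F (eroot (fst p) (snd p)))"
  proof (intro prod.mono_neutral_right[OF \<open>finite P\<close>] ballI)
    show "Pair i ` {i<..r} \<union> (\<lambda>j. (j, i)) ` {1..<i} \<subseteq> P"
      using assms by (auto simp: P_def)
    fix p assume "p \<in> P - (Pair i ` {i<..r} \<union> (\<lambda>j. (j, i)) ` {1..<i})"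
    then show "F (eroot (fst p) (snd p)) = 1"
      by (auto simp: P_def F_def ip_eroot_right lookup_unit_vec image_iff)
  qed
  also have "\<dots> = (\<Prod>p\<in>Pair i ` {i<..r}. F (eroot (fst p) (snd p))) * (\<Prod>p\<in>(\<lambda>j. (j, i)) ` {1..<i}. F (eroot (fst p) (snd p)))"
    by (intro prod.union_disjoint) auto
  also have "(\<Prod>p\<in>Pair i ` {i<..r}. F (eroot (fst p) (snd p))) = (\<Prod>j\<in>{i<..r}. const (\<sigma> n G (\<nu> \<cdot> i - \<nu> \<cdot> j)))"
    by (subst prod.reindex) (auto simp: inj_on_def F_def ip_eroot_right lookup_unit_vec intro!: prod.cong)
  also have "(\<Prod>p\<in>(\<lambda>j. (j, i)) ` {1..<i}. F (eroot (fst p) (snd p))) =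
      (\<Prod>j\<in>{1..<i}. const (inverse (\<sigma> n G (\<nu> \<cdot> j - \<nu> \<cdot> i))))"
    by (subst prod.reindex)
      (auto simp: inj_on_def F_def ip_eroot_right lookup_unit_vec power_int_minus const_inverse intro!: prod.cong)
  finally show ?thesis
    by (simp add: \<gamma>_def F_def const_mult const_prod)
qed

lemma fund_weights_diff:
  assumes "\<nu> \<in> fund_weights r n" "1 \<le> i" "i \<le> j" "j \<le> r"
  shows "0 \<le> \<nu> \<cdot> i - \<nu> \<cdot> j" "\<nu> \<cdot> i - \<nu> \<cdot> j \<le> int n"
proof -
  have mono: "\<nu> \<cdot> b \<le> \<nu> \<cdot> a" if "1 \<le> a" "a \<le> b" "b \<le> r" for a b
    using that(2,1,3)
  proof (induction b rule: dec_induct)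
    case (step m)
    then have "\<nu> \<cdot> Suc m \<le> \<nu> \<cdot> m" using assms(1) by (auto simp: fund_weights_def)
    with step show ?case by simp
  qed simp
  have "\<nu> \<cdot> 1 - \<nu> \<cdot> r \<le> int n" using assms(1) by (simp add: fund_weights_def)
  with mono[of i j] mono[of 1 i] mono[of j r] assms
  show "0 \<le> \<nu> \<cdot> i - \<nu> \<cdot> j" "\<nu> \<cdot> i - \<nu> \<cdot> j \<le> int n" by auto
qed

definition gen_act :: "nat \<Rightarrow> nat \<Rightarrow> nat \<Rightarrow> weight \<Rightarrow> weight" where
  "gen_act n r i \<nu> = (if i = 0 then scale (int n) (eroot 1 r) + perm_act (transpose 1 r) \<nu>
     else perm_act (simple_refl i) \<nu>)"

text \<open>The affine root of the i-th generator: it vanishes where the generator fixes the weight,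
  and is nonnegative for all i < r exactly on the closed fundamental alcove dilated by n.\<close>

definition wall_dist :: "nat \<Rightarrow> nat \<Rightarrow> nat \<Rightarrow> weight \<Rightarrow> int" where
  "wall_dist n r i \<nu> = (if i = 0 then \<nu> \<cdot> r + int n - \<nu> \<cdot> 1 else \<nu> \<cdot> i - \<nu> \<cdot> Suc i)"

lemma lookup_gen_act_0:
  "1 < r \<Longrightarrow> gen_act n r 0 \<nu> \<cdot> j =
    (if j = 1 then \<nu> \<cdot> r + int n else if j = r then \<nu> \<cdot> 1 - int n else \<nu> \<cdot> j)"
  by (auto simp: gen_act_def lookup_add lookup_eroot lookup_perm_act transpose_def)

lemma lookup_gen_act: "i \<noteq> 0 \<Longrightarrow> gen_act n r i \<nu> \<cdot> j = \<nu> \<cdot> simple_refl i j"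
  by (simp add: gen_act_def)

context metaplectic
begin

lemma G_dvd: "int n dvd a \<Longrightarrow> G a = G 0"
  by (rule G_cong) simp

lemma G_nonzero: "G a \<noteq> 0"
  using G_dvd[of a] G0 G_inverse[of a] by (cases "int n dvd a") auto

lemma sigma_nonzero: "\<sigma> n G a \<noteq> 0"
  using G_nonzero by (simp add: \<sigma>_def)

lemma sigma_inverse: "a \<noteq> 0 \<Longrightarrow> inverse (\<sigma> n G (- a)) = \<sigma> n G a"
  using G_dvd[of a] G_dvd[of "- a"] G_inverse[of a]
  by (cases "int n dvd a") (auto simp: \<sigma>_def intro: inverse_unique simp: mult.commute)

text \<open>The sign condition in \<sigma> breaks periodicity at one place only, between 0 with
  value k and n with value k^(-1).\<close>

lemma sigma_shift: "a \<noteq> int n \<Longrightarrow> \<sigma> n G (a - int n) = \<sigma> n G a"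
proof -
  assume a: "a \<noteq> int n"
  have d: "int n dvd a - int n \<longleftrightarrow> int n dvd a"
    using dvd_add_left_iff[of "int n" "int n" "a - int n"] by simp
  show ?thesis
  proof (cases "int n dvd a")
    case True
    then have "a > 0 \<longleftrightarrow> a - int n > 0"
      using a by (metis diff_gt_0_iff_gt zdvd_imp_le le_less of_nat_0_le_iff less_trans n1 of_nat_0_less_iff less_le_trans zero_less_one)
    then show ?thesis using d True by (simp add: \<sigma>_def G_diff_n)
  next
    case False
    then show ?thesis using d by (simp add: \<sigma>_def G_diff_n)
  qed
qed

text \<open>One factor of an eigenvalue. For j < i it is the inverse of \<sigma>(\<nu>_j - \<nu>_i),
  which equals \<sigma>(\<nu>_i - \<nu>_j) except at 0, where it is k^(-1) instead of k. The flag
  records j < i.\<close>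

definition hh :: "bool \<Rightarrow> int \<Rightarrow> 'a" where
  "hh b a = (if a = 0 \<and> b then inverse (G 0) else \<sigma> n G a)"

text \<open>The flag was introduced for this: changing it together with a shift by n absorbs the
  jump of \<sigma> between n and 0.\<close>

lemma hh_shift: "hh True (a - int n) = hh False a"
  using sigma_shift[of a] n1 by (cases "a = int n") (auto simp: hh_def \<sigma>_def)

lemma hh_nonzero_arg: "a \<noteq> 0 \<Longrightarrow> hh b a = \<sigma> n G a"
  by (simp add: hh_def)

text \<open>The part of the i-th eigenvalue that is free of q.\<close>

definition Gam :: "nat \<Rightarrow> weight \<Rightarrow> 'a" where
  "Gam i \<nu> = (\<Prod>j\<in>{1..r} - {i}. hh (j < i) (\<nu> \<cdot> i - \<nu> \<cdot> j))"

lemma Gam_nonzero: "Gam i \<nu> \<noteq> 0"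
  using sigma_nonzero G0 by (simp add: Gam_def hh_def)

lemma gamma_eq:
  assumes "i \<in> {1..r}"
  shows "\<gamma> r n G i \<nu> = qvar powi (- \<nu> \<cdot> i) * const (Gam i \<nu>)"
proof -
  have "(\<Prod>j\<in>{i<..r}. \<sigma> n G (\<nu> \<cdot> i - \<nu> \<cdot> j)) = (\<Prod>j\<in>{i<..r}. hh (j < i) (\<nu> \<cdot> i - \<nu> \<cdot> j))"
    by (intro prod.cong) (auto simp: hh_def)
  moreover have "(\<Prod>j\<in>{1..<i}. inverse (\<sigma> n G (\<nu> \<cdot> j - \<nu> \<cdot> i))) = (\<Prod>j\<in>{1..<i}. hh (j < i) (\<nu> \<cdot> i - \<nu> \<cdot> j))"
  proof (intro prod.cong refl)
    fix j assume "j \<in> {1..<i}"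
    then show "inverse (\<sigma> n G (\<nu> \<cdot> j - \<nu> \<cdot> i)) = hh (j < i) (\<nu> \<cdot> i - \<nu> \<cdot> j)"
      using sigma_inverse[of "\<nu> \<cdot> i - \<nu> \<cdot> j"] by (cases "\<nu> \<cdot> i = \<nu> \<cdot> j") (auto simp: hh_def \<sigma>_def)
  qed
  moreover have "{1..r} - {i} = {i<..r} \<union> {1..<i}" using assms by auto
  moreover have "(\<Prod>j\<in>{i<..r} \<union> {1..<i}. hh (j < i) (\<nu> \<cdot> i - \<nu> \<cdot> j)) =
      (\<Prod>j\<in>{i<..r}. hh (j < i) (\<nu> \<cdot> i - \<nu> \<cdot> j)) * (\<Prod>j\<in>{1..<i}. hh (j < i) (\<nu> \<cdot> i - \<nu> \<cdot> j))"
    by (intro prod.union_disjoint) auto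
  ultimately show ?thesis
    by (simp only: gamma_split[OF assms] Gam_def)
qed

lemma Gam_reindex:
  assumes "p permutes {1..r}" "i \<in> {1..r}"
    and "\<And>j. j \<in> {1..r} - {i} \<Longrightarrow> hh (p j < p i) (\<mu> \<cdot> p i - \<mu> \<cdot> p j) = hh (j < i) (\<nu> \<cdot> i - \<nu> \<cdot> j)"
  shows "Gam (p i) \<mu> = Gam i \<nu>"
proof -
  have "bij_betw p ({1..r} - {i}) ({1..r} - {p i})"
    using permutes_imp_bij[OF assms(1)] assms(2)
    by (intro bij_betw_DiffI) (auto simp: bij_betw_def)
  then show ?thesis
    unfolding Gam_def by (subst prod.reindex_bij_betw[symmetric]) (use assms(3) in \<open>auto intro: prod.cong\<close>)
qed

text \<open>Off the wall, s_i preserves the relative order of any two positions with equal entries,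
  and that order is all that \<open>hh\<close> sees besides the entries.\<close>

lemma gamma_gen_act:
  assumes "1 \<le> i" "i < r" "wall_dist n r i \<nu> \<noteq> 0" "j \<in> {1..r}"
  shows "\<gamma> r n G (simple_refl i j) (gen_act n r i \<nu>) = \<gamma> r n G j \<nu>"
proof -
  have p: "simple_refl i permutes {1..r}"
    using assms by (intro simple_refl_permutes) auto
  have ne: "\<nu> \<cdot> i \<noteq> \<nu> \<cdot> Suc i"
    using assms by (simp add: wall_dist_def)
  have "Gam (simple_refl i j) (gen_act n r i \<nu>) = Gam j \<nu>"
  proof (rule Gam_reindex[OF p assms(4)])
    fix l assume l: "l \<in> {1..r} - {j}"
    show "hh (simple_refl i l < simple_refl i j)
        (gen_act n r i \<nu> \<cdot> simple_refl i j - gen_act n r i \<nu> \<cdot> simple_refl i l) =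
      hh (l < j) (\<nu> \<cdot> j - \<nu> \<cdot> l)"
    proof (cases "\<nu> \<cdot> j = \<nu> \<cdot> l")
      case True
      with ne l have "simple_refl i l < simple_refl i j \<longleftrightarrow> l < j"
        by (auto simp: simple_refl_apply)
      then show ?thesis using assms by (simp add: lookup_gen_act)
    next
      case False
      then show ?thesis using assms by (simp add: lookup_gen_act hh_nonzero_arg)
    qed
  qed
  moreover have "simple_refl i j \<in> {1..r}"
    using permutes_in_image[OF p] assms by blast
  ultimately show ?thesis
    using assms by (simp add: gamma_eq lookup_gen_act)
qed

text \<open>Compared with the other positions, 1 and r trade their order while their entries move by
  n; \<open>hh_shift\<close> says that these effects cancel. For the pair of 1 and r itself the
  shift is 2n, one half of which is invisible to \<sigma> off the wall.\<close>

lemma gamma_gen_act_0: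
  assumes "wall_dist n r 0 \<nu> \<noteq> 0" "j \<in> {1..r}"
  shows "\<gamma> r n G (transpose 1 r j) (gen_act n r 0 \<nu>) =
    qvar powi (int n * ((if j = 1 then 1 else 0) - (if j = r then 1 else 0))) * \<gamma> r n G j \<nu>"
proof -
  let ?p = "transpose 1 r"
  have p: "?p permutes {1..r}"
    using r2 by (intro permutes_swap_id) auto
  have ne: "\<nu> \<cdot> 1 - \<nu> \<cdot> r \<noteq> int n"
    using assms by (auto simp: wall_dist_def)
  \<comment> \<open>The entry that arrives at the image of position l, with the shift by n that
    accounts for the power of q.\<close>
  have a: "gen_act n r 0 \<nu> \<cdot> ?p l = \<nu> \<cdot> l + int n * ((if l = r then 1 else 0) - (if l = 1 then 1 else 0))" for l
    using r2 by (simp add: lookup_gen_act_0 transpose_def)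
  have hs: "hh False (a + int n) = hh True a" for a
    using hh_shift[of "a + int n"] by simp
  have "Gam (?p j) (gen_act n r 0 \<nu>) = Gam j \<nu>"
  proof (rule Gam_reindex[OF p assms(2)])
    fix l assume l: "l \<in> {1..r} - {j}"
    consider "l \<notin> {1, r}" "j \<notin> {1, r}" | "l = 1" "j \<notin> {1, r}" | "l = r" "j \<notin> {1, r}"
      | "j = 1" "l \<notin> {1, r}" | "j = r" "l \<notin> {1, r}" | "j = 1" "l = r" | "j = r" "l = 1"
      using l by auto
    then show "hh (?p l < ?p j) (gen_act n r 0 \<nu> \<cdot> ?p j - gen_act n r 0 \<nu> \<cdot> ?p l) =
      hh (l < j) (\<nu> \<cdot> j - \<nu> \<cdot> l)"
    proof cases
      case 2
      then show ?thesis
        unfolding a using r2 assms(2) hs[of "\<nu> \<cdot> j - \<nu> \<cdot> 1"] by (auto simp: transpose_def algebra_simps)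
    next
      case 3
      then show ?thesis
        unfolding a using r2 assms(2) hh_shift[of "\<nu> \<cdot> j - \<nu> \<cdot> r"] by (auto simp: transpose_def algebra_simps)
    next
      case 4
      then show ?thesis
        unfolding a using r2 l hh_shift[of "\<nu> \<cdot> 1 - \<nu> \<cdot> l"] by (auto simp: transpose_def algebra_simps)
    next
      case 5
      then show ?thesis
        unfolding a using r2 l hs[of "\<nu> \<cdot> r - \<nu> \<cdot> l"] by (auto simp: transpose_def algebra_simps)
    next
      case 6
      have "hh True (\<nu> \<cdot> 1 - \<nu> \<cdot> r - int n - int n) = hh False (\<nu> \<cdot> 1 - \<nu> \<cdot> r)"
        using hh_shift[of "\<nu> \<cdot> 1 - \<nu> \<cdot> r - int n"] sigma_shift[OF ne] by (simp add: hh_def)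
      then show ?thesis
        unfolding a using 6 r2 by (auto simp: transpose_def algebra_simps)
    next
      case 7
      have "\<sigma> n G (\<nu> \<cdot> r - \<nu> \<cdot> 1 + int n + int n) = \<sigma> n G (\<nu> \<cdot> r - \<nu> \<cdot> 1 + int n)"
        using ne sigma_shift[of "\<nu> \<cdot> r - \<nu> \<cdot> 1 + int n + int n"]
        unfolding add_diff_cancel_right' by auto
      then have "hh False (\<nu> \<cdot> r - \<nu> \<cdot> 1 + int n + int n) = hh True (\<nu> \<cdot> r - \<nu> \<cdot> 1)"
        using hs[of "\<nu> \<cdot> r - \<nu> \<cdot> 1"] by (simp add: hh_def)
      then show ?thesis
        unfolding a using 7 r2 by (auto simp: transpose_def algebra_simps)
    next
      case 1
      then show ?thesis
        unfolding a by (auto simp: transpose_def)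
    qed
  qed
  moreover have "?p j \<in> {1..r}"
    using permutes_in_image[OF p] assms by blast
  ultimately show ?thesis
    using assms(2) unfolding gamma_eq[OF assms(2)]
    by (simp only: gamma_eq a mult.assoc[symmetric] power_int_add[symmetric, of qvar] qvar_nonzero)
      (simp add: algebra_simps power_int_add[symmetric])
qed

definition eig :: "weight \<Rightarrow> 'a poly fract laurent \<Rightarrow> bool" where
  "eig \<mu> f \<longleftrightarrow> (\<forall>i\<in>{1..r}. Yop i f = lsmult (\<gamma> r n G i \<mu>) f)"

text \<open>The factors of Y_i carry the entry \<nu>_i to the last position, rotate it to the first,
  and bring it back to position i. Each swap exchanges entries whose difference lies in [0,n], so by
  \<open>T_dominant\<close> a monomial stays a monomial and the scalars multiply to the
  eigenvalue.\<close>

lemma eig_xpow: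
  assumes "\<nu> \<in> fund_weights r n"
  shows "eig \<nu> (xpow \<nu>)"
  unfolding eig_def
proof
  fix i assume i: "i \<in> {1..r}"
  note diff = fund_weights_diff[OF assms]
  \<comment> \<open>\<open>cyc m\<close> is the weight with the i-th entry moved right to position
    m, and \<open>ryc m\<close> the one with that entry moved left to position m; the rotation of
    \<open>cyc r\<close> is \<open>ryc 1\<close>.\<close>
  define cyc where "cyc m = fold (\<lambda>j. perm_act (simple_refl j)) [i..<m] \<nu>" for m
  define ryc where "ryc m = foldr (\<lambda>j. perm_act (simple_refl j)) [m..<i] \<nu>" for m
  have cyc: "cyc m \<cdot> l = (if l = m then \<nu> \<cdot> i else if i \<le> l \<and> l < m then \<nu> \<cdot> Suc l else \<nu> \<cdot> l)"
    if "i \<le> m" for m l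
    using that
  proof (induction m arbitrary: l rule: dec_induct)
    case base
    then show ?case by (simp add: cyc_def)
  next
    case (step m)
    have "cyc (Suc m) = perm_act (simple_refl m) (cyc m)"
      using step by (simp add: cyc_def)
    then show ?case using step by (auto simp: simple_refl_apply)
  qed
  have ryc_step: "ryc m = perm_act (simple_refl m) (ryc (Suc m))" if "m < i" for m
    using that by (simp add: ryc_def upt_conv_Cons)
  have ryc: "ryc m \<cdot> l = (if l = m then \<nu> \<cdot> i else if m < l \<and> l \<le> i then \<nu> \<cdot> (l - 1) else \<nu> \<cdot> l)"
    if "m \<le> i" for m l
    using that
  proof (induction m arbitrary: l rule: inc_induct)
    case base
    then show ?case by (simp add: ryc_def)
  next
    case (step m)
    then show ?case by (auto simp: ryc_step simple_refl_apply)
  qed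
  have A: "fold TT [i..<m] (xpow \<nu>) = lsmult (const (\<Prod>j\<in>{i<..m}. \<sigma> n G (\<nu> \<cdot> i - \<nu> \<cdot> j))) (xpow (cyc m))"
    if "i \<le> m" "m \<le> r" for m
    using that
  proof (induction m rule: dec_induct)
    case base
    then show ?case by (simp add: cyc_def)
  next
    case (step m)
    have d: "cyc m \<cdot> m - cyc m \<cdot> Suc m = \<nu> \<cdot> i - \<nu> \<cdot> Suc m"
      using step by (simp add: cyc)
    have "cyc (Suc m) = perm_act (simple_refl m) (cyc m)"
      using step by (simp add: cyc_def)
    moreover have "{i<..Suc m} = insert (Suc m) {i<..m}" using step by auto
    moreover have "TT m (xpow (cyc m)) = lsmult (const (\<sigma> n G (\<nu> \<cdot> i - \<nu> \<cdot> Suc m))) (xpow (perm_act (simple_refl m) (cyc m)))"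
      using T_dominant[of "cyc m" m] diff[of i "Suc m"] i step by (simp add: d)
    ultimately show ?case
      using step by (simp add: T_scale const_mult mult.commute)
  qed
  have B: "fold Ti [1..<m] (xpow (ryc 1)) = lsmult (const (\<Prod>j\<in>{1..<m}. inverse (\<sigma> n G (\<nu> \<cdot> j - \<nu> \<cdot> i)))) (xpow (ryc m))"
    if "1 \<le> m" "m \<le> i" for m
    using that
  proof (induction m rule: dec_induct)
    case (step m)
    let ?s = "\<sigma> n G (\<nu> \<cdot> m - \<nu> \<cdot> i)"
    have d: "ryc (Suc m) \<cdot> m - ryc (Suc m) \<cdot> Suc m = \<nu> \<cdot> m - \<nu> \<cdot> i"
      using step by (simp add: ryc)
    have "TT m (xpow (ryc (Suc m))) = lsmult (const ?s) (xpow (ryc m))"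
      using T_dominant[of "ryc (Suc m)" m] diff[of m i] i step by (simp add: d ryc_step)
    then have "Ti m (lsmult (const ?s) (xpow (ryc m))) = xpow (ryc (Suc m))"
      by (metis Ti_T)
    then have "Ti m (xpow (ryc m)) = lsmult (inverse (const ?s)) (xpow (ryc (Suc m)))"
      using sigma_nonzero by (simp add: Ti_scale flip: \<open>Ti m (lsmult (const ?s) (xpow (ryc m))) = xpow (ryc (Suc m))\<close>)
    then show ?case
      using step by (simp add: Ti_scale const_mult const_inverse)
  qed simp
  have "rotate_weight r (cyc r) = ryc 1"
    using i r2 by (intro poly_mapping_eqI) (auto simp: lookup_rotate_weight cyc ryc)
  moreover have "cyc r \<cdot> r = \<nu> \<cdot> i" using i by (simp add: cyc)
  moreover have "ryc i = \<nu>" by (simp add: ryc_def)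
  ultimately show "Yop i (xpow \<nu>) = lsmult (\<gamma> r n G i \<nu>) (xpow \<nu>)"
    using i A[of r] B[of i] lin_scale[OF lin_fold[of Ti "[1..<i]", OF lin_Ti]]
    by (simp add: Yop_def om_scale om_xpow gamma_split const_mult mult_ac)
qed

text \<open>With \<open>eig_hi\<close>, the pair of eigenvalues for the intertwiner. For i = 0 the
  pair belongs to Y_{r-1} and Y_r on the preimage under \<open>Phi\<close>: the shift of indices
  gives the eigenvalue at r, and the wrap-around gives q^n times the one at 1.\<close>

definition eig_lo :: "nat \<Rightarrow> weight \<Rightarrow> 'a poly fract" where
  "eig_lo i \<mu> = (if i = 0 then \<gamma> r n G r \<mu> else \<gamma> r n G i \<mu>)"

definition eig_hi :: "nat \<Rightarrow> weight \<Rightarrow> 'a poly fract" where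
  "eig_hi i \<mu> = (if i = 0 then qvar powi int n * \<gamma> r n G 1 \<mu> else \<gamma> r n G (Suc i) \<mu>)"

definition cc :: "nat \<Rightarrow> weight \<Rightarrow> 'a poly fract" where
  "cc i \<mu> = kap * eig_lo i \<mu> / (eig_hi i \<mu> - eig_lo i \<mu>)"

text \<open>C is the ratio of the parts \<open>Gam\<close>. For i = 0 the factor q^n in
  \<open>eig_hi\<close> completes the difference of exponents to the affine root.\<close>

lemma eig_ratio:
  assumes "i < r"
  obtains C where "C \<noteq> 0" "eig_hi i \<mu> \<noteq> 0"
    "eig_lo i \<mu> = qvar powi (- wall_dist n r i \<mu>) * const C * eig_hi i \<mu>"
proof -
  have nz: "\<gamma> r n G j \<mu> \<noteq> 0" if "j \<in> {1..r}" for j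
    using Gam_nonzero that by (simp add: gamma_eq)
  have ratio: "qvar powi a * const (Gam j \<mu>) =
      qvar powi (a - b) * const (Gam j \<mu> / Gam l \<mu>) * (qvar powi b * const (Gam l \<mu>))" for a b j l
  proof -
    have "qvar powi (a - b) * const (Gam j \<mu> / Gam l \<mu>) * (qvar powi b * const (Gam l \<mu>)) =
        (qvar powi (a - b) * qvar powi b) * (const (Gam j \<mu> / Gam l \<mu>) * const (Gam l \<mu>))"
      by (simp only: mult_ac)
    also have "\<dots> = qvar powi a * const (Gam j \<mu>)"
      by (simp add: power_int_add[symmetric] const_mult[symmetric] Gam_nonzero)
    finally show ?thesis ..
  qed
  show thesis
  proof (cases "i = 0")
    case True
    have "eig_hi i \<mu> = qvar powi (int n - \<mu> \<cdot> 1) * const (Gam 1 \<mu>)"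
      using True r2 by (simp add: eig_hi_def gamma_eq power_int_diff power_int_minus divide_inverse)
    moreover have "eig_lo i \<mu> = qvar powi (- \<mu> \<cdot> r) * const (Gam r \<mu>)"
      using True r2 by (simp add: eig_lo_def gamma_eq)
    moreover have "- wall_dist n r i \<mu> = - \<mu> \<cdot> r - (int n - \<mu> \<cdot> 1)"
      using True by (simp add: wall_dist_def)
    ultimately show ?thesis
      using that[of "Gam r \<mu> / Gam 1 \<mu>"] ratio[of "- \<mu> \<cdot> r" r "int n - \<mu> \<cdot> 1" 1] Gam_nonzero
      by simp
  next
    case False
    have "eig_hi i \<mu> = qvar powi (- \<mu> \<cdot> Suc i) * const (Gam (Suc i) \<mu>)"
      "eig_lo i \<mu> = qvar powi (- \<mu> \<cdot> i) * const (Gam i \<mu>)"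
      using False assms by (simp_all add: eig_hi_def eig_lo_def gamma_eq)
    moreover have "- wall_dist n r i \<mu> = - \<mu> \<cdot> i - (- \<mu> \<cdot> Suc i)"
      using False by (simp add: wall_dist_def)
    ultimately show ?thesis
      using that[of "Gam i \<mu> / Gam (Suc i) \<mu>"] ratio[of "- \<mu> \<cdot> i" i "- \<mu> \<cdot> Suc i" "Suc i"] Gam_nonzero
      by simp
  qed
qed

end

lemma qvar_power: "(qvar :: 'a::field poly fract) ^ m = Fract ([:0, 1:] ^ m) 1"
  by (induction m) (simp_all add: qvar_def One_fract_def)

lemma qvar_powi_eq_const:
  assumes "(qvar :: 'a::field poly fract) powi d = const c"
  shows "d = 0"
proof -
  have *: "m = 0" if "(qvar :: 'a poly fract) ^ m = const c" for m c
  proof -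
    have "[:0, 1:] ^ m = [:c:]"
      using that by (simp add: qvar_power const_def eq_fract)
    then have "degree ([:0, 1:] ^ m :: 'a poly) = 0" by simp
    then show ?thesis by (simp add: degree_power_eq)
  qed
  show ?thesis
  proof (cases "d \<ge> 0")
    case True
    then show ?thesis using *[of "nat d" c] assms by (simp add: power_int_def)
  next
    case False
    then have "inverse (qvar ^ nat (- d)) = const c"
      using assms by (simp add: power_int_def power_inverse)
    then have "qvar ^ nat (- d) = const (inverse c)"
      unfolding const_inverse by (metis inverse_inverse_eq)
    then show ?thesis using * False by fastforce
  qed
qed

section \<open>Reduced words in the symmetric group\<close>

definition sprod :: "nat list \<Rightarrow> nat \<Rightarrow> nat" where
  "sprod = word_prod (\<circ>) id simple_refl"

lemma sprod_Nil: "sprod [] = id"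
  and sprod_Cons: "sprod (i # ws) = simple_refl i \<circ> sprod ws"
  by (simp_all add: sprod_def word_prod_def)

lemma sprod_append: "sprod (ws @ vs) = sprod ws \<circ> sprod vs"
  by (induction ws) (simp_all add: comp_assoc sprod_Nil sprod_Cons)

lemma sprod_snoc: "sprod (ws @ [i]) = sprod ws \<circ> simple_refl i"
  unfolding sprod_append sprod_Cons sprod_Nil by simp

lemma sprod_permutes: "set ws \<subseteq> {1..<r} \<Longrightarrow> sprod ws permutes {1..r}"
proof (induction ws)
  case (Cons i ws)
  then show ?case
    unfolding sprod_Cons by (intro permutes_compose simple_refl_permutes) auto
qed (simp add: permutes_id sprod_Nil)

lemma bij_sprod [simp]: "bij (sprod ws)"
proof (induction ws)
  case Nil
  show ?case unfolding sprod_Nil by (rule bij_id)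
next
  case (Cons i ws)
  show ?case unfolding sprod_Cons by (rule bij_comp[OF Cons bij_simple_refl])
qed

lemma comp_simple_refl [simp]: "v \<circ> simple_refl i \<circ> simple_refl i = v"
  by (simp add: fun_eq_iff)

lemma comp_simple_refl_permutes:
  "v permutes {1..r} \<Longrightarrow> 1 \<le> i \<Longrightarrow> i < r \<Longrightarrow> v \<circ> simple_refl i permutes {1..r}"
  by (rule permutes_compose[OF simple_refl_permutes]) auto

lemma simple_refl_commute:
  "Suc p < q \<Longrightarrow> simple_refl p (simple_refl q (simple_refl p x)) = simple_refl q x"
  unfolding simple_refl_apply by auto

lemma simple_refl_braid:
  "simple_refl p (simple_refl (Suc p) (simple_refl p (simple_refl (Suc p) (simple_refl p x)))) =
    simple_refl (Suc p) x"
  unfolding simple_refl_apply by auto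

definition inversions :: "nat \<Rightarrow> (nat \<Rightarrow> nat) \<Rightarrow> (nat \<times> nat) set" where
  "inversions r v = {(a, b). 1 \<le> a \<and> a < b \<and> b \<le> r \<and> v b < v a}"

lemma finite_inversions [simp]: "finite (inversions r v)"
  by (rule finite_subset[of _ "{1..r} \<times> {1..r}"]) (auto simp: inversions_def)

lemma inversions_id: "inversions r id = {}"
  by (auto simp: inversions_def)

text \<open>Relabelling positions by s_i matches the inversions on both sides, except that (i, i+1)
  is new.\<close>

lemma card_inversions_right:
  assumes "1 \<le> i" "i < r" "v i < v (Suc i)"
  shows "card (inversions r (v \<circ> simple_refl i)) = Suc (card (inversions r v))"
proof -
  let ?m = "map_prod (simple_refl i) (simple_refl i)"
  have inv: "?m (?m p) = p" for p by (cases p) simp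
  have "inversions r (v \<circ> simple_refl i) = insert (i, Suc i) (?m ` inversions r v)"
  proof (rule set_eqI)
    fix p
    have "p \<in> ?m ` inversions r v \<longleftrightarrow> ?m p \<in> inversions r v"
      using inv by (metis image_iff)
    moreover have "p \<in> inversions r (v \<circ> simple_refl i) \<longleftrightarrow> p = (i, Suc i) \<or> ?m p \<in> inversions r v"
      using assms by (cases p) (auto simp: inversions_def simple_refl_apply split: if_splits)
    ultimately show "p \<in> inversions r (v \<circ> simple_refl i) \<longleftrightarrow> p \<in> insert (i, Suc i) (?m ` inversions r v)"
      by simp
  qed
  moreover have "(i, Suc i) \<notin> ?m ` inversions r v"
    by (auto simp: inversions_def simple_refl_apply split: if_splits)
  moreover have "inj_on ?m (inversions r v)"
    using inv by (metis inj_on_inverseI)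
  ultimately show ?thesis by (simp add: card_image)
qed

lemma card_inversions_right_less:
  assumes "1 \<le> i" "i < r" "v (Suc i) < v i"
  shows "card (inversions r v) = Suc (card (inversions r (v \<circ> simple_refl i)))"
  using card_inversions_right[of i r "v \<circ> simple_refl i"] assms by (simp add: simple_refl_apply)

text \<open>Exchanging the adjacent values i and i+1 alters only the comparison between the two
  positions where they occur.\<close>

lemma card_inversions_left:
  assumes "v permutes {1..r}" "1 \<le> i" "i < r" "inv v i < inv v (Suc i)"
  shows "card (inversions r (simple_refl i \<circ> v)) = Suc (card (inversions r v))"
proof -
  have b: "bij v" using assms permutes_bij by blast
  have iv: "v x = y \<longleftrightarrow> x = inv v y" for x y
    using inv_eq_iff_eq[OF b, of y x] by auto
  have "inv v i \<in> {1..r}" "inv v (Suc i) \<in> {1..r}"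
    unfolding permutes_in_image[OF permutes_inv[OF assms(1)]] using assms by auto
  moreover have "simple_refl i (v b) < simple_refl i (v a) \<longleftrightarrow> (a, b) = (inv v i, inv v (Suc i)) \<or> v b < v a"
    if "a < b" for a b
  proof -
    consider "v a = i" "v b = Suc i" | "v a = Suc i" "v b = i"
      | "\<not> (v a = i \<and> v b = Suc i)" "\<not> (v a = Suc i \<and> v b = i)" by blast
    then show ?thesis
    proof cases
      case 1
      then have "(a, b) = (inv v i, inv v (Suc i))" using iv by auto
      then show ?thesis using 1 by (simp add: simple_refl_apply)
    next
      case 2
      then have "b = inv v i" "a = inv v (Suc i)" using iv by auto
      then show ?thesis using assms(4) that by simp
    next
      case 3
      then have "(a, b) \<noteq> (inv v i, inv v (Suc i))" using iv by blast
      moreover have "v a \<noteq> v b" using that iv by (metis less_irrefl)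
      ultimately show ?thesis using 3 by (auto simp: simple_refl_apply)
    qed
  qed
  ultimately have "inversions r (simple_refl i \<circ> v) = insert (inv v i, inv v (Suc i)) (inversions r v)"
    using assms(4) unfolding inversions_def by fastforce
  moreover have "(inv v i, inv v (Suc i)) \<notin> inversions r v"
    using iv[THEN iffD2, OF refl] by (simp add: inversions_def)
  ultimately show ?thesis by simp
qed

text \<open>Reducedness measured by inversions, which can be followed letter by letter;
  \<open>sym_reducedD\<close> connects it with minimal length.\<close>

definition red_word :: "nat \<Rightarrow> nat list \<Rightarrow> bool" where
  "red_word r ws \<longleftrightarrow> set ws \<subseteq> {1..<r} \<and> length ws = card (inversions r (sprod ws))"

lemma card_inversions_le:
  assumes "set ws \<subseteq> {1..<r}"
  shows "card (inversions r (sprod ws)) \<le> length ws"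
  using assms
proof (induction ws rule: rev_induct)
  case (snoc i ws)
  then have i: "1 \<le> i" "i < r" by auto
  have "sprod ws i \<noteq> sprod ws (Suc i)"
    using bij_is_inj[OF bij_sprod] by (metis injD n_not_Suc_n)
  then consider "sprod ws i < sprod ws (Suc i)" | "sprod ws (Suc i) < sprod ws i" by linarith
  then show ?case
    using snoc card_inversions_right[OF i, of "sprod ws"] card_inversions_right_less[OF i, of "sprod ws"]
    unfolding sprod_snoc comp_def by cases auto
qed (simp add: sprod_Nil inversions_id)

lemma red_word_exists:
  assumes "v permutes {1..r}"
  shows "\<exists>ws. red_word r ws \<and> sprod ws = v"
  using assms
proof (induction "card (inversions r v)" arbitrary: v rule: less_induct)
  case less
  show ?case
  proof (cases "\<exists>i. 1 \<le> i \<and> i < r \<and> v (Suc i) < v i")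
    case True
    then obtain i where i: "1 \<le> i" "i < r" "v (Suc i) < v i" by blast
    note c = card_inversions_right_less[OF i]
    have "v \<circ> simple_refl i permutes {1..r}"
      using i less.prems by (intro comp_simple_refl_permutes)
    with less.hyps c obtain ws where "red_word r ws" "sprod ws = v \<circ> simple_refl i"
      by (metis lessI)
    then have "red_word r (ws @ [i]) \<and> sprod (ws @ [i]) = v"
      using i c by (simp add: red_word_def sprod_snoc)
    then show ?thesis by blast
  next
    case False
    have "v i < v (Suc i)" if "1 \<le> i" "i < r" for i
      using False that permutes_inj[OF less.prems] by (metis injD linorder_neqE_nat n_not_Suc_n)
    \<comment> \<open>Without descents the permutation is increasing on 1, ..., r, hence never
      decreases a point there and must be the identity.\<close>
    then have mono: "x \<le> v x" if "x \<in> {1..r}" for x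
      using that
    proof (induction x)
      case (Suc x)
      show ?case
      proof (cases "x = 0")
        case True
        then show ?thesis using permutes_in_image[OF less.prems, of 1] Suc.prems by auto
      next
        case False
        with Suc have "x \<le> v x" by auto
        also have "v x < v (Suc x)"
          using False Suc.prems \<open>\<And>i. 1 \<le> i \<Longrightarrow> i < r \<Longrightarrow> v i < v (Suc i)\<close>[of x] by auto
        finally show ?thesis by simp
      qed
    qed simp
    then have "v = id"
      using permutes_natset_ge[OF less.prems] by blast
    then have "red_word r [] \<and> sprod [] = v"
      by (simp add: red_word_def inversions_id sprod_Nil)
    then show ?thesis by blast
  qed
qed

lemma sym_reducedD:
  assumes "sym_reduced r ws v"
  shows "red_word r ws" "sprod ws = v"
proof -
  have ws: "set ws \<subseteq> {1..<r}" "sprod ws = v"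
    and len: "length ws = (LEAST l. \<exists>ws. set ws \<subseteq> {1..<r} \<and> sprod ws = v \<and> length ws = l)"
    using assms by (simp_all add: sym_reduced_def reduced_word_def word_length_def sprod_def)
  obtain vs where vs: "red_word r vs" "sprod vs = v"
    using red_word_exists[OF sprod_permutes[OF ws(1)]] ws(2) by blast
  have "length ws \<le> length vs"
    unfolding len using vs by (intro Least_le) (auto simp: red_word_def)
  then show "red_word r ws" "sprod ws = v"
    using card_inversions_le[OF ws(1)] vs ws by (auto simp: red_word_def)
qed

lemma red_word_snocD:
  assumes "red_word r (ws @ [i])"
  shows "red_word r ws" "1 \<le> i" "i < r" "sprod ws i < sprod ws (Suc i)"
proof -
  show i: "1 \<le> i" "i < r" using assms by (auto simp: red_word_def)
  have ws: "set ws \<subseteq> {1..<r}" using assms by (auto simp: red_word_def)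
  have "sprod ws i \<noteq> sprod ws (Suc i)"
    using bij_is_inj[OF bij_sprod] by (metis injD n_not_Suc_n)
  moreover have "\<not> sprod ws (Suc i) < sprod ws i"
    using card_inversions_right_less[OF i, of "sprod ws"] card_inversions_le[OF ws] assms
    by (auto simp: red_word_def sprod_snoc)
  ultimately show lt: "sprod ws i < sprod ws (Suc i)" by linarith
  show "red_word r ws"
    using card_inversions_right[OF i lt] assms by (auto simp: red_word_def sprod_snoc)
qed

lemma red_word_snocI:
  assumes "red_word r ws" "1 \<le> i" "i < r" "sprod ws i < sprod ws (Suc i)"
  shows "red_word r (ws @ [i])"
  using assms card_inversions_right[OF assms(2-4)] by (simp add: red_word_def sprod_snoc)

lemma red_word_for:
  assumes "v permutes {1..r}"
  obtains ws where "red_word r ws" "sprod ws = v"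
  using red_word_exists[OF assms] by blast

text \<open>Matsumoto's theorem, by induction on the length. If the last letters p and q differ,
  both are descents of v, so v has reduced words that end in the two alternating expressions of the
  longest element generated by s_p and s_q. One relation of \<open>F\<close> compares these two
  words; every other comparison shares its last letter and follows by induction.\<close>

lemma matsumoto:
  fixes F :: "nat \<Rightarrow> 'b \<Rightarrow> 'b"
  assumes comm: "\<And>i j f. Suc i < j \<Longrightarrow> F i (F j f) = F j (F i f)"
    and braid: "\<And>i f. F i (F (Suc i) (F i f)) = F (Suc i) (F i (F (Suc i) f))"
    and "red_word r ws" "red_word r ws'" "sprod ws = sprod ws'"
  shows "foldr F ws f = foldr F ws' f"
  using assms(3-)
proof (induction "length ws" arbitrary: ws ws' f rule: less_induct)
  case less
  have len: "length ws = length ws'" using less.prems by (simp add: red_word_def)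
  show ?case
  proof (cases ws rule: rev_cases)
    case Nil
    then show ?thesis using len by simp
  next
    case (snoc a i)
    then obtain b j where b: "ws' = b @ [j]" using len by (metis length_0_conv rev_exhaust snoc_eq_iff_butlast)
    note A = red_word_snocD[OF less.prems(1)[unfolded snoc]] and B = red_word_snocD[OF less.prems(2)[unfolded b]]
    define v where "v = sprod ws"
    have va: "sprod a = v \<circ> simple_refl i"
      unfolding v_def snoc sprod_snoc comp_simple_refl ..
    have vb: "sprod b = v \<circ> simple_refl j"
      unfolding v_def less.prems(3) b sprod_snoc comp_simple_refl ..
    have vp: "v permutes {1..r}"
      unfolding v_def using less.prems(1) by (intro sprod_permutes) (auto simp: red_word_def)
    have di: "v (Suc i) < v i" and dj: "v (Suc j) < v j"
      using A(4) B(4) by (simp_all add: va vb simple_refl_apply)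
    \<comment> \<open>By symmetry the smaller of the two last letters may be called p.\<close>
    have main: "foldr F (x @ [p]) f = foldr F (y @ [q]) f"
      if x: "red_word r x" "sprod x = v \<circ> simple_refl p" "1 \<le> p" "v (Suc p) < v p"
        and y: "red_word r y" "sprod y = v \<circ> simple_refl q" "q < r" "v (Suc q) < v q"
        and l: "length x < length ws" "length y < length ws" and pq: "p < q" for x y p q
    proof (cases "q = Suc p")
      case False
      have pq': "Suc p < q" "1 \<le> q" "p < r" using False pq x y by auto
      have "v \<circ> simple_refl p \<circ> simple_refl q permutes {1..r}"
        using x(3) y(3) pq' by (intro comp_simple_refl_permutes vp)
      then obtain c where c: "red_word r c" "sprod c = v \<circ> simple_refl p \<circ> simple_refl q"
        by (rule red_word_for)
      have cq: "red_word r (c @ [q])"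
        using c pq' x(4) y(3,4) by (intro red_word_snocI) (simp_all add: simple_refl_apply)
      have cp: "red_word r (c @ [p])"
        using c pq' x(3,4) by (intro red_word_snocI) (simp_all add: simple_refl_apply)
      have "sprod (c @ [q]) = sprod x"
        unfolding sprod_snoc c(2) x(2) comp_simple_refl ..
      moreover have "sprod (c @ [p]) = sprod y"
        unfolding sprod_snoc c(2) y(2) by (simp add: fun_eq_iff simple_refl_commute[OF pq'(1)])
      ultimately have "foldr F x g = foldr F (c @ [q]) g" "foldr F y g = foldr F (c @ [p]) g" for g
        using less.hyps[OF l(1) x(1) cq] less.hyps[OF l(2) y(1) cp] by simp_all
      then show ?thesis using comm[of p q] pq'(1) by simp
    next
      case True
      \<comment> \<open>\<open>c\<close> will spell v with the longest element of the braid pair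
        removed; appending p, q, p or q, p, q gives the two words.\<close>
      have "v \<circ> simple_refl p \<circ> simple_refl q \<circ> simple_refl p permutes {1..r}"
        using x(3) y(3) pq by (intro comp_simple_refl_permutes vp) auto
      then obtain c where c: "red_word r c" "sprod c = v \<circ> simple_refl p \<circ> simple_refl q \<circ> simple_refl p"
        by (rule red_word_for)
      have vs: "v (Suc (Suc p)) < v (Suc p)" "v (Suc p) < v p" "Suc p < r"
        using x(4) y(3,4) True by auto
      have c1: "red_word r (c @ [p])" "red_word r (c @ [q])"
        using c x(3) vs True by (auto intro!: red_word_snocI simp: simple_refl_apply)
      have c2: "red_word r ((c @ [p]) @ [q])"
        using c x(3) vs True by (intro red_word_snocI c1) (simp_all add: simple_refl_apply sprod_snoc)
      have c3: "red_word r ((c @ [q]) @ [p])"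
        using c x(3) vs True by (intro red_word_snocI c1) (simp_all add: simple_refl_apply sprod_snoc)
      have "sprod ((c @ [p]) @ [q]) = sprod x"
        unfolding sprod_snoc c(2) x(2) comp_simple_refl ..
      moreover have "sprod ((c @ [q]) @ [p]) = sprod y"
        unfolding sprod_snoc c(2) y(2) True by (simp add: fun_eq_iff simple_refl_braid)
      ultimately have "foldr F x g = foldr F ((c @ [p]) @ [q]) g" "foldr F y g = foldr F ((c @ [q]) @ [p]) g" for g
        using less.hyps[OF l(1) x(1) c2] less.hyps[OF l(2) y(1) c3] by simp_all
      then show ?thesis using braid[of p] True by simp
    qed
    consider "i = j" | "i < j" | "j < i" by linarith
    then show ?thesis
    proof cases
      case 1
      then have "foldr F a g = foldr F b g" for g
        using less.hyps[OF _ A(1) B(1)] va vb snoc by simp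
      then show ?thesis using snoc b 1 by simp
    next
      case 2
      then show ?thesis
        using main[OF A(1) va A(2) di B(1) vb B(3) dj] snoc b len by simp
    next
      case 3
      then show ?thesis
        using main[OF B(1) vb B(2) dj A(1) va A(3) di] snoc b len by simp
    qed
  qed
qed

lemma red_word_ConsD:
  assumes "red_word r (i # ws)"
  shows "red_word r ws" "1 \<le> i" "i < r" "inv (sprod ws) i < inv (sprod ws) (Suc i)"
proof -
  show i: "1 \<le> i" "i < r" using assms by (auto simp: red_word_def)
  have ws: "set ws \<subseteq> {1..<r}" using assms by (auto simp: red_word_def)
  note p = sprod_permutes[OF ws]
  have len: "Suc (length ws) = card (inversions r (simple_refl i \<circ> sprod ws))"
    using assms by (simp add: red_word_def sprod_Cons)
  have "inv (sprod ws) i \<noteq> inv (sprod ws) (Suc i)"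
    using permutes_inj[OF permutes_inv[OF p]] by (metis injD n_not_Suc_n)
  moreover have "\<not> inv (sprod ws) (Suc i) < inv (sprod ws) i"
  proof
    assume lt: "inv (sprod ws) (Suc i) < inv (sprod ws) i"
    let ?v = "simple_refl i \<circ> sprod ws"
    have pv: "?v permutes {1..r}"
      using i by (intro permutes_compose[OF p] simple_refl_permutes) auto
    have "inv ?v = inv (sprod ws) \<circ> simple_refl i"
      by (simp add: o_inv_distrib)
    then have "card (inversions r (simple_refl i \<circ> ?v)) = Suc (card (inversions r ?v))"
      using lt by (intro card_inversions_left[OF pv i]) (simp add: simple_refl_apply)
    moreover have "simple_refl i \<circ> ?v = sprod ws" by (simp add: fun_eq_iff)
    ultimately show False
      using len card_inversions_le[OF ws] by simp
  qed
  ultimately show lt: "inv (sprod ws) i < inv (sprod ws) (Suc i)" by linarith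
  show "red_word r ws"
    using card_inversions_left[OF p i lt] len ws by (simp add: red_word_def)
qed

lemma red_word_ConsI:
  assumes "red_word r ws" "1 \<le> i" "i < r" "inv (sprod ws) i < inv (sprod ws) (Suc i)"
  shows "red_word r (i # ws)"
  using assms card_inversions_left[OF sprod_permutes assms(2-4)] by (simp add: red_word_def sprod_Cons)

lemma inv_sprod: "inv (sprod ws) = sprod (rev ws)"
proof (induction ws)
  case Nil
  show ?case unfolding rev.simps sprod_Nil by (rule inv_id)
next
  case (Cons i ws)
  have "inv (simple_refl i \<circ> sprod ws) = inv (sprod ws) \<circ> inv (simple_refl i)"
    by (rule o_inv_distrib) simp_all
  then show ?case
    unfolding sprod_Cons rev.simps sprod_snoc Cons.IH inv_simple_refl .
qed

text \<open>Moving the permutation to the other side of the pairing shows that the factor of the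
  first letter is the scalar by which T_i acts, via \<open>T_dominant\<close>, on the monomial
  already moved by the remaining letters.\<close>

lemma Sigma_word_Cons:
  "Sigma_word n G \<nu> (i # us) =
    \<sigma> n G (perm_act (sprod us) \<nu> \<cdot> i - perm_act (sprod us) \<nu> \<cdot> Suc i) * Sigma_word n G \<nu> us"
proof -
  have "ip \<nu> (perm_act (word_prod (\<circ>) id simple_refl (rev us)) (simple_root i)) =
      perm_act (sprod us) \<nu> \<cdot> i - perm_act (sprod us) \<nu> \<cdot> Suc i"
    unfolding sprod_def[symmetric] inv_sprod[symmetric] simple_root_def
    by (simp add: perm_act_eroot bij_imp_bij_inv ip_eroot_right lookup_perm_act)
  then show ?thesis
    unfolding Sigma_word_def length_Cons prod.lessThan_Suc_shift by simp
qed

lemma Sigma_word_Nil: "Sigma_word n G \<nu> [] = 1"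
  by (simp add: Sigma_word_def)

section \<open>The cycle, the operators T_v, and the basis of the affine Hecke algebra\<close>

definition rot_perm :: "nat \<Rightarrow> nat \<Rightarrow> nat" where
  "rot_perm r = (\<lambda>i. if i = r then 1 else if i \<in> {1..<r} then Suc i else i)"

lemma rot_perm_word:
  assumes "1 \<le> m" "m \<le> r"
  shows "red_word r [1..<m] \<and> sprod [1..<m] = rot_perm m"
  using assms
proof (induction m rule: dec_induct)
  case base
  then show ?case
    by (auto simp: red_word_def sprod_Nil inversions_id rot_perm_def fun_eq_iff)
next
  case (step m)
  then have IH: "red_word r [1..<m]" "sprod [1..<m] = rot_perm m" by auto
  have u: "[1..<Suc m] = [1..<m] @ [m]" using step by simp
  have "red_word r ([1..<m] @ [m])"
    using step IH by (intro red_word_snocI) (auto simp: rot_perm_def)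
  moreover have "sprod ([1..<m] @ [m]) = rot_perm (Suc m)"
    unfolding sprod_snoc IH using step by (auto simp: fun_eq_iff rot_perm_def simple_refl_apply)
  ultimately show ?case unfolding u by blast
qed

text \<open>The permutation part of T_0 = g T_{r-1} g^(-1): the cycle conjugates s_{r-1} to the
  reflection in \<theta>.\<close>

lemma transpose_rot_perm:
  assumes "r \<ge> 2"
  shows "transpose 1 r \<circ> rot_perm r = rot_perm r \<circ> simple_refl (r - 1)"
proof
  fix x
  consider "x = r" | "x = r - 1" | "x \<noteq> r" "x \<noteq> r - 1" by blast
  then show "(transpose 1 r \<circ> rot_perm r) x = (rot_perm r \<circ> simple_refl (r - 1)) x"
    using assms by cases (auto simp: rot_perm_def simple_refl_apply transpose_def)
qed

text \<open>Crossing the wall of type \<open>i\<close> from the alcove \<open>u\<close> leads to the negative side.\<close>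

definition descends :: "nat \<Rightarrow> aff \<Rightarrow> nat \<Rightarrow> bool" where
  "descends r u i = (if i = 0 then snd u r < snd u 1 else snd u i < snd u (Suc i))"

context metaplectic
begin

text \<open>The choice of the reduced word is immaterial by \<open>matsumoto\<close>.\<close>

definition Tw :: "(nat \<Rightarrow> nat) \<Rightarrow> 'a poly fract laurent \<Rightarrow> 'a poly fract laurent" where
  "Tw v = foldr TT (SOME ws. red_word r ws \<and> sprod ws = v)"

lemma Tw_red_word:
  assumes "red_word r ws"
  shows "Tw (sprod ws) f = foldr TT ws f"
proof -
  have "\<exists>vs. red_word r vs \<and> sprod vs = sprod ws" using assms by blast
  from someI_ex[OF this] show ?thesis
    unfolding Tw_def using assms by (intro matsumoto T_commute T_braid) auto
qed

lemma lin_Tw: "lin (Tw v)"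
  unfolding Tw_def by (intro lin_foldr lin_T)

lemma Tw_right:
  assumes "v permutes {1..r}" "1 \<le> i" "i < r" "v i < v (Suc i)"
  shows "Tw v (TT i f) = Tw (v \<circ> simple_refl i) f"
proof -
  obtain ws where ws: "red_word r ws" "sprod ws = v"
    using red_word_for[OF assms(1)] by blast
  have "red_word r (ws @ [i])"
    using ws assms by (intro red_word_snocI) auto
  from Tw_red_word[OF this] Tw_red_word[OF ws(1)] show ?thesis
    by (simp add: ws sprod_snoc)
qed

lemma Tw_left:
  assumes "v permutes {1..r}" "1 \<le> i" "i < r" "inv v i < inv v (Suc i)"
  shows "TT i (Tw v f) = Tw (simple_refl i \<circ> v) f"
proof -
  obtain ws where ws: "red_word r ws" "sprod ws = v"
    using red_word_for[OF assms(1)] by blast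
  have "red_word r (i # ws)"
    using ws assms by (intro red_word_ConsI) auto
  from Tw_red_word[OF this] Tw_red_word[OF ws(1)] show ?thesis
    by (simp add: ws sprod_Cons)
qed

text \<open>In a reduced word each letter lengthens the permutation spelled by the letters after it,
  so the entries it swaps still stand in dominant order and differ by at most n. The scalars of
  \<open>T_dominant\<close> collect to \<Sigma>.\<close>

lemma Tw_xpow:
  assumes "red_word r us" "\<nu> \<in> fund_weights r n"
  shows "Tw (sprod us) (xpow \<nu>) = lsmult (const (Sigma_word n G \<nu> us)) (xpow (perm_act (sprod us) \<nu>))"
proof -
  have "foldr TT us (xpow \<nu>) = lsmult (const (Sigma_word n G \<nu> us)) (xpow (perm_act (sprod us) \<nu>))"
    using assms(1)
  proof (induction us)
    case Nil
    then show ?case unfolding sprod_Nil perm_act_id by (simp add: Sigma_word_Nil)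
  next
    case (Cons i us)
    note D = red_word_ConsD[OF Cons.prems]
    let ?v = "sprod us" and ?\<kappa> = "perm_act (sprod us) \<nu>"
    have p: "inv ?v permutes {1..r}"
      using D(1) by (intro permutes_inv sprod_permutes) (simp add: red_word_def)
    have "inv ?v i \<in> {1..r}" "inv ?v (Suc i) \<in> {1..r}"
      unfolding permutes_in_image[OF p] using D(2,3) by auto
    then have "0 \<le> ?\<kappa> \<cdot> i - ?\<kappa> \<cdot> Suc i" "?\<kappa> \<cdot> i - ?\<kappa> \<cdot> Suc i \<le> int n"
      using fund_weights_diff[OF assms(2), of "inv ?v i" "inv ?v (Suc i)"] D(4)
      by (simp_all add: lookup_perm_act)
    from T_dominant[OF this]
    have "foldr TT (i # us) (xpow \<nu>) =
        lsmult (const (Sigma_word n G \<nu> (i # us))) (xpow (perm_act (sprod (i # us)) \<nu>))"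
      using Cons.IH[OF D(1)]
      by (simp add: T_scale Sigma_word_Cons const_mult mult.commute sprod_Cons perm_act_comp)
    then show ?case .
  qed
  then show ?thesis using Tw_red_word[OF assms(1)] by simp
qed

lemma Sigma_word_nonzero: "Sigma_word n G \<nu> us \<noteq> 0"
  using sigma_nonzero by (simp add: Sigma_word_def)

text \<open>The basis \<open>x\<^bsup>n\<beta>\<^esup> T\<^sub>v\<close> of the affine Hecke algebra, indexed by \<open>\<tau>(\<beta>) v\<close>.\<close>

definition MM :: "aff \<Rightarrow> 'a poly fract laurent \<Rightarrow> 'a poly fract laurent" where
  "MM u f = xpow (scale (int n) (fst u)) * Tw (snd u) f"

lemma lin_MM: "lin (MM u)"
  unfolding MM_def[abs_def] by (intro lin_mult lin_Tw)

lemma rot_perm_permutes: "rot_perm r permutes {1..r}"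
  using rot_perm_word[of r r] sprod_permutes[of "[1..<r]" r] r2 by (auto simp: red_word_def)

lemma inv_rot_perm: "inv (rot_perm r) i = (if i = 1 then r else if i \<in> {1<..r} then i - 1 else i)"
  unfolding rot_perm_def using bij_rotate(2)[of r] r2 by (simp add: fun_eq_iff)

text \<open>T_v g = x_{v(1)}^n T_{vc}, with c the cycle. A new letter j either commutes with the
  monomial and lengthens vc, or j = v(1), and then T_j x_j^n = x_{j+1}^n T_j^(-1), where the inverse
  shortens vc.\<close>

lemma Tw_gop:
  assumes "red_word r ws"
  shows "foldr TT ws (gop f) = xpow (en (sprod ws 1)) * Tw (sprod ws \<circ> rot_perm r) f"
  using assms
proof (induction ws)
  case Nil
  have "Tw (rot_perm r) f = foldr TT [1..<r] f"
    using Tw_red_word[of "[1..<r]" f] rot_perm_word[of r r] r2 by simp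
  then show ?case by (simp add: gop_def sprod_Nil)
next
  case (Cons j ws)
  note D = red_word_ConsD[OF Cons.prems]
  let ?v = "sprod ws"
  have vp: "?v permutes {1..r}"
    using D(1) by (intro sprod_permutes) (simp add: red_word_def)
  note ip = permutes_in_image[OF permutes_inv[OF vp]]
  have rng: "inv ?v j \<in> {1..r}" "inv ?v (Suc j) \<in> {1..r}"
    unfolding ip using D(2,3) by auto
  have b: "bij ?v" "bij (rot_perm r)" using permutes_bij[OF rot_perm_permutes] by simp_all
  have vr: "?v \<circ> rot_perm r permutes {1..r}"
    by (rule permutes_compose[OF rot_perm_permutes vp])
  have inv_vr: "inv (?v \<circ> rot_perm r) x = inv (rot_perm r) (inv ?v x)" for x
    using b by (simp add: o_inv_distrib)
  have v1: "inv ?v x = 1 \<longleftrightarrow> ?v 1 = x" for x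
    using inv_eq_iff_eq[OF b(1), of x 1] by auto
  \<comment> \<open>Position 1 cannot hold j+1, since j has to stand to the left of it; hence only
    two cases remain.\<close>
  have ne: "?v 1 \<noteq> Suc j"
    using D(4) rng v1[of "Suc j"] by auto
  have IH: "foldr TT ws (gop f) = xpow (en (?v 1)) * Tw (?v \<circ> rot_perm r) f"
    by (rule Cons.IH[OF D(1)])
  have "foldr TT (j # ws) (gop f) = xpow (en (sprod (j # ws) 1)) * Tw (sprod (j # ws) \<circ> rot_perm r) f"
  proof (cases "?v 1 = j")
    case True
    let ?w = "simple_refl j \<circ> (?v \<circ> rot_perm r)"
    have wp: "?w permutes {1..r}"
      using D(2,3) by (intro permutes_compose[OF vr] simple_refl_permutes) auto
    have inv_w: "inv ?w x = inv (rot_perm r) (inv ?v (simple_refl j x))" for x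
      using b by (simp add: o_inv_distrib bij_comp)
    have "inv ?v j = 1" using True v1 by blast
    then have "inv ?w j < inv ?w (Suc j)"
      unfolding inv_w using rng ne v1[of "Suc j"] D(4) by (auto simp: simple_refl_apply inv_rot_perm)
    from Tw_left[OF wp D(2,3) this] have "TT j (Tw ?w f) = Tw (?v \<circ> rot_perm r) f"
      by (simp add: comp_assoc[symmetric] fun_eq_iff comp_def)
    then have "Ti j (Tw (?v \<circ> rot_perm r) f) = Tw ?w f" by (metis Ti_T)
    moreover have "TT j (xpow (en j) * g) = xpow (en (Suc j)) * Ti j g" for g
      by (simp add: T_en Ti_def right_diff_distrib lsmult_mult_right)
    moreover have "sprod (j # ws) \<circ> rot_perm r = ?w"
      by (simp only: sprod_Cons comp_assoc)
    moreover have "sprod (j # ws) 1 = Suc j"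
      using True by (simp only: sprod_Cons comp_apply) (simp add: simple_refl_apply)
    ultimately show ?thesis
      by (simp only: foldr.simps comp_apply IH True)
  next
    case False
    then have "inv ?v j \<noteq> 1" "inv ?v (Suc j) \<noteq> 1" using ne v1 by blast+
    then have "inv (?v \<circ> rot_perm r) j < inv (?v \<circ> rot_perm r) (Suc j)"
      unfolding inv_vr using rng D(4) by (auto simp: inv_rot_perm)
    note Tw_left[OF vr D(2,3) this]
    moreover have "sprod (j # ws) \<circ> rot_perm r = simple_refl j \<circ> (?v \<circ> rot_perm r)"
      by (simp only: sprod_Cons comp_assoc)
    moreover have "sprod (j # ws) 1 = ?v 1"
      using False ne by (simp only: sprod_Cons comp_apply) (simp add: simple_refl_apply)
    ultimately show ?thesis
      by (simp only: foldr.simps comp_apply IH T_en_other[OF False ne])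
  qed
  then show ?case .
qed

text \<open>On indices, g is right multiplication by the translation by \<epsilon>_1 followed by the
  cycle. This leaves the Coxeter group for the extended one, which is why \<open>MM\<close> accepts
  any weight in the first component.\<close>

lemma MM_gop:
  assumes "v permutes {1..r}"
  shows "MM (\<beta>, v) (gop f) = MM (\<beta> + unit_vec (v 1), v \<circ> rot_perm r) f"
proof -
  obtain ws where ws: "red_word r ws" "sprod ws = v"
    using red_word_for[OF assms] by blast
  show ?thesis
    using Tw_gop[OF ws(1), of f] Tw_red_word[OF ws(1), of "gop f"]
    by (simp add: MM_def ws(2) scale_add xpow_mult_assoc)
qed

lemma aff_mult_gen:
  "aff_mult (\<beta>, v) (aff_gen 1 r i) = (if i = 0 then (\<beta> + perm_act v (eroot 1 r), v \<circ> transpose 1 r)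
    else (\<beta> + perm_act v 0, v \<circ> simple_refl i))"
  by (simp add: aff_mult_def aff_gen_def)

text \<open>For i = 0 the index is multiplied on the right by g, then s_{r-1}, then g^(-1). The
  outer factors cancel in the weight up to the translation part of s_0, and the result is again an
  index in the Coxeter group when the start is.\<close>

lemma MM_TA_up:
  assumes "snd u permutes {1..r}" "i < r" "descends r u i"
  shows "MM u (TA i f) = MM (aff_mult u (aff_gen 1 r i)) f"
proof (cases u)
  case (Pair \<beta> v)
  then have v: "v permutes {1..r}" and b: "bij v" using assms permutes_bij by auto
  show ?thesis
  proof (cases "i = 0")
    case False
    then show ?thesis
      using assms Tw_right[OF v, of i f] b
      unfolding Pair aff_mult_gen by (simp add: MM_def TA_def descends_def perm_act_0)
  next
    case True
    have lt: "v r < v 1" using assms(3) by (simp add: True Pair descends_def)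
    let ?t = "v \<circ> transpose 1 r"
    have vr: "v \<circ> rot_perm r permutes {1..r}"
      by (rule permutes_compose[OF rot_perm_permutes v])
    have tp: "?t permutes {1..r}"
      using r2 by (intro permutes_compose[OF permutes_swap_id v]) auto
    \<comment> \<open>The wall condition for i = 0 is the condition that s_{r-1} lengthens vc,
      because the cycle sends r-1 to r and r to 1.\<close>
    have lt': "(v \<circ> rot_perm r) (r - 1) < (v \<circ> rot_perm r) (Suc (r - 1))"
      using lt r2 by (auto simp: rot_perm_def)
    have r1: "1 \<le> r - 1" "r - 1 < r" using r2 by auto
    have "MM u (TA i f) = MM (\<beta> + unit_vec (v 1), v \<circ> rot_perm r) (TT (r - 1) (gopi f))"
      unfolding MM_gop[OF v, symmetric] by (simp add: Pair True TA_def)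
    also have "\<dots> = MM (\<beta> + unit_vec (v 1), v \<circ> rot_perm r \<circ> simple_refl (r - 1)) (gopi f)"
      unfolding MM_def snd_conv fst_conv Tw_right[OF vr r1 lt'] ..
    also have "v \<circ> rot_perm r \<circ> simple_refl (r - 1) = ?t \<circ> rot_perm r"
      using transpose_rot_perm[OF r2] by (simp add: comp_assoc)
    also have "\<beta> + unit_vec (v 1) = \<beta> + perm_act v (eroot 1 r) + unit_vec (?t 1)"
      unfolding perm_act_eroot[OF b] by (simp add: eroot_def)
    also have "MM (\<beta> + perm_act v (eroot 1 r) + unit_vec (?t 1), ?t \<circ> rot_perm r) (gopi f) =
        MM (\<beta> + perm_act v (eroot 1 r), ?t) (gop (gopi f))"
      by (rule MM_gop[OF tp, symmetric])
    finally show ?thesis unfolding Pair aff_mult_gen by (simp add: True)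
  qed
qed

lemma aff_mult_gen_gen:
  assumes "bij (snd u)"
  shows "aff_mult (aff_mult u (aff_gen m r i)) (aff_gen m r i) = u"
proof (cases u)
  case (Pair \<beta> v)
  have b: "bij v" "bij (v \<circ> transpose 1 r)" using assms Pair by (auto intro: bij_comp)
  have "perm_act v (eroot 1 r) + perm_act (v \<circ> transpose 1 r) (eroot 1 r) = (0 :: weight)"
    unfolding perm_act_eroot[OF b(1)] perm_act_eroot[OF b(2)] by (simp add: eroot_def)
  then have "perm_act v (scale (int m) (eroot 1 r)) + perm_act (v \<circ> transpose 1 r) (scale (int m) (eroot 1 r)) = 0"
    unfolding perm_act_scale[OF b(1)] perm_act_scale[OF b(2)] scale_add[symmetric] by simp
  then show ?thesis
    using assms by (simp add: Pair aff_mult_def aff_gen_def perm_act_0 bij_comp add.assoc comp_assoc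
        fun_eq_iff)
qed

text \<open>The neighbouring alcove descends to u, so \<open>MM_TA_up\<close> applies there to
  T_i^(-1) f. Crossing towards the positive side therefore costs an extra \<open>kap\<close> times
  the uncrossed term.\<close>

lemma MM_TA_down:
  assumes "snd u permutes {1..r}" "i < r" "\<not> descends r u i"
  shows "MM u (TA i f) = MM (aff_mult u (aff_gen 1 r i)) f + lsmult kap (MM u f)"
proof -
  let ?u' = "aff_mult u (aff_gen 1 r i)"
  have b: "bij (snd u)" and inj: "inj (snd u)" using assms permutes_bij permutes_inj by blast+
  have p: "snd ?u' permutes {1..r}"
  proof (cases "i = 0")
    case True
    have "snd u \<circ> transpose 1 r permutes {1..r}"
      using r2 by (intro permutes_compose[OF permutes_swap_id assms(1)]) auto
    then show ?thesis by (simp add: True aff_mult_def aff_gen_def)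
  next
    case False
    then have "snd u \<circ> simple_refl i permutes {1..r}"
      using assms by (intro comp_simple_refl_permutes) auto
    then show ?thesis using False by (simp add: aff_mult_def aff_gen_def)
  qed
  have "snd u 1 \<noteq> snd u r" "snd u i \<noteq> snd u (Suc i)"
    using injD[OF inj] r2 by fastforce+
  then have up: "descends r ?u' i"
    using assms(3) r2 by (auto simp: descends_def aff_mult_def aff_gen_def simple_refl_apply)
  let ?g = "TA i f - lsmult kap f"
  have "TA i ?g = f"
    by (simp add: lin_diff[OF lin_TA] lin_scale[OF lin_TA] TA_quadratic)
  with MM_TA_up[OF p assms(2) up, of ?g] aff_mult_gen_gen[OF b, of 1 i]
  have "MM ?u' f = MM u ?g" by simp
  then show ?thesis by (simp add: lin_diff[OF lin_MM] lin_scale[OF lin_MM])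
qed

end

section \<open>Alcove walks\<close>

lemma base_walksD:
  assumes "p \<in> base_walks r ws"
  shows "length p = Suc (length ws)" "p ! 0 = aff_one" "last p = p ! length ws" "p \<noteq> []"
proof -
  show len: "length p = Suc (length ws)" and "p ! 0 = aff_one"
    using assms by (auto simp: base_walks_def alcove_walks_def)
  from len show "p \<noteq> []" by auto
  with len show "last p = p ! length ws" by (simp add: last_conv_nth)
qed

lemma base_walks_step:
  assumes "p \<in> base_walks r ws" "j < length ws"
  shows "p ! Suc j = p ! j \<or> p ! Suc j = aff_mult (p ! j) (aff_gen 1 r (ws ! j))"
proof -
  have "Suc j \<in> {1..length ws}" using assms by auto
  then have "p ! Suc j \<in> {p ! (Suc j - 1), aff_mult (p ! (Suc j - 1)) (aff_gen 1 r (ws ! (Suc j - 1)))}"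
    using assms(1) unfolding base_walks_def alcove_walks_def by blast
  then show ?thesis by simp
qed

lemma base_walks_Nil: "base_walks r [] = {[aff_one]}"
  by (auto simp: base_walks_def alcove_walks_def length_Suc_conv)

lemma base_walks_snoc:
  "base_walks r (ws @ [i]) = (\<lambda>p. p @ [last p]) ` base_walks r ws \<union>
    (\<lambda>p. p @ [aff_mult (last p) (aff_gen 1 r i)]) ` base_walks r ws"
  (is "_ = ?L \<union> ?R")
proof (intro set_eqI iffI)
  fix p assume p: "p \<in> base_walks r (ws @ [i])"
  then have len: "length p = Suc (Suc (length ws))" by (auto dest: base_walksD)
  then obtain p' a where pp: "p = p' @ [a]" by (metis length_0_conv nat.distinct(1) rev_exhaust)
  have len': "length p' = Suc (length ws)" using len pp by simp
  have "p' ! j \<in> {p' ! (j - 1), aff_mult (p' ! (j - 1)) (aff_gen 1 r (ws ! (j - 1)))}"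
    if "j \<in> {1..length ws}" for j
  proof -
    have "j \<noteq> 0" "j \<le> length ws" using that by auto
    then obtain m where m: "j = Suc m" "m < length ws" by (metis not0_implies_Suc Suc_le_lessD)
    then show ?thesis
      using base_walks_step[OF p, of m] len' by (simp add: pp nth_append)
  qed
  then have p': "p' \<in> base_walks r ws"
    using p len' by (auto simp: base_walks_def alcove_walks_def pp nth_append)
  have "a = last p' \<or> a = aff_mult (last p') (aff_gen 1 r i)"
    using base_walks_step[OF p, of "length ws"] len' base_walksD(3)[OF p'] by (auto simp: pp nth_append)
  then show "p \<in> ?L \<union> ?R" using p' pp by auto
next
  fix p assume "p \<in> ?L \<union> ?R"
  then obtain p' a where p': "p' \<in> base_walks r ws" "p = p' @ [a]"
    "a = last p' \<or> a = aff_mult (last p') (aff_gen 1 r i)" by blast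
  note D = base_walksD[OF p'(1)]
  have "p ! j \<in> {p ! (j - 1), aff_mult (p ! (j - 1)) (aff_gen 1 r ((ws @ [i]) ! (j - 1)))}"
    if j: "j \<in> {1..length (ws @ [i])}" for j
  proof (cases "j = Suc (length ws)")
    case True
    then show ?thesis using p'(3) D by (auto simp: p'(2) nth_append)
  next
    case False
    then show ?thesis
      using base_walks_step[OF p'(1), of "j - 1"] j D by (auto simp: p'(2) nth_append)
  qed
  then show "p \<in> base_walks r (ws @ [i])"
    using D by (auto simp: base_walks_def alcove_walks_def p'(2) nth_append)
qed

lemma finite_base_walks: "finite (base_walks r ws)"
  by (induction ws rule: rev_induct) (simp_all add: base_walks_Nil base_walks_snoc)

lemma folds_snoc:
  assumes "p \<in> base_walks r ws"
  shows "folds (ws @ [i]) (p @ [a]) = folds ws p \<union> (if a = last p then {Suc (length ws)} else {})"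
proof -
  note D = base_walksD[OF assms]
  show ?thesis
  proof (intro set_eqI)
    fix j
    show "j \<in> folds (ws @ [i]) (p @ [a]) \<longleftrightarrow> j \<in> folds ws p \<union> (if a = last p then {Suc (length ws)} else {})"
      using D by (cases "j = Suc (length ws)") (auto simp: folds_def nth_append)
  qed
qed

lemma folds_le: "j \<in> folds ws p \<Longrightarrow> 1 \<le> j \<and> j \<le> length ws"
  by (simp add: folds_def)

lemma finite_folds [simp]: "finite (folds ws p)"
  by (rule finite_subset[of _ "{1..length ws}"]) (auto simp: folds_def)

lemma aff_gen_permutes:
  "r \<ge> 2 \<Longrightarrow> i < r \<Longrightarrow> snd (aff_gen m r i) permutes {1..r}"
  by (cases "i = 0")
    (auto simp: aff_gen_def simp del: One_nat_def intro!: permutes_swap_id simple_refl_permutes)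

lemma base_walks_permutes:
  assumes "r \<ge> 2" "set ws \<subseteq> {0..<r}" "p \<in> base_walks r ws" "j \<le> length ws"
  shows "snd (p ! j) permutes {1..r}"
  using assms(4)
proof (induction j)
  case 0
  show ?case
    unfolding base_walksD(2)[OF assms(3)] aff_one_def snd_conv by (rule permutes_id)
next
  case (Suc j)
  then have "ws ! j \<in> set ws" by simp
  then have "ws ! j < r" using assms(2) by auto
  with Suc assms(1) have "snd (aff_mult (p ! j) (aff_gen 1 r (ws ! j))) permutes {1..r}"
    unfolding aff_mult_def snd_conv by (intro permutes_compose[OF aff_gen_permutes]) auto
  with Suc have "snd (p ! Suc j) permutes {1..r}"
    using base_walks_step[OF assms(3), of j] by auto
  then show ?case .
qed

text \<open>Folds are recognised by equality of consecutive alcoves, so a crossing has to be a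
  genuine move.\<close>

lemma aff_mult_gen_neq:
  assumes "r \<ge> 2" "bij (snd u)"
  shows "aff_mult u (aff_gen m r i) \<noteq> u"
proof
  assume "aff_mult u (aff_gen m r i) = u"
  then have "snd u \<circ> snd (aff_gen m r i) = snd u"
    by (metis aff_mult_def snd_conv)
  then have "snd u (snd (aff_gen m r i) x) = snd u x" for x by (metis comp_apply)
  then have "snd (aff_gen m r i) x = x" for x
    using bij_is_inj[OF assms(2)] by (metis injD)
  from this[of 1] this[of i] show False
    using assms(1) by (auto simp: aff_gen_def simple_refl_apply split: if_splits)
qed

section \<open>Passing from one weight to the next, and the expansion over alcove walks\<close>

context metaplectic
begin

lemma eig_lsmult: "eig \<mu> f \<Longrightarrow> eig \<mu> (lsmult c f)"
  by (simp add: eig_def lin_scale[OF lin_Yop] mult.commute)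

lemma eig_lo_neq_hi:
  assumes "i < r" "wall_dist n r i \<mu> \<noteq> 0"
  shows "eig_lo i \<mu> \<noteq> eig_hi i \<mu>"
proof
  assume eq: "eig_lo i \<mu> = eig_hi i \<mu>"
  obtain C where C: "C \<noteq> 0" "eig_hi i \<mu> \<noteq> 0"
    "eig_lo i \<mu> = qvar powi (- wall_dist n r i \<mu>) * const C * eig_hi i \<mu>"
    using eig_ratio[OF assms(1), of \<mu>] by metis
  then have "qvar powi (- wall_dist n r i \<mu>) * const C = 1" using eq by simp
  then have "qvar powi (- wall_dist n r i \<mu>) = const (inverse C)"
    using inverse_unique[of "const C" "qvar powi (- wall_dist n r i \<mu>)"] by (simp add: const_inverse mult.commute)
  then show False using assms(2) qvar_powi_eq_const by force
qed

text \<open>For i > 0 this is the intertwiner together with commutation with the other Y_j. For i =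
  0 the vector is pulled back through \<open>Phi\<close>, intertwined at r-1, and pushed forward
  again.\<close>

lemma eig_step:
  assumes "i < r" "wall_dist n r i \<mu> \<noteq> 0" "eig \<mu> f"
  shows "eig (gen_act n r i \<mu>) (TA i f + lsmult (cc i \<mu>) f)"
proof (cases "i = 0")
  case False
  then have i: "1 \<le> i" "i < r" using assms by auto
  have y: "Yop i f = lsmult (eig_lo i \<mu>) f" "Yop (Suc i) f = lsmult (eig_hi i \<mu>) f"
    using assms(3) i by (simp_all add: eig_def eig_lo_def eig_hi_def)
  define h where "h = TT i f + lsmult (cc i \<mu>) f"
  have hi: "Yop i h = lsmult (eig_hi i \<mu>) h" "Yop (Suc i) h = lsmult (eig_lo i \<mu>) h"
    using intertwiner[OF i y eig_lo_neq_hi[OF assms(1,2)]] by (simp_all add: h_def cc_def)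
  have "Yop j h = lsmult (\<gamma> r n G j (gen_act n r i \<mu>)) h" if j: "j \<in> {1..r}" for j
  proof -
    have "simple_refl i j \<in> {1..r}"
      using permutes_in_image[OF simple_refl_permutes[of i r]] j i by auto
    then have g: "\<gamma> r n G j (gen_act n r i \<mu>) = \<gamma> r n G (simple_refl i j) \<mu>"
      using gamma_gen_act[OF i assms(2), of "simple_refl i j"] by simp
    consider "j = i" | "j = Suc i" | "j < i" | "Suc i < j" by linarith
    then show ?thesis
    proof cases
      case 3
      then obtain m where m: "i = Suc m" "j \<le> m" by (cases i) auto
      have "Yop j (TT i f) = TT i (Yop j f)"
        unfolding m(1) using m j i by (intro Yop_T_lt) auto
      then show ?thesis
        using 3 assms(3) j unfolding g
        by (simp add: h_def lin_add[OF lin_Yop] lin_scale[OF lin_Yop] eig_def T_scale simple_refl_apply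
            lsmult_add_right mult.commute)
    next
      case 4
      have "Yop j (TT i f) = TT i (Yop j f)"
        using 4 j i by (intro Yop_T_gt) auto
      then show ?thesis
        using 4 assms(3) j unfolding g
        by (simp add: h_def lin_add[OF lin_Yop] lin_scale[OF lin_Yop] eig_def T_scale simple_refl_apply
            lsmult_add_right mult.commute)
    qed (use hi g i in \<open>simp_all add: simple_refl_apply eig_lo_def eig_hi_def\<close>)
  qed
  then show ?thesis using False by (simp add: eig_def h_def TA_def)
next
  case True
  have r: "Suc (r - 1) = r" and r1: "1 \<le> r - 1" "r - 1 < r" using r2 by auto
  let ?y = "eig_lo 0 \<mu>" and ?y' = "eig_hi 0 \<mu>"
  have f: "Yop j f = lsmult (\<gamma> r n G j \<mu>) f" if "j \<in> {1..r}" for j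
    using assms(3) that by (simp add: eig_def)
  \<comment> \<open>The eigenvalues of the preimage are those of f shifted cyclically; the wrapped
    one acquires q^n.\<close>
  obtain h where h: "Phi h = f" using Phi_surj by blast
  have Yh: "Yop j h = lsmult (\<gamma> r n G (Suc j) \<mu>) h" if "1 \<le> j" "j < r" for j
    by (rule Phi_inj) (use Yop_Phi[OF that, of h] f[of "Suc j"] that in \<open>simp add: h lin_scale[OF lin_Phi]\<close>)
  have "lsmult (qvar powi (- int n)) (Phi (Yop r h)) = lsmult (\<gamma> r n G 1 \<mu>) f"
    using Yop_1_Phi[of h] f[of 1] r2 by (simp add: h)
  then have "lsmult (qvar powi int n) (lsmult (qvar powi (- int n)) (Phi (Yop r h))) =
      lsmult (qvar powi int n) (lsmult (\<gamma> r n G 1 \<mu>) f)"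
    by (simp only:)
  then have "Phi (Yop r h) = lsmult ?y' f"
    by (simp add: eig_hi_def power_int_minus)
  then have Yrh: "Yop r h = lsmult ?y' h"
    by (intro Phi_inj[of "Yop r h"]) (simp add: h lin_scale[OF lin_Phi])
  have y: "Yop (r - 1) h = lsmult ?y h" "Yop (Suc (r - 1)) h = lsmult ?y' h"
    using Yh[OF r1] Yrh r by (simp_all add: eig_lo_def)
  define h' where "h' = TT (r - 1) h + lsmult (cc 0 \<mu>) h"
  have h1: "Yop (r - 1) h' = lsmult ?y' h'" and h2: "Yop r h' = lsmult ?y h'"
    using intertwiner[OF r1 y eig_lo_neq_hi] assms True r by (simp_all add: h'_def cc_def)
  have h3: "Yop j h' = lsmult (\<gamma> r n G (Suc j) \<mu>) h'" if "1 \<le> j" "j < r - 1" for j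
  proof -
    have "Yop j (TT (Suc (r - 2)) h) = TT (Suc (r - 2)) (Yop j h)"
      using that by (intro Yop_T_lt) auto
    moreover have "Suc (r - 2) = r - 1" using r2 by auto
    ultimately show ?thesis
      using Yh[of j] that
      by (simp add: h'_def lin_add[OF lin_Yop] lin_scale[OF lin_Yop] T_scale lsmult_add_right mult.commute)
  qed
  have eig: "eig (gen_act n r 0 \<mu>) (Phi h')"
    unfolding eig_def
  proof
    fix j assume j: "j \<in> {1..r}"
    have "transpose 1 r j \<in> {1..r}" using j by (auto simp: transpose_def)
    then have g: "\<gamma> r n G j (gen_act n r 0 \<mu>) = qvar powi (int n * ((if j = r then 1 else 0) - (if j = 1 then 1 else 0))) *
        \<gamma> r n G (transpose 1 r j) \<mu>"
      using gamma_gen_act_0[of \<mu> "transpose 1 r j"] assms True by (simp add: transpose_eq_iff)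
    consider "j = 1" | "j = r" | "1 < j" "j < r" using j by force
    then show "Yop j (Phi h') = lsmult (\<gamma> r n G j (gen_act n r 0 \<mu>)) (Phi h')"
    proof cases
      case 1
      then show ?thesis
        using Yop_1_Phi[of h'] r2 unfolding g by (simp add: h2 lin_scale[OF lin_Phi] eig_lo_def)
    next
      case 2
      have "Yop r (Phi h') = lsmult ?y' (Phi h')"
        using Yop_Phi[OF r1, of h'] unfolding r h1 lin_scale[OF lin_Phi] .
      then show ?thesis
        using 2 r2 unfolding g by (simp add: eig_hi_def)
    next
      case 3
      then obtain m where "j = Suc m" "1 \<le> m" "m < r - 1" by (cases j) auto
      then show ?thesis
        using Yop_Phi[of m h'] h3[of m] 3 unfolding g by (simp add: lin_scale[OF lin_Phi] transpose_def)
    qed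
  qed
  have nz: "?y' \<noteq> 0" "?y \<noteq> 0"
    using eig_ratio[of 0 \<mu>] r2 by (metis const_eq_0_iff less_le_trans mult_eq_0_iff pos2 power_int_eq_0_iff qvar_nonzero)+
  \<comment> \<open>On eigenvectors of Y_r, \<open>Phi\<close> is a multiple of g, by y' on h and by
    y on h'. Conjugation by g in place of \<open>Phi\<close> thus only changes the result by
    y'/y.\<close>
  have "f = lsmult ?y' (gop h)"
    using Phi_eq_gop[of h] h by (simp add: Yrh lin_scale[OF lin_gop])
  then have "TA 0 f + lsmult (cc 0 \<mu>) f = lsmult ?y' (gop h')"
    by (simp add: TA_def h'_def lin_scale[OF lin_gop] lin_scale[OF lin_gopi] T_scale
        lin_add[OF lin_gop] lsmult_add_right mult.commute)
  also have "\<dots> = lsmult (?y' / ?y) (Phi h')"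
    using Phi_eq_gop[of h'] nz by (simp add: h2 lin_scale[OF lin_gop])
  finally show ?thesis using eig_lsmult[OF eig] True by simp
qed

definition walk_op :: "nat list \<Rightarrow> (nat \<Rightarrow> 'a poly fract) \<Rightarrow> 'a poly fract laurent \<Rightarrow> 'a poly fract laurent" where
  "walk_op ws c = foldr (\<lambda>j f. TA (ws ! j) f + lsmult (c j) f) [0..<length ws]"

text \<open>Steps of a walk are numbered from 1, letters and coefficients from 0, hence the shift.
  The summand \<open>kap\<close> is the extra term of \<open>MM_TA_down\<close>.\<close>

definition fold_coeff :: "nat list \<Rightarrow> (nat \<Rightarrow> 'a poly fract) \<Rightarrow> aff list \<Rightarrow> nat \<Rightarrow> 'a poly fract" where
  "fold_coeff ws c p j = c (j - 1) + (if descends r (p ! (j - 1)) (ws ! (j - 1)) then 0 else kap)"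

lemma MM_one: "MM aff_one f = f"
  using Tw_red_word[of "[]" f] by (simp add: MM_def aff_one_def red_word_def sprod_Nil[unfolded id_def] inversions_id[unfolded id_def] id_def)

text \<open>Induction on the last letter: its operator acts on f first and so stands immediately to
  the right of the basis element reached by a shorter walk, where the multiplication rule splits it
  into a crossing and a fold.\<close>

lemma walk_op_expand:
  assumes "set ws \<subseteq> {0..<r}"
  shows "walk_op ws c f =
    (\<Sum>p\<in>base_walks r ws. lsmult (\<Prod>j\<in>folds ws p. fold_coeff ws c p j) (MM (last p) f))"
  using assms
proof (induction ws arbitrary: f rule: rev_induct)
  case Nil
  show ?case by (simp add: walk_op_def base_walks_Nil folds_def MM_one)
next
  case (snoc i ws)
  let ?B = "base_walks r ws" and ?l = "length ws"
  let ?W = "\<lambda>ws p. \<Prod>j\<in>folds ws p. fold_coeff ws c p j"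
  let ?s = "\<lambda>p. aff_mult (last p) (aff_gen 1 r i)"
  have i: "i < r" and ws: "set ws \<subseteq> {0..<r}" using snoc.prems by auto
  have perm: "snd (last p) permutes {1..r}" if "p \<in> ?B" for p
    using base_walks_permutes[OF r2 ws that, of ?l] base_walksD(3)[OF that] by simp
  have neq: "?s p \<noteq> last p" if "p \<in> ?B" for p
    using aff_mult_gen_neq[OF r2] perm[OF that] permutes_bij by blast
  have W: "fold_coeff (ws @ [i]) c (p @ [a]) j = fold_coeff ws c p j" if "p \<in> ?B" "j \<in> folds ws p" for p a j
    using folds_le[OF that(2)] base_walksD(1)[OF that(1)] by (auto simp: fold_coeff_def nth_append)
  have notin: "Suc ?l \<notin> folds ws p" for p using folds_le[of "Suc ?l" ws p] by auto
  have W1: "?W (ws @ [i]) (p @ [?s p]) = ?W ws p" if "p \<in> ?B" for p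
    using folds_snoc[OF that, of i "?s p"] neq[OF that] W[OF that] by simp
  have W2: "?W (ws @ [i]) (p @ [last p]) = (c ?l + (if descends r (last p) i then 0 else kap)) * ?W ws p"
    if "p \<in> ?B" for p
    using folds_snoc[OF that, of i "last p"] notin W[OF that] base_walksD(1,3)[OF that]
    by (simp add: fold_coeff_def nth_append)
  have "walk_op (ws @ [i]) c f = walk_op ws c (TA i f + lsmult (c ?l) f)"
  proof -
    have "foldr (\<lambda>j f. TA ((ws @ [i]) ! j) f + lsmult (c j) f) [0..<?l] g =
        foldr (\<lambda>j f. TA (ws ! j) f + lsmult (c j) f) [0..<?l] g" for g
      by (intro foldr_cong) (auto simp: nth_append)
    then show ?thesis by (simp add: walk_op_def)
  qed
  also have "\<dots> = (\<Sum>p\<in>?B. lsmult (?W ws p) (MM (last p) (TA i f + lsmult (c ?l) f)))"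
    by (rule snoc.IH[OF ws])
  also have "\<dots> = (\<Sum>p\<in>?B. lsmult (?W (ws @ [i]) (p @ [?s p])) (MM (?s p) f) +
      lsmult (?W (ws @ [i]) (p @ [last p])) (MM (last p) f))"
  proof (intro sum.cong refl)
    fix p assume p: "p \<in> ?B"
    have "MM (last p) (TA i f) = MM (?s p) f + lsmult (if descends r (last p) i then 0 else kap) (MM (last p) f)"
      using MM_TA_up[OF perm[OF p] i] MM_TA_down[OF perm[OF p] i] by simp
    then show "lsmult (?W ws p) (MM (last p) (TA i f + lsmult (c ?l) f)) =
        lsmult (?W (ws @ [i]) (p @ [?s p])) (MM (?s p) f) + lsmult (?W (ws @ [i]) (p @ [last p])) (MM (last p) f)"
      unfolding W1[OF p] W2[OF p] lin_add[OF lin_MM] lin_scale[OF lin_MM]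
      by (simp add: lsmult_add_right lsmult_add_left algebra_simps)
  qed
  also have "\<dots> = (\<Sum>p\<in>(\<lambda>p. p @ [?s p]) ` ?B. lsmult (?W (ws @ [i]) p) (MM (last p) f)) +
      (\<Sum>p\<in>(\<lambda>p. p @ [last p]) ` ?B. lsmult (?W (ws @ [i]) p) (MM (last p) f))"
    unfolding sum.distrib by (subst (1 2) sum.reindex) (auto simp: inj_on_def)
  also have "\<dots> = (\<Sum>p\<in>base_walks r (ws @ [i]). lsmult (?W (ws @ [i]) p) (MM (last p) f))"
    unfolding base_walks_snoc using neq
    by (subst sum.union_disjoint[symmetric]) (auto simp: finite_base_walks Un_commute)
  finally show ?case .
qed

end

section \<open>Words of minimal length\<close>

abbreviation act_word :: "nat \<Rightarrow> nat \<Rightarrow> nat list \<Rightarrow> weight \<Rightarrow> weight" where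
  "act_word n r \<equiv> foldr (gen_act n r)"

text \<open>
  The extension of \<open>\<nu> \<in> \<int>\<^sup>r\<close> to \<open>\<int>\<close> with \<open>\<nu>\<^bsub>x+r\<^esub> = \<nu>\<^sub>x - n\<close>: each generator of
  \<open>nQ \<rtimes> S\<^sub>r\<close>, including the affine one, acts by adjacent transpositions of the positions.
\<close>

definition periodic_ext :: "nat \<Rightarrow> nat \<Rightarrow> weight \<Rightarrow> int \<Rightarrow> int" where
  "periodic_ext n r \<nu> x = \<nu> \<cdot> Suc (nat ((x - 1) mod int r)) - int n * ((x - 1) div int r)"

text \<open>For y - x not divisible by r, the affine reflection that exchanges x + rm and y + rm for
  every m.\<close>

definition affine_swap :: "nat \<Rightarrow> int \<Rightarrow> int \<Rightarrow> int \<Rightarrow> int" where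
  "affine_swap r x y z = (if int r dvd z - x then z + (y - x) else if int r dvd z - y then z - (y - x) else z)"

abbreviation adj_swap :: "nat \<Rightarrow> nat \<Rightarrow> int \<Rightarrow> int" where
  "adj_swap r i \<equiv> affine_swap r (int i) (int i + 1)"

lemma periodic_ext_eq:
  assumes "1 \<le> j" "j \<le> r"
  shows "periodic_ext n r \<nu> (int j + int r * m) = \<nu> \<cdot> j - int n * m"
proof -
  obtain l where l: "j = Suc l" using assms(1) by (cases j) auto
  have "(int l + int r * m) mod int r = int l" "(int l + int r * m) div int r = m"
    using assms(2) by (simp_all add: l)
  then show ?thesis by (simp add: periodic_ext_def l)
qed

lemma int_residue:
  assumes "1 \<le> r"
  obtains j m where "1 \<le> j" "j \<le> r" "x = int j + int r * m"
proof
  let ?j = "Suc (nat ((x - 1) mod int r))"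
  show "1 \<le> ?j" by simp
  have "(x - 1) mod int r < int r" using assms by simp
  then show "?j \<le> r" using assms by linarith
  have "0 \<le> (x - 1) mod int r" using assms by simp
  then have "int ?j = (x - 1) mod int r + 1" by simp
  show "x = int ?j + int r * ((x - 1) div int r)"
    using mult_div_mod_eq[of "int r" "x - 1"] \<open>int ?j = (x - 1) mod int r + 1\<close> by linarith
qed

lemma dvd_small_iff:
  assumes "\<bar>d\<bar> < int r"
  shows "int r dvd d + int r * m \<longleftrightarrow> d = 0"
proof -
  have "int r dvd d + int r * m \<longleftrightarrow> int r dvd d" by (simp add: dvd_add_left_iff)
  then show ?thesis using assms dvd_imp_le_int[of d "int r"] by auto
qed

text \<open>Position 0 carries \<nu>_r + n and position 1 carries \<nu>_1, so s_0 exchanges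
  neighbours just as s_i does.\<close>

lemma periodic_ext_gen_act:
  assumes "2 \<le> r" "i < r"
  shows "periodic_ext n r (gen_act n r i \<nu>) = periodic_ext n r \<nu> \<circ> adj_swap r i"
proof
  fix x
  obtain j m where j: "1 \<le> j" "j \<le> r" and x: "x = int j + int r * m"
    using int_residue[of r x] assms by auto
  have d1: "int r dvd x - int i \<longleftrightarrow> (j = i \<or> i = 0 \<and> j = r)"
  proof (cases "j = r \<and> i = 0")
    case False
    have e: "x - int i = (int j - int i) + int r * m" by (simp add: x)
    have "\<bar>int j - int i\<bar> < int r" using False j assms by auto
    then show ?thesis unfolding e using dvd_small_iff[of "int j - int i" r m] False by auto
  qed (auto simp: x)
  have d2: "int r dvd x - (int i + 1) \<longleftrightarrow> j = Suc i"
  proof -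
    have e: "x - (int i + 1) = (int j - int i - 1) + int r * m" by (simp add: x)
    have "\<bar>int j - int i - 1\<bar> < int r" using j assms by auto
    then show ?thesis unfolding e using dvd_small_iff[of "int j - int i - 1" r m] by auto
  qed
  have conclude: "periodic_ext n r (gen_act n r i \<nu>) x = (periodic_ext n r \<nu> \<circ> adj_swap r i) x"
    if "adj_swap r i x = int l + int r * k" "1 \<le> l" "l \<le> r"
      "gen_act n r i \<nu> \<cdot> j - int n * m = \<nu> \<cdot> l - int n * k" for l k
    using that(1,4) periodic_ext_eq[OF j, of n "gen_act n r i \<nu>" m] periodic_ext_eq[OF that(2,3), of n \<nu> k]
    by (simp only: x comp_apply)
  consider "i = 0" "j = r" | "j = i" | "j = Suc i" | "j \<noteq> i" "j \<noteq> Suc i" "i = 0 \<longrightarrow> j \<noteq> r" by blast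
  then show "periodic_ext n r (gen_act n r i \<nu>) x = (periodic_ext n r \<nu> \<circ> adj_swap r i) x"
  proof cases
    case 1
    then have "adj_swap r i x = int 1 + int r * (m + 1)"
      using d1 by (simp add: affine_swap_def x algebra_simps)
    then show ?thesis
      by (rule conclude) (use 1 assms in \<open>simp_all add: lookup_gen_act_0 algebra_simps\<close>)
  next
    case 2
    then have "adj_swap r i x = int (Suc i) + int r * m"
      using d1 by (simp add: affine_swap_def x)
    then show ?thesis
      by (rule conclude) (use 2 j assms in \<open>simp_all add: lookup_gen_act simple_refl_apply\<close>)
  next
    case 3
    show ?thesis
    proof (cases "i = 0")
      case True
      then have "adj_swap r i x = int r + int r * (m - 1)"
        using d1 d2 3 assms by (simp add: affine_swap_def x algebra_simps)
      then show ?thesis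
        by (rule conclude) (use 3 True assms in \<open>simp_all add: lookup_gen_act_0 algebra_simps\<close>)
    next
      case False
      then have "adj_swap r i x = int i + int r * m"
        using d1 d2 3 assms by (simp add: affine_swap_def x)
      then show ?thesis
        by (rule conclude) (use 3 j False assms in \<open>simp_all add: lookup_gen_act simple_refl_apply\<close>)
    qed
  next
    case 4
    then have "adj_swap r i x = int j + int r * m"
      using d1 d2 by (auto simp: affine_swap_def x)
    then show ?thesis
      by (rule conclude)
        (use 4 j assms in \<open>cases "i = 0"; simp add: lookup_gen_act lookup_gen_act_0 simple_refl_apply\<close>)+
  qed
qed

lemma periodic_ext_inj:
  assumes "periodic_ext n r \<mu> = periodic_ext n r \<nu>" "\<mu> \<in> vecs r" "\<nu> \<in> vecs r"
  shows "\<mu> = \<nu>"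
proof (rule poly_mapping_eqI)
  fix j
  show "\<mu> \<cdot> j = \<nu> \<cdot> j"
  proof (cases "j \<in> {1..r}")
    case True
    then show ?thesis
      using periodic_ext_eq[of j r n \<mu> 0] periodic_ext_eq[of j r n \<nu> 0] assms(1) by simp
  next
    case False
    then show ?thesis using assms by (simp add: vecs_iff)
  qed
qed

text \<open>Dominance gives the steps within a period, and \<nu>_1 - \<nu>_r <= n the step from r to
  r+1.\<close>

lemma periodic_ext_antimono:
  assumes "\<nu> \<in> fund_weights r n" "1 \<le> r" "x \<le> y"
  shows "periodic_ext n r \<nu> y \<le> periodic_ext n r \<nu> x"
proof -
  have step: "periodic_ext n r \<nu> (z + 1) \<le> periodic_ext n r \<nu> z" for z
  proof -
    obtain j m where j: "1 \<le> j" "j \<le> r" and z: "z = int j + int r * m"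
      using int_residue[of r z] assms by auto
    show ?thesis
    proof (cases "j = r")
      case True
      then have e: "z + 1 = int 1 + int r * (m + 1)" by (simp add: z algebra_simps)
      have "periodic_ext n r \<nu> (z + 1) = \<nu> \<cdot> 1 - int n * (m + 1)"
        unfolding e using assms(2) by (intro periodic_ext_eq) auto
      then show ?thesis
        using assms(1) periodic_ext_eq[OF j, of n \<nu> m, folded z] unfolding True
        by (simp add: fund_weights_def algebra_simps)
    next
      case False
      then have e: "z + 1 = int (Suc j) + int r * m" by (simp add: z)
      have "periodic_ext n r \<nu> (z + 1) = \<nu> \<cdot> Suc j - int n * m"
        unfolding e using False j by (intro periodic_ext_eq) auto
      then show ?thesis
        using assms(1) False j by (simp add: z periodic_ext_eq fund_weights_def)
    qed
  qed
  show ?thesis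
    using assms(3)
  proof (induction y rule: int_ge_induct)
    case (step y)
    then show ?case using \<open>\<And>z. periodic_ext n r \<nu> (z + 1) \<le> periodic_ext n r \<nu> z\<close>[of y] by linarith
  qed simp
qed

lemma adj_swap_shift: "adj_swap r i (z + int r * m) = adj_swap r i z + int r * m"
proof -
  have "int r dvd z + int r * m - a \<longleftrightarrow> int r dvd z - a" for a
  proof -
    have "z + int r * m - a = (z - a) + int r * m" by simp
    then show ?thesis by (simp only: dvd_add_left_iff[OF dvd_triv_left])
  qed
  then show ?thesis by (simp add: affine_swap_def)
qed

lemma adj_swap_adj_swap:
  assumes "2 \<le> r"
  shows "adj_swap r i (adj_swap r i z) = z"
proof -
  have r: "\<not> int r dvd 1" "\<not> int r dvd - 1" using assms by auto
  consider "int r dvd z - int i" | "\<not> int r dvd z - int i" "int r dvd z - (int i + 1)"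
    | "\<not> int r dvd z - int i" "\<not> int r dvd z - (int i + 1)" by blast
  then show ?thesis
  proof cases
    case 1
    then have "adj_swap r i z = z + 1" by (simp add: affine_swap_def)
    moreover have "\<not> int r dvd z + 1 - int i"
      using 1 r(1) dvd_add_right_iff[of "int r" "z - int i" 1] by (simp add: algebra_simps)
    moreover have "int r dvd z + 1 - (int i + 1)" using 1 by simp
    ultimately show ?thesis by (simp add: affine_swap_def)
  next
    case 2
    then have "adj_swap r i z = z - 1" by (simp add: affine_swap_def)
    moreover have "int r dvd z - 1 - int i" using 2 by (simp add: algebra_simps)
    ultimately show ?thesis by (simp add: affine_swap_def)
  qed (simp add: affine_swap_def)
qed

lemma affine_swap_adj_swap:
  assumes "2 \<le> r"
  shows "affine_swap r (adj_swap r i x) (adj_swap r i y) (adj_swap r i z) = adj_swap r i (affine_swap r x y z)"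
proof -
  let ?s = "adj_swap r i"
  have d: "int r dvd ?s z - ?s x \<longleftrightarrow> int r dvd z - x" for z x
  proof -
    have *: "int r dvd ?s z - ?s x" if dv: "int r dvd z - x" for z x
    proof -
      obtain m where "z - x = int r * m" using dv by blast
      then have "z = x + int r * m" by simp
      then show ?thesis by (simp only: adj_swap_shift) simp
    qed
    show ?thesis
      using *[of z x] *[of "?s z" "?s x"] by (auto simp: adj_swap_adj_swap[OF assms])
  qed
  consider "int r dvd z - x" | "\<not> int r dvd z - x" "int r dvd z - y"
    | "\<not> int r dvd z - x" "\<not> int r dvd z - y" by blast
  then show ?thesis
  proof cases
    case 1
    then obtain m where "z - x = int r * m" by blast
    then have z: "z = x + int r * m" by simp
    have "affine_swap r x y z = y + int r * m"
      using 1 by (simp add: affine_swap_def z)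
    moreover have "affine_swap r (?s x) (?s y) (?s z) = ?s z + (?s y - ?s x)"
      using 1 d by (simp add: affine_swap_def)
    moreover have "?s z = ?s x + int r * m" unfolding z by (rule adj_swap_shift)
    ultimately show ?thesis by (simp add: adj_swap_shift)
  next
    case 2
    then obtain m where "z - y = int r * m" by blast
    then have z: "z = y + int r * m" by simp
    have "affine_swap r x y z = x + int r * m"
      using 2 by (simp add: affine_swap_def z)
    moreover have "affine_swap r (?s x) (?s y) (?s z) = ?s z - (?s y - ?s x)"
      using 2 d by (simp add: affine_swap_def)
    moreover have "?s z = ?s y + int r * m" unfolding z by (rule adj_swap_shift)
    ultimately show ?thesis by (simp add: adj_swap_shift)
  next
    case 3
    then show ?thesis using d by (simp add: affine_swap_def)
  qed
qed

text \<open>Points move by at most 1, so the order of two points is reversed only if they are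
  neighbours that get exchanged.\<close>

lemma adj_swap_order:
  assumes "2 \<le> r" "x < y" "\<not> adj_swap r i x < adj_swap r i y"
  shows "affine_swap r x y = adj_swap r i"
proof -
  have "adj_swap r i x \<noteq> adj_swap r i y"
    using assms adj_swap_adj_swap[OF assms(1), of i] by (metis less_irrefl)
  then have lt: "adj_swap r i y < adj_swap r i x" using assms(3) by simp
  have "adj_swap r i x \<le> x + 1" "y - 1 \<le> adj_swap r i y"
    by (auto simp: affine_swap_def)
  moreover have "adj_swap r i x \<noteq> x \<or> adj_swap r i y \<noteq> y" using lt assms(2) by auto
  ultimately have y: "y = x + 1" and x: "int r dvd x - int i"
    using lt assms(2) by (auto simp: affine_swap_def split: if_splits)
  have "int r dvd z - x \<longleftrightarrow> int r dvd z - int i" for z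
  proof -
    have "z - int i = (z - x) + (x - int i)" by simp
    then show ?thesis by (simp only: dvd_add_left_iff[OF x])
  qed
  moreover have "int r dvd z - y \<longleftrightarrow> int r dvd z - (int i + 1)" for z
  proof -
    have "z - (int i + 1) = (z - y) + (x - int i)" using y by simp
    then show ?thesis by (simp only: dvd_add_left_iff[OF x])
  qed
  ultimately show ?thesis by (simp add: fun_eq_iff affine_swap_def y)
qed

primrec swap_word :: "nat \<Rightarrow> nat list \<Rightarrow> (int \<Rightarrow> int) \<Rightarrow> int \<Rightarrow> int" where
  "swap_word r [] \<phi> x = \<phi> x"
| "swap_word r (i # ws) \<phi> x = swap_word r ws \<phi> (adj_swap r i x)"

text \<open>The exchange condition: deleting the letter whose wall separates the start from the end
  reflects the end in the wall.\<close>

lemma exchange: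
  assumes "2 \<le> r" "\<And>x y. x \<le> y \<Longrightarrow> \<phi> y \<le> \<phi> x" "x < y"
    and "swap_word r ws \<phi> x < swap_word r ws \<phi> y"
  shows "\<exists>ws'. set ws' \<subseteq> set ws \<and> length ws' < length ws \<and>
    (\<forall>z. swap_word r ws' \<phi> z = swap_word r ws \<phi> (affine_swap r x y z))"
  using assms(3,4)
proof (induction ws arbitrary: x y)
  case Nil
  then show ?case using assms(2)[of x y] by simp
next
  case (Cons a ws)
  show ?case
  proof (cases "adj_swap r a x < adj_swap r a y")
    case True
    have "swap_word r ws \<phi> (adj_swap r a x) < swap_word r ws \<phi> (adj_swap r a y)"
      using Cons.prems by simp
    from Cons.IH[OF True this] obtain ws' where ws': "set ws' \<subseteq> set ws" "length ws' < length ws"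
      "\<And>z. swap_word r ws' \<phi> z = swap_word r ws \<phi> (affine_swap r (adj_swap r a x) (adj_swap r a y) z)"
      by blast
    have "swap_word r (a # ws') \<phi> z = swap_word r (a # ws) \<phi> (affine_swap r x y z)" for z
      using ws'(3) affine_swap_adj_swap[OF assms(1)] by simp
    then show ?thesis using ws' by (intro exI[of _ "a # ws'"]) auto
  next
    \<comment> \<open>The letter \<open>a\<close> reverses the two positions, so it is the letter to
      be deleted.\<close>
    case False
    have "swap_word r ws \<phi> z = swap_word r (a # ws) \<phi> (affine_swap r x y z)" for z
      unfolding adj_swap_order[OF assms(1) Cons.prems(1) False]
      by (simp add: adj_swap_adj_swap[OF assms(1)])
    then show ?thesis by (intro exI[of _ ws]) auto
  qed
qed

lemma gen_act_vecs:
  assumes "2 \<le> r" "i < r" "\<nu> \<in> vecs r"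
  shows "gen_act n r i \<nu> \<in> vecs r"
  using assms by (cases "i = 0") (auto simp: vecs_iff lookup_gen_act lookup_gen_act_0 simple_refl_apply)

lemma act_word_vecs:
  assumes "2 \<le> r" "set ws \<subseteq> {0..<r}" "\<nu> \<in> vecs r"
  shows "act_word n r ws \<nu> \<in> vecs r"
  using assms(2) by (induction ws) (auto simp: assms gen_act_vecs)

lemma periodic_ext_act_word:
  assumes "2 \<le> r" "set ws \<subseteq> {0..<r}"
  shows "periodic_ext n r (act_word n r ws \<nu>) x = swap_word r ws (periodic_ext n r \<nu>) x"
  using assms(2) by (induction ws arbitrary: x) (simp_all add: periodic_ext_gen_act assms(1))

text \<open>Minimality among words that carry \<nu> to the same weight, rather than among group
  elements: in this form it passes to suffixes and applies directly to the ends of walks.\<close>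

definition min_word :: "nat \<Rightarrow> nat \<Rightarrow> nat list \<Rightarrow> weight \<Rightarrow> bool" where
  "min_word n r ws \<nu> \<longleftrightarrow> \<nu> \<in> fund_weights r n \<and> set ws \<subseteq> {0..<r} \<and>
     (\<forall>ws'. set ws' \<subseteq> {0..<r} \<longrightarrow> act_word n r ws' \<nu> = act_word n r ws \<nu> \<longrightarrow> length ws \<le> length ws')"

lemma min_word_ConsD:
  assumes "min_word n r (i # ws) \<nu>"
  shows "min_word n r ws \<nu>"
  unfolding min_word_def
proof (intro conjI allI impI)
  fix ws'
  assume "set ws' \<subseteq> {0..<r}" "act_word n r ws' \<nu> = act_word n r ws \<nu>"
  then have "set (i # ws') \<subseteq> {0..<r}" "act_word n r (i # ws') \<nu> = act_word n r (i # ws) \<nu>"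
    using assms by (auto simp: min_word_def)
  then have "length (i # ws) \<le> length (i # ws')" using assms unfolding min_word_def by blast
  then show "length ws \<le> length ws'" by simp
qed (use assms in \<open>auto simp: min_word_def\<close>)

lemma wall_dist_periodic_ext:
  assumes "2 \<le> r" "i < r"
  shows "wall_dist n r i \<nu> = periodic_ext n r \<nu> (int i) - periodic_ext n r \<nu> (int i + 1)"
proof (cases "i = 0")
  case True
  then show ?thesis
    using periodic_ext_eq[of r r n \<nu> "-1"] periodic_ext_eq[of 1 r n \<nu> 0] assms
    by (simp add: wall_dist_def)
next
  case False
  then show ?thesis
    using periodic_ext_eq[of i r n \<nu> 0] periodic_ext_eq[of "Suc i" r n \<nu> 0] assms
    by (simp add: wall_dist_def add.commute)
qed

lemma min_word_wall_dist:
  assumes "2 \<le> r" "min_word n r (i # ws) \<nu>"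
  shows "0 < wall_dist n r i (act_word n r ws \<nu>)"
proof (rule ccontr)
  assume neg: "\<not> 0 < wall_dist n r i (act_word n r ws \<nu>)"
  have D: "\<nu> \<in> fund_weights r n" "set ws \<subseteq> {0..<r}" "i < r" and \<nu>: "\<nu> \<in> vecs r"
    using assms(2) by (auto simp: min_word_def fund_weights_def)
  have min: "length (i # ws) \<le> length ws'"
    if "set ws' \<subseteq> {0..<r}" "act_word n r ws' \<nu> = act_word n r (i # ws) \<nu>" for ws'
    using assms(2) that by (auto simp: min_word_def)
  let ?\<mu> = "act_word n r ws \<nu>"
  show False
  proof (cases "wall_dist n r i ?\<mu> = 0")
    case True
    have "gen_act n r i ?\<mu> = ?\<mu>"
      using True assms(1) by (cases "i = 0")
        (auto intro!: poly_mapping_eqI simp: lookup_gen_act lookup_gen_act_0 wall_dist_def simple_refl_apply)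
    then show False using min[OF D(2)] by simp
  next
    case False
    let ?\<phi> = "periodic_ext n r \<nu>"
    have "swap_word r ws ?\<phi> (int i) < swap_word r ws ?\<phi> (int i + 1)"
      using neg False wall_dist_periodic_ext[OF assms(1) D(3), of n ?\<mu>]
      by (simp add: periodic_ext_act_word[OF assms(1) D(2)])
    moreover have "?\<phi> y \<le> ?\<phi> x" if "x \<le> y" for x y
      using periodic_ext_antimono[OF D(1)] assms(1) that by simp
    ultimately obtain ws' where ws': "set ws' \<subseteq> set ws" "length ws' < length ws"
      "\<And>z. swap_word r ws' ?\<phi> z = swap_word r ws ?\<phi> (adj_swap r i z)"
      using exchange[where \<phi> = ?\<phi> and x = "int i" and y = "int i + 1" and ws = ws, OF assms(1)]
      by auto
    have sub: "set ws' \<subseteq> {0..<r}" "set (i # ws) \<subseteq> {0..<r}" using ws'(1) D by auto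
    have "periodic_ext n r (act_word n r ws' \<nu>) = periodic_ext n r (act_word n r (i # ws) \<nu>)"
      using ws'(3) periodic_ext_act_word[OF assms(1) sub(1)] periodic_ext_act_word[OF assms(1) sub(2)]
      by (simp add: fun_eq_iff del: foldr.simps)
    then have "act_word n r ws' \<nu> = act_word n r (i # ws) \<nu>"
      by (rule periodic_ext_inj) (intro act_word_vecs[OF assms(1)] sub \<nu>)+
    then show False using min[OF sub(1)] ws'(2) by simp
  qed
qed

text \<open>Up to the factor r^2 the sum is the squared distance to the point with coordinates
  -nj/r, which lies inside the dilated alcove. Reflecting in a violated wall decreases it, by 2nr
  times the absolute value of the affine root.\<close>

lemma act_word_exists:
  assumes "2 \<le> r" "1 \<le> n" "\<nu> \<in> vecs r"
  shows "\<exists>ws lam. lam \<in> fund_weights r n \<and> set ws \<subseteq> {0..<r} \<and> act_word n r ws lam = \<nu>"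
  using assms(3)
proof (induction "nat (\<Sum>j\<in>{1..r}. (int r * \<nu> \<cdot> j + int n * int j)\<^sup>2)" arbitrary: \<nu> rule: less_induct)
  case less
  let ?f = "\<lambda>\<nu> j. (int r * \<nu> \<cdot> j + int n * int j)\<^sup>2"
  show ?case
  proof (cases "\<nu> \<in> fund_weights r n")
    case True
    then show ?thesis by (intro exI[of _ "[]"]) auto
  next
    case False
    have "\<exists>i<r. wall_dist n r i \<nu> < 0"
    proof (rule ccontr)
      assume "\<not> (\<exists>i<r. wall_dist n r i \<nu> < 0)"
      then have *: "0 \<le> wall_dist n r i \<nu>" if "i < r" for i using that by auto
      have "\<nu> \<cdot> i \<ge> \<nu> \<cdot> Suc i" if "i \<in> {1..<r}" for i
        using *[of i] that by (simp add: wall_dist_def)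
      moreover have "\<nu> \<cdot> 1 - \<nu> \<cdot> r \<le> int n"
        using *[of 0] assms(1) by (simp add: wall_dist_def)
      ultimately show False using False less.prems by (simp add: fund_weights_def)
    qed
    then obtain i where i: "i < r" "wall_dist n r i \<nu> < 0" by blast
    let ?\<mu> = "gen_act n r i \<nu>"
    let ?a = "if i = 0 then 1 else i" and ?b = "if i = 0 then r else Suc i"
    have ab: "?a \<in> {1..r}" "?b \<in> {1..r}" "?a \<noteq> ?b" using i assms(1) by auto
    have "(\<Sum>j\<in>{1..r}. ?f ?\<mu> j) - (\<Sum>j\<in>{1..r}. ?f \<nu> j) = (\<Sum>j\<in>{1..r}. ?f ?\<mu> j - ?f \<nu> j)"
      by (rule sum_subtractf[symmetric])
    also have "\<dots> = (\<Sum>j\<in>{?a, ?b}. ?f ?\<mu> j - ?f \<nu> j)"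
      using ab assms(1) by (intro sum.mono_neutral_right)
        (auto simp: lookup_gen_act lookup_gen_act_0 simple_refl_apply split: if_splits)
    also have "\<dots> = 2 * int n * int r * wall_dist n r i \<nu>"
      using ab(3) assms(1) by (cases "i = 0")
        (auto simp: lookup_gen_act lookup_gen_act_0 simple_refl_apply wall_dist_def power2_eq_square algebra_simps)
    also have "\<dots> < 0" using i assms by (simp add: mult_pos_neg)
    finally have "(\<Sum>j\<in>{1..r}. ?f ?\<mu> j) < (\<Sum>j\<in>{1..r}. ?f \<nu> j)" by simp
    moreover have "0 \<le> (\<Sum>j\<in>{1..r}. ?f ?\<mu> j)" by (intro sum_nonneg) auto
    ultimately have "nat (\<Sum>j\<in>{1..r}. ?f ?\<mu> j) < nat (\<Sum>j\<in>{1..r}. ?f \<nu> j)" by linarith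
    from less.hyps[OF this gen_act_vecs[OF assms(1) i(1) less.prems]]
    obtain ws lam where "lam \<in> fund_weights r n" "set ws \<subseteq> {0..<r}" "act_word n r ws lam = ?\<mu>" by blast
    moreover have "gen_act n r i ?\<mu> = \<nu>"
      using assms(1) by (cases "i = 0") (auto intro!: poly_mapping_eqI simp: lookup_gen_act lookup_gen_act_0)
    ultimately show ?thesis using i by (intro exI[of _ "i # ws"] exI[of _ lam]) auto
  qed
qed

text \<open>The crossings of a walk spell a word, and a fold drops its letter. Scaling the
  translation part by n turns the generators for alcoves into those acting on weights.\<close>

lemma walk_end_word:
  assumes "2 \<le> r" "set ws \<subseteq> {0..<r}" "p \<in> base_walks r ws"
  shows "\<exists>ws'. set ws' \<subseteq> {0..<r} \<and> (folds ws p = {} \<longrightarrow> ws' = ws) \<and>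
    (folds ws p \<noteq> {} \<longrightarrow> length ws' < length ws) \<and>
    (\<forall>\<nu>. scale (int n) (wt p) + perm_act (dir p) \<nu> = act_word n r ws' \<nu>)"
  using assms(2,3)
proof (induction ws arbitrary: p rule: rev_induct)
  case Nil
  then show ?case
    by (auto simp: base_walks_Nil folds_def wt_def dir_def aff_one_def perm_act_id[unfolded id_def] id_def)
next
  case (snoc i ws)
  from snoc.prems(2) obtain p' a where p': "p' \<in> base_walks r ws" "p = p' @ [a]"
    "a = last p' \<or> a = aff_mult (last p') (aff_gen 1 r i)" unfolding base_walks_snoc by blast
  have ws: "set ws \<subseteq> {0..<r}" and i: "i < r" using snoc.prems by auto
  from snoc.IH[OF ws p'(1)] obtain ws' where ws': "set ws' \<subseteq> {0..<r}" "folds ws p' = {} \<longrightarrow> ws' = ws"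
    "folds ws p' \<noteq> {} \<longrightarrow> length ws' < length ws"
    "\<And>\<nu>. scale (int n) (wt p') + perm_act (dir p') \<nu> = act_word n r ws' \<nu>" by blast
  have "length ws' \<le> length ws" using ws'(2,3) by (cases "folds ws p' = {}") auto
  show ?case
  proof (cases "a = last p'")
    case True
    then show ?thesis
      using ws' \<open>length ws' \<le> length ws\<close> folds_snoc[OF p'(1), of i a]
      by (intro exI[of _ ws']) (auto simp: p'(2) wt_def dir_def)
  next
    case False
    then have a: "a = aff_mult (last p') (aff_gen 1 r i)" using p'(3) by simp
    have "snd (last p') permutes {1..r}"
      using base_walks_permutes[OF assms(1) ws p'(1), of "length ws"] base_walksD(3)[OF p'(1)] by simp
    then have b: "bij (snd (last p'))" by (rule permutes_bij)
    have "scale (int n) (fst a) + perm_act (snd a) \<nu> = act_word n r (ws' @ [i]) \<nu>" for \<nu>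
    proof -
      have "act_word n r (ws' @ [i]) \<nu> = scale (int n) (wt p') + perm_act (dir p') (gen_act n r i \<nu>)"
        by (simp add: ws'(4))
      also have "\<dots> = scale (int n) (fst a) + perm_act (snd a) \<nu>"
        using b by (simp add: a wt_def dir_def gen_act_def aff_mult_def aff_gen_def scale_add perm_act_add
            perm_act_scale perm_act_comp perm_act_0 add.assoc)
      finally show ?thesis ..
    qed
    then show ?thesis
      using ws' i folds_snoc[OF p'(1), of i a] False
      by (intro exI[of _ "ws' @ [i]"]) (auto simp: p'(2) wt_def dir_def)
  qed
qed

lemma unfolded_unique:
  assumes "p \<in> base_walks r ws" "folds ws p = {}" "p' \<in> base_walks r ws" "folds ws p' = {}"
  shows "p = p'"
proof (rule nth_equalityI)
  have step: "q ! Suc j = aff_mult (q ! j) (aff_gen 1 r (ws ! j))"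
    if "q \<in> base_walks r ws" "folds ws q = {}" "j < length ws" for q j
  proof -
    have "Suc j \<notin> folds ws q" using that by simp
    then show ?thesis using base_walks_step[OF that(1,3)] that(3) by (auto simp: folds_def)
  qed
  show len: "length p = length p'" using assms base_walksD(1) by metis
  fix j assume "j < length p"
  then have "j \<le> length ws" using base_walksD(1)[OF assms(1)] by simp
  then show "p ! j = p' ! j"
  proof (induction j)
    case 0
    show ?case unfolding base_walksD(2)[OF assms(1)] base_walksD(2)[OF assms(3)] ..
  next
    case (Suc j)
    then show ?case using step[OF assms(1,2), of j] step[OF assms(3,4), of j] by simp
  qed
qed

lemma unfolded_exists:
  assumes "2 \<le> r" "set ws \<subseteq> {0..<r}"
  shows "\<exists>p\<in>base_walks r ws. folds ws p = {}"
  using assms(2)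
proof (induction ws rule: rev_induct)
  case Nil
  then show ?case by (simp add: base_walks_Nil folds_def)
next
  case (snoc i ws)
  then obtain p where p: "p \<in> base_walks r ws" "folds ws p = {}" by auto
  have "snd (last p) permutes {1..r}"
    using base_walks_permutes[OF assms(1) _ p(1), of "length ws"] base_walksD(3)[OF p(1)] snoc.prems by simp
  then have "aff_mult (last p) (aff_gen 1 r i) \<noteq> last p"
    using aff_mult_gen_neq[OF assms(1)] permutes_bij by blast
  then have "folds (ws @ [i]) (p @ [aff_mult (last p) (aff_gen 1 r i)]) = {}"
    using folds_snoc[OF p(1)] p(2) by simp
  then show ?case using p(1) by (auto simp: base_walks_snoc)
qed

section \<open>Existence and uniqueness of the eigenfunctions\<close>

lemma laurent_ring_iff: "f \<in> laurent_ring r \<longleftrightarrow> (\<forall>\<kappa>. \<kappa> \<notin> vecs r \<longrightarrow> f \<cdot> \<kappa> = 0)"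
  by (auto simp: laurent_ring_def in_keys_iff)

lemma laurent_ring_add: "f \<in> laurent_ring r \<Longrightarrow> g \<in> laurent_ring r \<Longrightarrow> f + g \<in> laurent_ring r"
  and laurent_ring_diff: "f \<in> laurent_ring r \<Longrightarrow> g \<in> laurent_ring r \<Longrightarrow> f - g \<in> laurent_ring r"
  and laurent_ring_lsmult: "f \<in> laurent_ring r \<Longrightarrow> lsmult c f \<in> laurent_ring r"
  by (simp_all add: laurent_ring_iff lookup_add lookup_minus)

lemma laurent_ring_sum: "(\<And>a. a \<in> A \<Longrightarrow> f a \<in> laurent_ring r) \<Longrightarrow> sum f A \<in> laurent_ring r"
  by (simp add: laurent_ring_iff lookup_sum)

lemma laurent_ring_mult: "f \<in> laurent_ring r \<Longrightarrow> g \<in> laurent_ring r \<Longrightarrow> f * g \<in> laurent_ring r"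
  unfolding laurent_ring_def using Poly_Mapping.keys_mult[of f g]
  by (auto 0 3 simp: subset_iff intro: vecs_add)

lemma laurent_ring_xpow: "\<nu> \<in> vecs r \<Longrightarrow> xpow \<nu> \<in> laurent_ring r"
  by (auto simp: laurent_ring_iff lookup_xpow)

lemma laurent_ring_lin:
  assumes "lin F" "\<And>\<nu>. \<nu> \<in> vecs r \<Longrightarrow> F (xpow \<nu>) \<in> laurent_ring r" "f \<in> laurent_ring r"
  shows "F f \<in> laurent_ring r"
proof -
  have "F f = (\<Sum>\<nu>\<in>Poly_Mapping.keys f. lsmult (f \<cdot> \<nu>) (F (xpow \<nu>)))"
    using arg_cong[OF laurent_expand, of F f] assms(1) by (simp add: lin_sum lin_scale)
  also have "\<dots> \<in> laurent_ring r"
    using assms by (intro laurent_ring_sum laurent_ring_lsmult) (auto simp: laurent_ring_def)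
  finally show ?thesis .
qed

lemma simple_root_vecs: "i \<in> {1..<r} \<Longrightarrow> simple_root i \<in> vecs r"
  by (auto simp: vecs_iff lookup_simple_root)

lemma div_diff_laurent_ring:
  assumes "n \<ge> 1" "i \<in> {1..<r}"
  shows "(div_diff n i (int n * m) :: 'f::field laurent) \<in> laurent_ring r"
proof -
  let ?X = "xpow (scale (int n) (simple_root i)) :: 'f laurent"
    and ?X' = "xpow (- scale (int n) (simple_root i)) :: 'f laurent"
  have X: "?X \<in> laurent_ring r" and X': "?X' \<in> laurent_ring r"
    using vecs_scale[OF simple_root_vecs[OF assms(2)]]
    by (auto intro!: laurent_ring_xpow simp: scale_minus_left[symmetric])
  note shift = div_diff_shift[OF assms(1) dvd_triv_left]
  show ?thesis
  proof (induction m rule: int_induct[where k = 0])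
    case base
    then show ?case by (simp add: laurent_ring_def div_diff_0[OF assms(1)])
  next
    case (step1 m)
    have "int n * (m + 1) = int n * m + int n" by (simp add: algebra_simps)
    then show ?case
      using step1 X' by (simp only: shift) (intro laurent_ring_diff laurent_ring_mult)
  next
    case (step2 m)
    have "int n * m = int n * (m - 1) + int n" by (simp add: algebra_simps)
    then have "?X * (div_diff n i (int n * m) + ?X') = div_diff n i (int n * (m - 1))"
      by (simp only: shift) (simp add: distrib_left right_diff_distrib xpow_mult_assoc xpow_mult)
    moreover have "?X * (div_diff n i (int n * m) + ?X') \<in> laurent_ring r"
      using step2 X X' by (intro laurent_ring_mult laurent_ring_add)
    ultimately show ?case by simp
  qed
qed

lemma min_word_drop: "min_word n r ws \<nu> \<Longrightarrow> min_word n r (drop m ws) \<nu>"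
proof (induction m arbitrary: ws)
  case (Suc m)
  then show ?case by (cases ws) (auto dest: min_word_ConsD)
qed simp

context metaplectic
begin

lemma T_laurent_ring:
  assumes "i \<in> {1..<r}" "f \<in> laurent_ring r"
  shows "TT i f \<in> laurent_ring r"
proof (rule laurent_ring_lin[OF lin_T _ assms(2)])
  fix \<nu> :: weight assume \<nu>: "\<nu> \<in> vecs r"
  have "div_diff n i (a - a mod int n) \<in> laurent_ring r" for a
    using div_diff_laurent_ring[OF n1 assms(1), of "a div int n"] by (simp add: minus_mod_eq_mult_div)
  then show "TT i (xpow \<nu>) \<in> laurent_ring r"
    unfolding T_xpow Let_def using \<nu> perm_act_vecs[OF simple_refl_permutes[OF assms(1)] \<nu>]
    by (intro laurent_ring_add laurent_ring_lsmult laurent_ring_mult laurent_ring_xpow) auto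
qed

lemma Ti_laurent_ring: "i \<in> {1..<r} \<Longrightarrow> f \<in> laurent_ring r \<Longrightarrow> Ti i f \<in> laurent_ring r"
  unfolding Ti_def by (intro laurent_ring_diff laurent_ring_lsmult T_laurent_ring)

text \<open>\<open>T_inv\<close> inverts T_i on the Laurent polynomials in r variables;
  \<open>Ti\<close> is a two-sided inverse and preserves that ring, which gives injectivity there
  and the preimage.\<close>

lemma T_inv_eq: "i \<in> {1..<r} \<Longrightarrow> f \<in> laurent_ring r \<Longrightarrow> T_inv r n G i f = Ti i f"
  unfolding T_inv_def
  by (rule the_inv_into_f_eq) (auto intro: inj_on_inverseI[where g = "Ti i"] Ti_laurent_ring)

lemma om_laurent_ring: "f \<in> laurent_ring r \<Longrightarrow> om f \<in> laurent_ring r"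
proof (rule laurent_ring_lin[OF lin_om])
  fix \<nu> :: weight assume "\<nu> \<in> vecs r"
  then have "rotate_weight r \<nu> \<in> vecs r"
    using r2 by (auto simp: vecs_iff lookup_rotate_weight)
  then show "om (xpow \<nu>) \<in> laurent_ring r"
    unfolding om_xpow by (intro laurent_ring_lsmult laurent_ring_xpow)
qed

lemma fold_laurent_ring:
  assumes "\<And>i f. i \<in> set is \<Longrightarrow> f \<in> laurent_ring r \<Longrightarrow> F i f \<in> laurent_ring r" "f \<in> laurent_ring r"
  shows "fold F is f \<in> laurent_ring r"
  using assms by (induction "is" arbitrary: f) auto

lemma Y_eq_Yop:
  assumes "i \<in> {1..r}" "f \<in> laurent_ring r"
  shows "Y r n G i f = Yop i f"
proof -
  have eq: "fold (T_inv r n G) is g = fold Ti is g" if "set is \<subseteq> {1..<r}" "g \<in> laurent_ring r" for "is" g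
    using that
  proof (induction "is" arbitrary: g)
    case (Cons j "is")
    then show ?case using T_inv_eq[of j g] Ti_laurent_ring[of j g] by auto
  qed simp
  have "fold TT [i..<r] f \<in> laurent_ring r"
    using assms by (intro fold_laurent_ring T_laurent_ring) auto
  then show ?thesis
    unfolding Y_def Yop_def using assms by (intro eq om_laurent_ring) auto
qed

definition step_coeff :: "nat list \<Rightarrow> weight \<Rightarrow> nat \<Rightarrow> 'a poly fract" where
  "step_coeff ws \<nu> j = cc (ws ! j) (act_word n r (drop (Suc j) ws) \<nu>)"

definition EE :: "nat list \<Rightarrow> weight \<Rightarrow> 'a poly fract laurent" where
  "EE ws \<nu> = walk_op ws (step_coeff ws \<nu>) (xpow \<nu>)"

text \<open>The letters are applied from the right, starting with the monomial of the dominant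
  weight. Every suffix is again minimal, so the current weight is off the wall of the next
  letter.\<close>

lemma eig_EE:
  assumes "min_word n r ws \<nu>"
  shows "eig (act_word n r ws \<nu>) (EE ws \<nu>)"
proof -
  let ?c = "step_coeff ws \<nu>"
  define part where "part m = foldr (\<lambda>j f. TA (ws ! j) f + lsmult (?c j) f) [m..<length ws] (xpow \<nu>)" for m
  have "eig (act_word n r (drop m ws) \<nu>) (part m)" if "m \<le> length ws" for m
    using that
  proof (induction m rule: inc_induct)
    case base
    then show ?case using assms by (simp add: part_def min_word_def eig_xpow)
  next
    case (step m)
    have d: "drop m ws = ws ! m # drop (Suc m) ws" using step by (simp add: Cons_nth_drop_Suc)
    have "min_word n r (ws ! m # drop (Suc m) ws) \<nu>"
      using min_word_drop[OF assms, of m] d by simp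
    moreover have "ws ! m < r"
      using assms step by (auto simp: min_word_def dest: nth_mem)
    ultimately have "eig (gen_act n r (ws ! m) (act_word n r (drop (Suc m) ws) \<nu>))
        (TA (ws ! m) (part (Suc m)) + lsmult (cc (ws ! m) (act_word n r (drop (Suc m) ws) \<nu>)) (part (Suc m)))"
      using step.IH min_word_wall_dist[OF r2] by (intro eig_step) force+
    then show ?case
      using step by (simp add: d part_def upt_conv_Cons step_coeff_def)
  qed
  from this[of 0] show ?thesis by (simp add: part_def EE_def walk_op_def)
qed

lemma MM_xpow:
  assumes "red_word r us" "sprod us = snd u" "\<nu> \<in> fund_weights r n"
  shows "MM u (xpow \<nu>) = lsmult (const (Sigma_word n G \<nu> us))
    (xpow (scale (int n) (fst u) + perm_act (snd u) \<nu>))"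
  using Tw_xpow[OF assms(1,3)] assms(2) by (simp add: MM_def lsmult_mult_right xpow_mult)

lemma EE_expand:
  assumes "min_word n r ws \<nu>"
    and us: "\<And>p. p \<in> base_walks r ws \<Longrightarrow> red_word r (us p) \<and> sprod (us p) = dir p"
  shows "EE ws \<nu> = (\<Sum>p\<in>base_walks r ws. lsmult
    ((\<Prod>j\<in>folds ws p. fold_coeff ws (step_coeff ws \<nu>) p j) * const (Sigma_word n G \<nu> (us p)))
    (xpow (scale (int n) (wt p) + perm_act (dir p) \<nu>)))"
proof -
  have ws: "set ws \<subseteq> {0..<r}" and \<nu>: "\<nu> \<in> fund_weights r n" using assms(1) by (auto simp: min_word_def)
  show ?thesis
    unfolding EE_def walk_op_expand[OF ws]
  proof (intro sum.cong refl)
    fix p assume "p \<in> base_walks r ws"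
    then show "lsmult (\<Prod>j\<in>folds ws p. fold_coeff ws (step_coeff ws \<nu>) p j) (MM (last p) (xpow \<nu>)) =
        lsmult ((\<Prod>j\<in>folds ws p. fold_coeff ws (step_coeff ws \<nu>) p j) * const (Sigma_word n G \<nu> (us p)))
          (xpow (scale (int n) (wt p) + perm_act (dir p) \<nu>))"
      using MM_xpow[of "us p" "last p" \<nu>] us \<nu> by (simp add: wt_def dir_def)
  qed
qed

text \<open>Folding shortens the word, so that by minimality only the unfolded walk ends at the top weight.\<close>

lemma folded_end:
  assumes "min_word n r ws \<nu>" "p \<in> base_walks r ws" "folds ws p \<noteq> {}"
  obtains ws' where "set ws' \<subseteq> {0..<r}" "length ws' < length ws"
    "scale (int n) (wt p) + perm_act (dir p) \<nu> = act_word n r ws' \<nu>"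
    "act_word n r ws' \<nu> \<noteq> act_word n r ws \<nu>"
proof -
  have ws: "set ws \<subseteq> {0..<r}" using assms(1) by (auto simp: min_word_def)
  obtain ws' where ws': "set ws' \<subseteq> {0..<r}" "length ws' < length ws"
    "scale (int n) (wt p) + perm_act (dir p) \<nu> = act_word n r ws' \<nu>"
    using walk_end_word[OF r2 ws assms(2), of n] assms(3) by blast
  moreover have "act_word n r ws' \<nu> \<noteq> act_word n r ws \<nu>"
    using assms(1) ws' unfolding min_word_def by (meson leD)
  ultimately show thesis by (rule that)
qed

lemma unfolded_end:
  assumes "min_word n r ws \<nu>" "p \<in> base_walks r ws" "folds ws p = {}"
  shows "scale (int n) (wt p) + perm_act (dir p) \<nu> = act_word n r ws \<nu>"
  using walk_end_word[OF r2 _ assms(2), of n] assms by (auto simp: min_word_def)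

lemma EE_top:
  assumes "min_word n r ws \<nu>"
    and us: "\<And>p. p \<in> base_walks r ws \<Longrightarrow> red_word r (us p) \<and> sprod (us p) = dir p"
    and "pt \<in> base_walks r ws" "folds ws pt = {}"
  shows "EE ws \<nu> \<cdot> act_word n r ws \<nu> = const (Sigma_word n G \<nu> (us pt))"
proof -
  let ?g = "\<lambda>p. (\<Prod>j\<in>folds ws p. fold_coeff ws (step_coeff ws \<nu>) p j) * const (Sigma_word n G \<nu> (us p))"
  have ex: "EE ws \<nu> = (\<Sum>p\<in>base_walks r ws. lsmult (?g p) (xpow (scale (int n) (wt p) + perm_act (dir p) \<nu>)))"
    by (intro EE_expand assms us)
  have "EE ws \<nu> \<cdot> act_word n r ws \<nu> = (\<Sum>p\<in>base_walks r ws. if p = pt then ?g p else 0)"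
    unfolding ex lookup_sum
  proof (intro sum.cong refl)
    fix p assume p: "p \<in> base_walks r ws"
    have "act_word n r ws \<nu> = scale (int n) (wt p) + perm_act (dir p) \<nu> \<longleftrightarrow> p = pt"
    proof (cases "folds ws p = {}")
      case True
      then show ?thesis
        using unfolded_end[OF assms(1) p] unfolded_unique[OF p True assms(3,4)] by simp
    next
      case False
      then show ?thesis using folded_end[OF assms(1) p False] assms(4) by metis
    qed
    then show "lsmult (?g p) (xpow (scale (int n) (wt p) + perm_act (dir p) \<nu>)) \<cdot> act_word n r ws \<nu> =
        (if p = pt then ?g p else 0)" by (simp add: lookup_xpow)
  qed
  also have "\<dots> = ?g pt" using assms(3) by (simp add: finite_base_walks)
  finally show ?thesis using assms(4) by simp
qed

lemma walk_words:
  assumes "set ws \<subseteq> {0..<r}"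
  obtains us where "\<And>p. p \<in> base_walks r ws \<Longrightarrow> red_word r (us p) \<and> sprod (us p) = dir p"
proof -
  have "\<exists>us. red_word r us \<and> sprod us = dir p" if "p \<in> base_walks r ws" for p
    using base_walks_permutes[OF r2 assms that, of "length ws"] base_walksD(3)[OF that]
    by (intro red_word_exists) (simp add: dir_def)
  then show thesis using that by metis
qed

text \<open>Triangularity with respect to word length, without reference to walks: apart from the
  top weight, every exponent comes from a folded walk and hence from a shorter word on the same
  starting weight.\<close>

lemma EE_triangular:
  assumes "min_word n r ws \<nu>"
  obtains c P a where "c \<noteq> 0" "finite P" "\<forall>p\<in>P. set p \<subseteq> {0..<r} \<and> length p < length ws"
    "EE ws \<nu> = lsmult c (xpow (act_word n r ws \<nu>)) + (\<Sum>p\<in>P. lsmult (a p) (xpow (act_word n r p \<nu>)))"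
proof -
  have ws: "set ws \<subseteq> {0..<r}" using assms by (auto simp: min_word_def)
  obtain us where us: "\<And>p. p \<in> base_walks r ws \<Longrightarrow> red_word r (us p) \<and> sprod (us p) = dir p"
    using walk_words[OF ws] by blast
  obtain pt where pt: "pt \<in> base_walks r ws" "folds ws pt = {}"
    using unfolded_exists[OF r2 ws] by blast
  let ?B = "base_walks r ws - {pt}"
  let ?g = "\<lambda>p. (\<Prod>j\<in>folds ws p. fold_coeff ws (step_coeff ws \<nu>) p j) * const (Sigma_word n G \<nu> (us p))"
  let ?e = "\<lambda>p. scale (int n) (wt p) + perm_act (dir p) \<nu>"
  have "\<forall>p\<in>?B. \<exists>w. set w \<subseteq> {0..<r} \<and> length w < length ws \<and> ?e p = act_word n r w \<nu>"
    using folded_end[OF assms] unfolded_unique[OF _ _ pt] by (metis DiffE singletonI)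
  then obtain w where w: "\<And>p. p \<in> ?B \<Longrightarrow> set (w p) \<subseteq> {0..<r} \<and> length (w p) < length ws \<and> ?e p = act_word n r (w p) \<nu>"
    by metis
  have ex: "EE ws \<nu> = (\<Sum>p\<in>base_walks r ws. lsmult (?g p) (xpow (?e p)))"
    by (intro EE_expand assms us)
  have "EE ws \<nu> = lsmult (?g pt) (xpow (?e pt)) + (\<Sum>p\<in>?B. lsmult (?g p) (xpow (?e p)))"
    unfolding ex by (rule sum.remove[OF finite_base_walks pt(1)])
  also have "(\<Sum>p\<in>?B. lsmult (?g p) (xpow (?e p))) =
      (\<Sum>p\<in>?B. lsmult (?g p) (xpow (act_word n r (w p) \<nu>)))"
    using w by (intro sum.cong) auto
  \<comment> \<open>Several walks may be assigned the same word, so their coefficients are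
    collected.\<close>
  also have "\<dots> = (\<Sum>v\<in>w ` ?B. lsmult (\<Sum>p\<in>{p\<in>?B. w p = v}. ?g p) (xpow (act_word n r v \<nu>)))"
  proof -
    have "lsmult (sum h A) f = (\<Sum>a\<in>A. lsmult (h a) f)" for h :: "aff list \<Rightarrow> 'a poly fract" and A f
      by (induction A rule: infinite_finite_induct) (simp_all add: lsmult_add_left)
    then show ?thesis
      using sum.image_gen[of ?B "\<lambda>p. lsmult (?g p) (xpow (act_word n r (w p) \<nu>))" w] finite_base_walks[of r ws]
      by (auto intro!: sum.cong)
  qed
  finally show thesis
    using that[of "?g pt" "w ` ?B" "\<lambda>v. \<Sum>p\<in>{p\<in>?B. w p = v}. ?g p"] w pt unfolded_end[OF assms pt]
      finite_base_walks[of r ws] Sigma_word_nonzero[of \<nu> "us pt"] by auto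
qed

lemma EE_laurent_ring:
  assumes "min_word n r ws \<nu>"
  shows "EE ws \<nu> \<in> laurent_ring r"
proof -
  obtain c P a where "c \<noteq> 0" "finite P" and P: "\<forall>p\<in>P. set p \<subseteq> {0..<r} \<and> length p < length ws"
    and E: "EE ws \<nu> = lsmult c (xpow (act_word n r ws \<nu>)) + (\<Sum>p\<in>P. lsmult (a p) (xpow (act_word n r p \<nu>)))"
    by (rule EE_triangular[OF assms])
  have "act_word n r p \<nu> \<in> vecs r" if "set p \<subseteq> {0..<r}" for p
    using assms that by (intro act_word_vecs[OF r2]) (auto simp: min_word_def fund_weights_def)
  then show ?thesis
    unfolding E using P assms
    by (intro laurent_ring_add laurent_ring_sum laurent_ring_lsmult laurent_ring_xpow) (auto simp: min_word_def)
qed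

section \<open>Uniqueness of the eigenvectors\<close>

lemma gamma_distinct:
  assumes "i \<in> {1..r}" "\<mu> \<cdot> i \<noteq> \<nu> \<cdot> i"
  shows "\<gamma> r n G i \<mu> \<noteq> \<gamma> r n G i \<nu>"
proof
  assume "\<gamma> r n G i \<mu> = \<gamma> r n G i \<nu>"
  then have "qvar powi (- \<mu> \<cdot> i) * const (Gam i \<mu>) = qvar powi (- \<nu> \<cdot> i) * const (Gam i \<nu>)"
    using assms(1) by (simp add: gamma_eq)
  then have "qvar powi (\<nu> \<cdot> i) * (qvar powi (- \<mu> \<cdot> i) * const (Gam i \<mu>)) =
      qvar powi (\<nu> \<cdot> i) * (qvar powi (- \<nu> \<cdot> i) * const (Gam i \<nu>))" by simp
  then have eq: "qvar powi (\<nu> \<cdot> i - \<mu> \<cdot> i) * const (Gam i \<mu>) = const (Gam i \<nu>)"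
    by (simp add: mult.assoc[symmetric] power_int_add[symmetric])
  have "const (Gam i \<nu> * inverse (Gam i \<mu>)) = const (Gam i \<nu>) * inverse (const (Gam i \<mu>))"
    by (simp only: const_mult const_inverse)
  also have "\<dots> = qvar powi (\<nu> \<cdot> i - \<mu> \<cdot> i)"
    unfolding eq[symmetric] using Gam_nonzero[of i \<mu>] by simp
  finally have "qvar powi (\<nu> \<cdot> i - \<mu> \<cdot> i) = const (Gam i \<nu> * inverse (Gam i \<mu>))" ..
  then have "\<nu> \<cdot> i - \<mu> \<cdot> i = 0" by (rule qvar_powi_eq_const)
  then show False using assms(2) by simp
qed

text \<open>The usual argument: for \<nu> other than \<mu> some Y_i separates the two eigenvalues,
  and Y_i minus its eigenvalue at \<mu> removes the \<mu> component from the relation without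
  killing the one at \<nu>.\<close>

lemma eig_independent:
  assumes "finite A" "A \<subseteq> vecs r" "\<And>\<nu>. \<nu> \<in> A \<Longrightarrow> eig \<nu> (v \<nu>)" "(\<Sum>\<nu>\<in>A. v \<nu>) = 0"
  shows "\<forall>\<nu>\<in>A. v \<nu> = 0"
  using assms
proof (induction A arbitrary: v rule: finite_induct)
  case (insert \<mu> A)
  have v\<mu>: "v \<mu> = - (\<Sum>\<nu>\<in>A. v \<nu>)"
    using insert by (simp add: eq_neg_iff_add_eq_0)
  have "v \<nu> = 0" if \<nu>: "\<nu> \<in> A" for \<nu>
  proof -
    have "\<mu> \<noteq> \<nu>" using insert \<nu> by auto
    then obtain i where "\<mu> \<cdot> i \<noteq> \<nu> \<cdot> i" by (meson poly_mapping_eqI)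
    moreover have "\<mu> \<in> vecs r" "\<nu> \<in> vecs r" using insert.prems(1) \<nu> by auto
    ultimately have i: "i \<in> {1..r}" unfolding vecs_iff by metis
    note \<open>\<mu> \<cdot> i \<noteq> \<nu> \<cdot> i\<close>
    then have ne: "\<gamma> r n G i \<nu> \<noteq> \<gamma> r n G i \<mu>" using gamma_distinct[OF i] by metis
    let ?w = "\<lambda>\<kappa>. lsmult (\<gamma> r n G i \<kappa> - \<gamma> r n G i \<mu>) (v \<kappa>)"
    have Y: "Yop i (v \<kappa>) = lsmult (\<gamma> r n G i \<kappa>) (v \<kappa>)" if "\<kappa> \<in> insert \<mu> A" for \<kappa>
      using insert.prems(2)[OF that] i by (simp add: eig_def)
    have "(\<Sum>\<kappa>\<in>A. ?w \<kappa>) = Yop i (\<Sum>\<kappa>\<in>A. v \<kappa>) - lsmult (\<gamma> r n G i \<mu>) (\<Sum>\<kappa>\<in>A. v \<kappa>)"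
      using Y by (simp add: lin_sum[OF lin_Yop] lsmult_diff_left sum_subtractf lsmult_sum_right)
    also have "(\<Sum>\<kappa>\<in>A. v \<kappa>) = - v \<mu>" using v\<mu> by simp
    also have "Yop i (- v \<mu>) - lsmult (\<gamma> r n G i \<mu>) (- v \<mu>) = 0"
      using lin_diff[OF lin_Yop, of i 0 "v \<mu>"] lin_0[OF lin_Yop, of i] Y[of \<mu>] lsmult_diff_right[of _ 0 "v \<mu>"]
      by simp
    finally have "\<forall>\<kappa>\<in>A. ?w \<kappa> = 0"
      using insert.prems by (intro insert.IH eig_lsmult) auto
    then have "?w \<nu> = lsmult (\<gamma> r n G i \<nu> - \<gamma> r n G i \<mu>) 0" using \<nu> by simp
    then show ?thesis using ne by (subst (asm) lsmult_cancel) auto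
  qed
  then show ?case using v\<mu> by simp
qed simp

text \<open>Eigenvectors F_\<nu> exist for all weights and, by triangularity, span the ring. In the
  expansion of d only F_\<mu> can occur by independence, and its coefficient at \<mu> is nonzero
  while that of d is zero.\<close>

lemma eig_unique:
  assumes "\<mu> \<in> vecs r" "d \<in> laurent_ring r" "eig \<mu> d" "d \<cdot> \<mu> = 0"
  shows "d = 0"
proof -
  define Q where "Q \<nu> ws lam \<longleftrightarrow> lam \<in> fund_weights r n \<and> set ws \<subseteq> {0..<r} \<and> act_word n r ws lam = \<nu>" for \<nu> ws lam
  \<comment> \<open>The minimum runs over dominant starting weights as well as words; it is the
    induction measure for the spanning property.\<close>
  define L where "L \<nu> = (LEAST l. \<exists>ws lam. Q \<nu> ws lam \<and> length ws = l)" for \<nu>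
  have L_le: "L \<nu> \<le> length ws" if "Q \<nu> ws lam" for \<nu> ws lam
    unfolding L_def using that by (intro Least_le) blast
  have "\<exists>ws lam. Q \<nu> ws lam \<and> length ws = L \<nu>" if "\<nu> \<in> vecs r" for \<nu>
  proof -
    have "\<exists>l ws lam. Q \<nu> ws lam \<and> length ws = l"
      using act_word_exists[OF r2 n1 that] by (auto simp: Q_def)
    from LeastI_ex[OF this] show ?thesis unfolding L_def .
  qed
  then obtain W lm where W: "\<And>\<nu>. \<nu> \<in> vecs r \<Longrightarrow> Q \<nu> (W \<nu>) (lm \<nu>) \<and> length (W \<nu>) = L \<nu>"
    by metis
  have min: "min_word n r (W \<nu>) (lm \<nu>)" and ends: "act_word n r (W \<nu>) (lm \<nu>) = \<nu>" if "\<nu> \<in> vecs r" for \<nu>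
    using W[OF that] L_le[of \<nu>] by (auto simp: min_word_def Q_def)
  define F where "F \<nu> = EE (W \<nu>) (lm \<nu>)" for \<nu>
  have eigF: "eig \<nu> (F \<nu>)" if "\<nu> \<in> vecs r" for \<nu>
    using eig_EE[OF min[OF that]] ends[OF that] by (simp add: F_def)
  have topF: "F \<nu> \<cdot> \<nu> \<noteq> 0" if "\<nu> \<in> vecs r" for \<nu>
  proof -
    have ws: "set (W \<nu>) \<subseteq> {0..<r}" using min[OF that] by (simp add: min_word_def)
    obtain us where us: "\<And>p. p \<in> base_walks r (W \<nu>) \<Longrightarrow> red_word r (us p) \<and> sprod (us p) = dir p"
      using walk_words[OF ws] by blast
    obtain pt where pt: "pt \<in> base_walks r (W \<nu>)" "folds (W \<nu>) pt = {}"
      using unfolded_exists[OF r2 ws] by blast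
    show ?thesis
      using EE_top[OF min[OF that], where us = us, OF us pt] Sigma_word_nonzero by (simp add: F_def ends[OF that])
  qed
  have span: "\<exists>a\<in>laurent_ring r. lin_ext F a = xpow \<nu>" if "\<nu> \<in> vecs r" for \<nu>
    using that
  proof (induction "L \<nu>" arbitrary: \<nu> rule: less_induct)
    case less
    obtain c P b where c: "c \<noteq> 0" and P: "finite P"
      "\<forall>p\<in>P. set p \<subseteq> {0..<r} \<and> length p < length (W \<nu>)"
      and "EE (W \<nu>) (lm \<nu>) = lsmult c (xpow (act_word n r (W \<nu>) (lm \<nu>))) +
        (\<Sum>p\<in>P. lsmult (b p) (xpow (act_word n r p (lm \<nu>))))"
      by (rule EE_triangular[OF min[OF less.prems]])
    then have E: "F \<nu> = lsmult c (xpow \<nu>) + (\<Sum>p\<in>P. lsmult (b p) (xpow (act_word n r p (lm \<nu>))))"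
      by (simp add: F_def ends[OF less.prems])
    let ?e = "\<lambda>p. act_word n r p (lm \<nu>)"
    have lm: "lm \<nu> \<in> fund_weights r n" using W[OF less.prems] by (simp add: Q_def)
    then have e: "?e p \<in> vecs r" if "p \<in> P" for p
      using P(2)[rule_format, OF that] by (intro act_word_vecs[OF r2]) (auto simp: fund_weights_def)
    have "L (?e p) < L \<nu>" if "p \<in> P" for p
      using L_le[of "?e p" p "lm \<nu>"] P(2)[rule_format, OF that] lm W[OF less.prems] by (auto simp: Q_def)
    with less.hyps e have "\<forall>p\<in>P. \<exists>a\<in>laurent_ring r. lin_ext F a = xpow (?e p)" by blast
    then obtain A where A: "\<And>p. p \<in> P \<Longrightarrow> A p \<in> laurent_ring r \<and> lin_ext F (A p) = xpow (?e p)"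
      by metis
    let ?a = "lsmult (inverse c) (xpow \<nu> - (\<Sum>p\<in>P. lsmult (b p) (A p)))"
    have "lin_ext F ?a = lsmult (inverse c) (F \<nu> - (\<Sum>p\<in>P. lsmult (b p) (xpow (?e p))))"
      using A by (simp add: lin_scale[OF lin_lin_ext] lin_diff[OF lin_lin_ext] lin_sum[OF lin_lin_ext])
    also have "\<dots> = xpow \<nu>" using c by (simp add: E)
    finally show ?case
      using A less.prems
      by (intro bexI[of _ ?a] laurent_ring_lsmult laurent_ring_diff laurent_ring_sum laurent_ring_xpow) auto
  qed
  then obtain A where A: "\<And>\<nu>. \<nu> \<in> vecs r \<Longrightarrow> A \<nu> \<in> laurent_ring r \<and> lin_ext F (A \<nu>) = xpow \<nu>"
    by metis
  define a where "a = (\<Sum>\<nu>\<in>Poly_Mapping.keys d. lsmult (d \<cdot> \<nu>) (A \<nu>))"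
  have keys: "Poly_Mapping.keys d \<subseteq> vecs r" using assms(2) by (simp add: laurent_ring_def)
  have "lin_ext F a = (\<Sum>\<nu>\<in>Poly_Mapping.keys d. lsmult (d \<cdot> \<nu>) (xpow \<nu>))"
    unfolding a_def using A keys
    by (auto simp: lin_sum[OF lin_lin_ext] lin_scale[OF lin_lin_ext] intro!: sum.cong)
  then have Fa: "lin_ext F a = d" by (simp flip: laurent_expand)
  have "a \<in> laurent_ring r"
    unfolding a_def using A keys by (intro laurent_ring_sum laurent_ring_lsmult) auto
  then have ka: "Poly_Mapping.keys a \<subseteq> vecs r" by (simp add: laurent_ring_def)
  let ?S = "insert \<mu> (Poly_Mapping.keys a)"
  \<comment> \<open>Subtracting d in the component of its own weight makes the components sum to
    zero while each stays an eigenvector for its weight.\<close>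
  let ?v = "\<lambda>\<nu>. lsmult (a \<cdot> \<nu>) (F \<nu>) - (if \<nu> = \<mu> then d else 0)"
  have "(\<Sum>\<nu>\<in>?S. lsmult (a \<cdot> \<nu>) (F \<nu>)) = d"
    unfolding Fa[symmetric] lin_ext_def by (intro sum.mono_neutral_right) (auto simp: in_keys_iff)
  then have "(\<Sum>\<nu>\<in>?S. ?v \<nu>) = 0" by (simp add: sum_subtractf)
  moreover have "eig \<nu> (?v \<nu>)" if "\<nu> \<in> ?S" for \<nu>
  proof -
    have "\<nu> \<in> vecs r" using that ka assms(1) by auto
    then have "eig \<nu> (lsmult (a \<cdot> \<nu>) (F \<nu>))" by (intro eig_lsmult eigF)
    then show ?thesis
      using assms(3) by (auto simp: eig_def lin_diff[OF lin_Yop] lsmult_diff_right lin_0[OF lin_Yop])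
  qed
  ultimately have "\<forall>\<nu>\<in>?S. ?v \<nu> = 0"
    using ka assms(1) by (intro eig_independent) auto
  then have d: "lsmult (a \<cdot> \<mu>) (F \<mu>) = d" by simp
  then have "a \<cdot> \<mu> * F \<mu> \<cdot> \<mu> = 0" using assms(4) by (metis lookup_lsmult)
  then have "a \<cdot> \<mu> = 0" using topF[OF assms(1)] by simp
  with d show ?thesis by simp
qed

lemma E_poly_eq:
  assumes "min_word n r ws \<nu>"
    and us: "\<And>p. p \<in> base_walks r ws \<Longrightarrow> red_word r (us p) \<and> sprod (us p) = dir p"
    and pt: "pt \<in> base_walks r ws" "folds ws pt = {}"
  shows "lsmult (const (Sigma_word n G \<nu> (us pt))) (E_poly r n G (act_word n r ws \<nu>)) = EE ws \<nu>"
proof -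
  let ?\<mu> = "act_word n r ws \<nu>" and ?s = "const (Sigma_word n G \<nu> (us pt))"
  let ?P = "\<lambda>f. f \<in> laurent_ring r \<and> f \<cdot> ?\<mu> = 1 \<and> (\<forall>i\<in>{1..r}. Y r n G i f = lsmult (\<gamma> r n G i ?\<mu>) f)"
  have \<mu>: "?\<mu> \<in> vecs r"
    using assms(1) by (intro act_word_vecs[OF r2]) (auto simp: min_word_def fund_weights_def)
  have s: "?s \<noteq> 0" using Sigma_word_nonzero by simp
  have P: "?P f \<longleftrightarrow> f \<in> laurent_ring r \<and> f \<cdot> ?\<mu> = 1 \<and> eig ?\<mu> f" for f
    using Y_eq_Yop by (auto simp: eig_def)
  let ?f = "lsmult (inverse ?s) (EE ws \<nu>)"
  have Pf: "?P ?f"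
    unfolding P using s EE_top[OF assms(1), where us = us, OF us pt]
    by (auto intro: laurent_ring_lsmult eig_lsmult EE_laurent_ring eig_EE assms(1))
  moreover have "g = ?f" if "?P g" for g
  proof -
    have "eig ?\<mu> (g - ?f)"
      using that Pf unfolding P by (simp add: eig_def lin_diff[OF lin_Yop] lsmult_diff_right)
    then have "g - ?f = 0"
      using that Pf by (intro eig_unique[OF \<mu>] laurent_ring_diff) (auto simp: lookup_minus)
    then show ?thesis by simp
  qed
  ultimately have "E_poly r n G ?\<mu> = ?f"
    unfolding E_poly_def by (rule the_equality)
  then show ?thesis using s by simp
qed

end

section \<open>Sides of the walls of an alcove\<close>

lemma lookup_aff_act:
  "bij (snd u) \<Longrightarrow> aff_act u x \<cdot> k = of_int (fst u \<cdot> k) + x \<cdot> inv (snd u) k"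
  by (simp add: aff_act_def lookup_add lookup_perm_act Poly_Mapping.map.rep_eq when_def)

lemma bij_aff_gen: "bij (snd (aff_gen m r i))"
  by (simp add: aff_gen_def)

lemma lookup_aff_act_mult:
  assumes "bij (snd u)" "bij (snd w)"
  shows "(aff_act (aff_mult u w) x :: nat \<Rightarrow>\<^sub>0 'a::ring_1) \<cdot> k = of_int (fst u \<cdot> k) + aff_act w x \<cdot> inv (snd u) k"
proof -
  have "bij (snd (aff_mult u w))" using assms by (simp add: aff_mult_def bij_comp)
  moreover have "inv (snd (aff_mult u w)) = inv (snd w) \<circ> inv (snd u)"
    using assms by (simp add: aff_mult_def o_inv_distrib)
  ultimately show ?thesis
    using assms by (simp add: lookup_aff_act) (simp add: aff_mult_def lookup_add lookup_perm_act)
qed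

lemma aff_act_mult:
  assumes "bij (snd u)" "bij (snd w)"
  shows "aff_act (aff_mult u w) x = aff_act u (aff_act w x)"
  by (rule poly_mapping_eqI) (simp add: lookup_aff_act_mult[OF assms] lookup_aff_act[OF assms(1)])

lemma lookup_aff_gen:
  assumes "1 < r"
  shows "(aff_act (aff_gen 1 r i) x :: nat \<Rightarrow>\<^sub>0 'a::ring_1) \<cdot> j =
    (if i = 0 then (if j = 1 then x \<cdot> r + 1 else if j = r then x \<cdot> 1 - 1 else x \<cdot> j) else x \<cdot> simple_refl i j)"
  unfolding lookup_aff_act[OF bij_aff_gen] using assms
  by (auto simp: aff_gen_def lookup_eroot transpose_def)

definition vec_of :: "nat \<Rightarrow> (nat \<Rightarrow> real) \<Rightarrow> nat \<Rightarrow>\<^sub>0 real" where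
  "vec_of r f = (\<Sum>j\<in>{1..r}. Poly_Mapping.single j (f j))"

lemma lookup_vec_of: "vec_of r f \<cdot> k = (if k \<in> {1..r} then f k else 0)"
  by (simp add: vec_of_def lookup_sum lookup_single when_def)

text \<open>The alcove has a point at distance \<open>1 / (4R)\<close> from its wall of type \<open>i\<close>, and all other walls
  are at least twice as far from it; this leaves only one hyperplane between the point and its mirror image.\<close>

lemma wall_unique:
  assumes "2 \<le> r" "i < r" "a \<in> {1..r}" "b \<in> {1..r}" "a \<noteq> b"
    and pos: "\<And>x. x \<in> fund_alcove r \<Longrightarrow> x \<cdot> a - x \<cdot> b + of_int m > 0"
    and neg: "\<And>x. x \<in> fund_alcove r \<Longrightarrow>
      aff_act (aff_gen 1 r i) x \<cdot> a - aff_act (aff_gen 1 r i) x \<cdot> b + of_int m < (0 :: real)"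
  shows "a = (if i = 0 then r else i) \<and> b = (if i = 0 then 1 else Suc i)"
proof -
  have r1: "1 < r" using assms(1) by simp
  \<comment> \<open>The point -c/R lies on the wall of type i and on no other wall of the alcove: c
    takes equal values at i and i+1, or for i = 0 differs by R between 1 and r. The vector d is
    normal to the wall and displaces the point into the alcove.\<close>
  define R where "R = (if i = 0 then int r - 1 else int r)"
  define c where "c j = (if i = 0 \<or> j \<le> i then int j else int j - 1)" for j
  define d where "d j = (if j = (if i = 0 then r else i) then 1 else if j = (if i = 0 then 1 else Suc i) then -1 else 0 :: int)" for j
  have R: "R \<ge> 1" using assms(1) by (simp add: R_def)
  define x where "x = vec_of r (\<lambda>j. of_int (d j - 4 * c j) / (4 * of_int R))"
  have xk: "x \<cdot> k = of_int (d k - 4 * c k) / (4 * of_int R)" if "k \<in> {1..r}" for k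
    using that by (simp add: x_def lookup_vec_of)
  have diff: "x \<cdot> k - x \<cdot> l = of_int (d k - d l + 4 * (c l - c k)) / (4 * of_int R)"
    if "k \<in> {1..r}" "l \<in> {1..r}" for k l
    using that by (simp add: xk diff_divide_distrib[symmetric])
  have "x \<in> fund_alcove r"
  proof -
    have "x \<in> vecs r" by (auto simp: vecs_iff x_def lookup_vec_of)
    moreover have "x \<cdot> j > x \<cdot> Suc j" if j: "j \<in> {1..<r}" for j
    proof -
      have "0 < d j - d (Suc j) + 4 * (c (Suc j) - c j)"
        using j assms(1,2) by (auto simp: d_def c_def)
      then have "0 < x \<cdot> j - x \<cdot> Suc j"
        using j R by (subst diff) (auto intro!: divide_pos_pos)
      then show ?thesis by simp
    qed
    moreover have "x \<cdot> 1 - x \<cdot> r < 1"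
    proof -
      have "d 1 - d r + 4 * (c r - c 1) < 4 * R"
        using assms(1,2) by (auto simp: d_def c_def R_def)
      then have "real_of_int (d 1 - d r + 4 * (c r - c 1)) < real_of_int (4 * R)" by (simp only: of_int_less_iff)
      then show ?thesis
        using assms(1) R by (subst diff) (auto simp: divide_less_eq)
    qed
    ultimately show ?thesis by (simp add: fund_alcove_def)
  qed
  note P = pos[OF this] and N = neg[OF this]
  \<comment> \<open>The reflection reverses the displacement d.\<close>
  have y: "aff_act (aff_gen 1 r i) x \<cdot> k = x \<cdot> k - of_int (2 * d k) / (4 * of_int R)" if k: "k \<in> {1..r}" for k
  proof (cases "i = 0")
    case True
    have "x \<cdot> r + 1 = of_int (d r - 4 * c r + 4 * R) / (4 * of_int R)"
      "x \<cdot> 1 - 1 = of_int (d 1 - 4 * c 1 - 4 * R) / (4 * of_int R)"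
      using R assms(1) by (simp_all add: xk field_simps)
    then show ?thesis
      using True k assms(1) unfolding lookup_aff_gen[OF r1]
      by (auto simp: xk d_def c_def R_def diff_divide_distrib[symmetric])
  next
    case False
    have "simple_refl i k \<in> {1..r}" using k assms(2) False by (auto simp: simple_refl_apply)
    then show ?thesis
      using False k assms(1) unfolding lookup_aff_gen[OF r1]
      using R by (auto simp: xk d_def c_def simple_refl_apply field_simps)
  qed
  let ?N = "c b - c a + R * m" and ?D = "d a - d b"
  have "x \<cdot> a - x \<cdot> b + of_int m = of_int (?D + 4 * ?N) / (4 * of_int R)"
    using R assms by (simp add: diff field_simps)
  then have "of_int (?D + 4 * ?N) > (0 :: real)" using P R by (simp add: zero_less_divide_iff)
  then have 1: "?D + 4 * ?N > 0" by (simp only: of_int_0_less_iff)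
  have "aff_act (aff_gen 1 r i) x \<cdot> a - aff_act (aff_gen 1 r i) x \<cdot> b + of_int m =
      x \<cdot> a - x \<cdot> b - of_int (2 * ?D) / (4 * of_int R) + of_int m"
    unfolding y[OF assms(3)] y[OF assms(4)] by (simp add: diff_divide_distrib algebra_simps)
  also have "\<dots> = of_int (- ?D + 4 * ?N) / (4 * of_int R)"
    using R assms by (simp add: diff field_simps)
  finally have "of_int (- ?D + 4 * ?N) < (0 :: real)" using N R by (simp add: divide_less_0_iff)
  then have 2: "- ?D + 4 * ?N < 0" by (simp only: of_int_less_0_iff)
  \<comment> \<open>After clearing denominators the displacement contributes at most 2 and the rest
    is a multiple of 4. A sign change forces that rest to vanish, so the hyperplane contains the
    chosen point of the wall.\<close>
  have "N = 0 \<and> D > 0" if "D + 4 * N > 0" "- D + 4 * N < 0" "\<bar>D\<bar> \<le> 2" for N D :: int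
    using that by arith
  moreover have "\<bar>?D\<bar> \<le> 2" by (simp add: d_def)
  ultimately have N0: "?N = 0" and D: "?D > 0" using 1 2 by blast+
  have cb: "c b - c a = - (R * m)" using N0 by simp
  \<comment> \<open>The difference of c is now a multiple of R, and this bound leaves only the
    values 0 and R up to sign, which identify the wall.\<close>
  have bound: "\<bar>c b - c a\<bar> \<le> R \<and> (i \<noteq> 0 \<longrightarrow> \<bar>c b - c a\<bar> < R)"
    using assms by (auto simp: c_def R_def)
  show ?thesis
  proof (cases "i = 0")
    case True
    have "c b - c a \<noteq> 0" using True assms(5) by (simp add: c_def)
    then have "m \<noteq> 0" using cb by auto
    then have "R \<le> R * \<bar>m\<bar>" using R by (simp add: mult_le_cancel_left1)
    then have "\<bar>c b - c a\<bar> = R" using cb bound R by (simp add: abs_mult)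
    then have "(a = 1 \<and> b = r) \<or> (a = r \<and> b = 1)"
      using True assms by (auto simp: c_def R_def abs_if split: if_splits)
    then show ?thesis using True D assms(1) by (auto simp: d_def)
  next
    case False
    have "m = 0"
    proof (rule ccontr)
      assume "m \<noteq> 0"
      then have "R \<le> R * \<bar>m\<bar>" using R by (simp add: mult_le_cancel_left1)
      then show False using cb bound R False by (simp add: abs_mult)
    qed
    then have "c a = c b" using cb by simp
    then have "(a = i \<and> b = Suc i) \<or> (a = Suc i \<and> b = i)"
      using False assms(5) by (auto simp: c_def split: if_splits)
    then show ?thesis using False D by (auto simp: d_def)
  qed
qed

lemma fund_alcove_nonempty: "2 \<le> r \<Longrightarrow> fund_alcove r \<noteq> {}"
proof -
  assume r: "2 \<le> r"
  have "vec_of r (\<lambda>j. - real j / real r) \<in> fund_alcove r"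
    using r by (auto simp: fund_alcove_def vecs_iff lookup_vec_of field_simps)
  then show ?thesis by blast
qed

text \<open>Pulled back by u, a hyperplane between the two alcoves separates the fundamental alcove
  from its i-th neighbour, so \<open>wall_unique\<close> determines its two indices. Positivity of
  the root is then a comparison of the values of the permutation of u at these indices.\<close>

lemma positive_side_iff:
  assumes r: "2 \<le> r" and i: "i < r" and v: "snd u permutes {1..r}"
  shows "(\<exists>\<alpha>\<in>pos_roots r. \<exists>s. separates \<alpha> s (alcove r u) (alcove r (aff_mult u (aff_gen 1 r i))) \<and>
      on_pos_side \<alpha> s (alcove r u)) \<longleftrightarrow> descends r u i"
proof -
  have b: "bij (snd u)" using v by (rule permutes_bij)
  let ?v = "snd u" and ?g = "aff_gen 1 r i"
  define off where "off a c s = fst u \<cdot> a - fst u \<cdot> c + s" for a c s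
  have side: "ip (eroot a c) (aff_act u x) + of_int s = x \<cdot> inv ?v a - x \<cdot> inv ?v c + of_int (off a c s)"
    for a c s and x :: "nat \<Rightarrow>\<^sub>0 real"
    by (simp add: ip_eroot_left lookup_aff_act[OF b] off_def)
  have side': "ip (eroot a c) (aff_act (aff_mult u ?g) x) + of_int s =
      aff_act ?g x \<cdot> inv ?v a - aff_act ?g x \<cdot> inv ?v c + of_int (off a c s)"
    for a c s and x :: "nat \<Rightarrow>\<^sub>0 real"
    by (simp add: ip_eroot_left lookup_aff_act_mult[OF b bij_aff_gen] off_def)
  have iv: "inv ?v (?v k) = k" for k using b by (simp add: bij_is_inj)
  have vi: "?v (inv ?v k) = k" for k using b by (simp add: bij_is_surj surj_f_inv_f)
  have gen: "aff_act ?g x \<cdot> j = (if i = 0 then (if j = 1 then x \<cdot> r + 1 else if j = r then x \<cdot> 1 - 1 else x \<cdot> j)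
      else x \<cdot> simple_refl i j)" for x :: "nat \<Rightarrow>\<^sub>0 real" and j
    using r by (intro lookup_aff_gen) simp
  show ?thesis
  proof
    assume "\<exists>\<alpha>\<in>pos_roots r. \<exists>s. separates \<alpha> s (alcove r u) (alcove r (aff_mult u ?g)) \<and> on_pos_side \<alpha> s (alcove r u)"
    then obtain a c s where ac: "a \<in> {1..r}" "c \<in> {1..r}" "a < c"
      and sep: "separates (eroot a c) s (alcove r u) (alcove r (aff_mult u ?g))"
      and pos: "on_pos_side (eroot a c) s (alcove r u)"
      by (auto simp: pos_roots_def)
    obtain x0 where "x0 \<in> fund_alcove r" using fund_alcove_nonempty[OF r] by blast
    then have "\<not> on_neg_side (eroot a c) s (alcove r u)"
      using pos by (force simp: on_pos_side_def on_neg_side_def alcove_def)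
    then have neg: "on_neg_side (eroot a c) s (alcove r (aff_mult u ?g))"
      using sep by (auto simp: separates_def)
    have "inv ?v a = (if i = 0 then r else i) \<and> inv ?v c = (if i = 0 then 1 else Suc i)"
    proof (rule wall_unique[OF r i, where m = "off a c s"])
      show "inv ?v a \<in> {1..r}" "inv ?v c \<in> {1..r}"
        unfolding permutes_in_image[OF permutes_inv[OF v]] by (rule ac)+
      show "inv ?v a \<noteq> inv ?v c" using ac(3) vi by (metis less_irrefl)
      fix x :: "nat \<Rightarrow>\<^sub>0 real" assume x: "x \<in> fund_alcove r"
      show "x \<cdot> inv ?v a - x \<cdot> inv ?v c + of_int (off a c s) > 0"
        using pos x unfolding on_pos_side_def alcove_def side[symmetric] by blast
      show "aff_act ?g x \<cdot> inv ?v a - aff_act ?g x \<cdot> inv ?v c + of_int (off a c s) < 0"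
        using neg x unfolding on_neg_side_def alcove_def side'[symmetric] by blast
    qed
    then have "a = ?v (if i = 0 then r else i)" "c = ?v (if i = 0 then 1 else Suc i)"
      using vi by metis+
    then show "descends r u i" using ac(3) by (simp add: descends_def split: if_splits)
  next
    assume d: "descends r u i"
    let ?p = "if i = 0 then r else i" and ?q = "if i = 0 then 1 else Suc i"
    define a c where "a = ?v ?p" and "c = ?v ?q"
    have "?p \<in> {1..r}" "?q \<in> {1..r}" using r i by auto
    then have "a \<in> {1..r}" "c \<in> {1..r}"
      unfolding a_def c_def permutes_in_image[OF v] .
    moreover have lt: "a < c" using d by (auto simp: descends_def a_def c_def)
    ultimately have root: "eroot a c \<in> pos_roots r" unfolding pos_roots_def by blast
    \<comment> \<open>Chosen so that the pulled-back hyperplane is the wall of type i, with offset 1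
      for the affine wall and 0 otherwise.\<close>
    define s where "s = (if i = 0 then 1 else 0) - (fst u \<cdot> a - fst u \<cdot> c)"
    have off: "off a c s = (if i = 0 then 1 else 0)" by (simp add: off_def s_def)
    have ia: "inv ?v a = ?p" "inv ?v c = ?q" unfolding a_def c_def by (rule iv)+
    have pos: "on_pos_side (eroot a c) s (alcove r u)"
      unfolding on_pos_side_def alcove_def using r i
      by (auto simp: side ia off fund_alcove_def split: if_splits)
    have neg: "on_neg_side (eroot a c) s (alcove r (aff_mult u ?g))"
    proof -
      have "ip (eroot a c) (aff_act (aff_mult u ?g) x) + of_int s < 0" if "x \<in> fund_alcove r" for x
        unfolding side' ia off gen using that r i by (auto simp: fund_alcove_def simple_refl_apply)
      then show ?thesis unfolding on_neg_side_def alcove_def by blast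
    qed
    show "\<exists>\<alpha>\<in>pos_roots r. \<exists>s. separates \<alpha> s (alcove r u) (alcove r (aff_mult u ?g)) \<and> on_pos_side \<alpha> s (alcove r u)"
      using root pos neg unfolding separates_def by blast
  qed
qed

lemma pos_folds_iff:
  assumes "2 \<le> r" "set ws \<subseteq> {0..<r}" "p \<in> base_walks r ws" "j \<in> folds ws p"
  shows "j \<in> pos_folds r ws p \<longleftrightarrow> descends r (p ! (j - 1)) (ws ! (j - 1))"
proof -
  have j: "1 \<le> j" "j \<le> length ws" using folds_le[OF assms(4)] by auto
  then have "ws ! (j - 1) \<in> set ws" by (intro nth_mem) auto
  then have "ws ! (j - 1) < r" using assms(2) by auto
  moreover have "snd (p ! (j - 1)) permutes {1..r}"
    using base_walks_permutes[OF assms(1-3)] j by auto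
  ultimately show ?thesis
    using positive_side_iff[OF assms(1)] assms(4) by (simp add: pos_folds_def)
qed

section \<open>Limits\<close>

lemma lim_q_0_const: "lim_q_0 (const c) c"
  unfolding lim_q_0_def const_def by (rule exI[of _ "[:c:]"], rule exI[of _ 1]) simp

lemma lim_q_0_add:
  assumes "lim_q_0 f c" "lim_q_0 g d"
  shows "lim_q_0 (f + g) (c + d)"
proof -
  obtain a b where 1: "poly b 0 \<noteq> 0" "f = Fract a b" "c = poly a 0 / poly b 0"
    using assms(1) unfolding lim_q_0_def by blast
  obtain a' b' where 2: "poly b' 0 \<noteq> 0" "g = Fract a' b'" "d = poly a' 0 / poly b' 0"
    using assms(2) unfolding lim_q_0_def by blast
  have "b \<noteq> 0" "b' \<noteq> 0" using 1 2 by auto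
  then have "f + g = Fract (a * b' + a' * b) (b * b')" using 1 2 by simp
  moreover have "c + d = poly (a * b' + a' * b) 0 / poly (b * b') 0"
    unfolding 1(3) 2(3) using 1(1) 2(1) by (simp add: add_frac_eq mult.commute)
  moreover have "poly (b * b') 0 \<noteq> 0" using 1 2 by simp
  ultimately show ?thesis unfolding lim_q_0_def by blast
qed

lemma lim_q_0_mult:
  assumes "lim_q_0 f c" "lim_q_0 g d"
  shows "lim_q_0 (f * g) (c * d)"
proof -
  obtain a b where 1: "poly b 0 \<noteq> 0" "f = Fract a b" "c = poly a 0 / poly b 0"
    using assms(1) unfolding lim_q_0_def by blast
  obtain a' b' where 2: "poly b' 0 \<noteq> 0" "g = Fract a' b'" "d = poly a' 0 / poly b' 0"
    using assms(2) unfolding lim_q_0_def by blast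
  have "f * g = Fract (a * a') (b * b')" "c * d = poly (a * a') 0 / poly (b * b') 0"
    "poly (b * b') 0 \<noteq> 0"
    using 1 2 by simp_all
  then show ?thesis unfolding lim_q_0_def by blast
qed

text \<open>The degrees are only bounded: in the limit at infinity a numerator may have smaller
  degree than its denominator, and its coefficient is still read off in the degree of the
  denominator.\<close>

lemma coeff_mult_top:
  fixes p q :: "'a::comm_ring_1 poly"
  assumes "degree p \<le> m" "degree q \<le> l"
  shows "coeff (p * q) (m + l) = coeff p m * coeff q l"
proof -
  have "coeff p i * coeff q (m + l - i) = 0" if "i \<noteq> m" "i \<le> m + l" for i
    using that assms by (cases "i < m") (simp_all add: coeff_eq_0)
  then have "(\<Sum>i\<le>m + l. coeff p i * coeff q (m + l - i)) = (\<Sum>i\<in>{m}. coeff p i * coeff q (m + l - i))"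
    by (intro sum.mono_neutral_right) auto
  then show ?thesis by (simp add: coeff_mult)
qed

lemma lim_q_inf_const: "lim_q_inf (const c) c"
  unfolding lim_q_inf_def const_def by (rule exI[of _ "[:c:]"], rule exI[of _ 1]) simp

lemma lim_q_inf_add:
  assumes "lim_q_inf f c" "lim_q_inf g d"
  shows "lim_q_inf (f + g) (c + d)"
proof -
  obtain a b where 1: "b \<noteq> 0" "f = Fract a b" "degree a \<le> degree b" "c = coeff a (degree b) / coeff b (degree b)"
    using assms(1) unfolding lim_q_inf_def by blast
  obtain a' b' where 2: "b' \<noteq> 0" "g = Fract a' b'" "degree a' \<le> degree b'" "d = coeff a' (degree b') / coeff b' (degree b')"
    using assms(2) unfolding lim_q_inf_def by blast
  have nz: "coeff b (degree b) \<noteq> 0" "coeff b' (degree b') \<noteq> 0" using 1 2 by auto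
  have deg: "degree (b * b') = degree b + degree b'" using 1 2 by (simp add: degree_mult_eq)
  have "degree (a * b' + a' * b) \<le> degree (b * b')"
    unfolding deg using degree_mult_le[of a b'] degree_mult_le[of a' b] 1(3) 2(3)
    by (intro degree_add_le) auto
  moreover have "f + g = Fract (a * b' + a' * b) (b * b')" using 1 2 by simp
  moreover have "c + d = coeff (a * b' + a' * b) (degree (b * b')) / coeff (b * b') (degree (b * b'))"
  proof -
    have "coeff (a' * b) (degree b + degree b') = coeff a' (degree b') * coeff b (degree b)"
      using coeff_mult_top[OF 2(3), of b "degree b"] by (simp add: add.commute)
    moreover have "coeff (a * b') (degree b + degree b') = coeff a (degree b) * coeff b' (degree b')"
      by (rule coeff_mult_top[OF 1(3) order_refl])
    moreover have "coeff (b * b') (degree b + degree b') = coeff b (degree b) * coeff b' (degree b')"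
      by (rule coeff_mult_top[OF order_refl order_refl])
    ultimately show ?thesis
      unfolding deg coeff_add 1(4) 2(4) by (simp only: add_frac_eq[OF nz])
  qed
  moreover have "b * b' \<noteq> 0" using 1 2 by simp
  ultimately show ?thesis unfolding lim_q_inf_def by blast
qed

lemma lim_q_inf_mult:
  assumes "lim_q_inf f c" "lim_q_inf g d"
  shows "lim_q_inf (f * g) (c * d)"
proof -
  obtain a b where 1: "b \<noteq> 0" "f = Fract a b" "degree a \<le> degree b" "c = coeff a (degree b) / coeff b (degree b)"
    using assms(1) unfolding lim_q_inf_def by blast
  obtain a' b' where 2: "b' \<noteq> 0" "g = Fract a' b'" "degree a' \<le> degree b'" "d = coeff a' (degree b') / coeff b' (degree b')"
    using assms(2) unfolding lim_q_inf_def by blast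
  have deg: "degree (b * b') = degree b + degree b'" using 1 2 by (simp add: degree_mult_eq)
  have "degree (a * a') \<le> degree (b * b')"
    unfolding deg using degree_mult_le[of a a'] 1(3) 2(3) by linarith
  moreover have "f * g = Fract (a * a') (b * b')" using 1 2 by simp
  moreover have "c * d = coeff (a * a') (degree (b * b')) / coeff (b * b') (degree (b * b'))"
    unfolding deg using coeff_mult_top[OF 1(3) 2(3)] by (simp add: coeff_mult_top 1(4) 2(4))
  moreover have "b * b' \<noteq> 0" using 1 2 by simp
  ultimately show ?thesis unfolding lim_q_inf_def by blast
qed

context metaplectic
begin

text \<open>Substituting y = q^(-d) C y' into the coefficient of the intertwiner cancels y'.\<close>

lemma cc_eq:
  assumes "i < r" "0 < wall_dist n r i \<mu>"
  obtains C d where "C \<noteq> 0" "d > 0"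
    "cc i \<mu> = Fract [:(G 0 - inverse (G 0)) * C:] ([:0, 1:] ^ d - [:C:])"
proof -
  obtain C where C: "C \<noteq> 0" "eig_hi i \<mu> \<noteq> 0"
    "eig_lo i \<mu> = qvar powi (- wall_dist n r i \<mu>) * const C * eig_hi i \<mu>"
    using eig_ratio[OF assms(1), of \<mu>] by metis
  define d where "d = nat (wall_dist n r i \<mu>)"
  have d: "d > 0" "wall_dist n r i \<mu> = int d" using assms(2) by (simp_all add: d_def)
  define Q where "Q = (qvar ^ d :: 'a poly fract)"
  have Q: "Q \<noteq> 0" by (simp add: Q_def)
  have lo: "eig_lo i \<mu> = const C * eig_hi i \<mu> / Q"
    by (simp add: C(3) d(2) power_int_minus Q_def field_simps)
  have "eig_hi i \<mu> - eig_lo i \<mu> = eig_hi i \<mu> * (Q - const C) / Q"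
    using Q by (simp add: lo field_simps)
  then have "cc i \<mu> = kap * const C / (Q - const C)"
    using Q C(2) by (simp add: cc_def lo)
  also have "Q - const C = Fract ([:0, 1:] ^ d - [:C:]) 1"
    by (simp add: Q_def qvar_power const_def)
  also have "kap * const C = Fract [:(G 0 - inverse (G 0)) * C:] 1"
    by (simp add: kap_def const_mult[symmetric]) (simp add: const_def)
  finally show thesis using that[OF C(1) d(1)] by simp
qed

text \<open>Since d > 0, the denominator is -C at q = 0, and its degree d exceeds that of the
  constant numerator.\<close>

lemma cc_limits:
  assumes "i < r" "0 < wall_dist n r i \<mu>"
  shows "lim_q_0 (cc i \<mu>) (inverse (G 0) - G 0)" and "lim_q_inf (cc i \<mu>) 0"
proof -
  obtain C d where C: "C \<noteq> 0" and d: "d > 0"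
    and cc: "cc i \<mu> = Fract [:(G 0 - inverse (G 0)) * C:] ([:0, 1:] ^ d - [:C:])"
    using cc_eq[OF assms] by metis
  let ?b = "[:0, 1:] ^ d - [:C:]"
  let ?a = "[:(G 0 - inverse (G 0)) * C:]"
  have b0: "poly ?b 0 = - C" using d by (simp add: poly_power)
  have "poly ?b 0 \<noteq> 0" "inverse (G 0) - G 0 = poly ?a 0 / poly ?b 0"
    unfolding b0 using C by simp_all
  then show "lim_q_0 (cc i \<mu>) (inverse (G 0) - G 0)"
    unfolding lim_q_0_def cc by blast
  have deg: "degree ?b = d"
    unfolding diff_conv_add_uminus
    by (subst degree_add_eq_left) (use d in \<open>simp_all add: degree_power_eq\<close>)
  then have "?b \<noteq> 0" using d by auto
  moreover have "coeff [:(G 0 - inverse (G 0)) * C:] d = 0" using d by (simp add: coeff_eq_0)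
  ultimately show "lim_q_inf (cc i \<mu>) 0"
    unfolding lim_q_inf_def cc
    by (intro exI[of _ "[:(G 0 - inverse (G 0)) * C:]"] exI[of _ ?b]) (simp add: deg)
qed

text \<open>Both limits at once: \<open>lm\<close> is the limit relation, \<open>S\<close> selects
  the folds that survive, and \<open>k\<close> is here the limit of their coefficients. Only
  compatibility of \<open>lm\<close> with constants, sums and products enters.\<close>

lemma limit_formula:
  fixes lm :: "'a poly fract \<Rightarrow> 'a \<Rightarrow> bool" and S :: "aff list \<Rightarrow> nat set"
  assumes lm_const: "\<And>c. lm (const c) c"
    and lm_add: "\<And>f g c d. lm f c \<Longrightarrow> lm g d \<Longrightarrow> lm (f + g) (c + d)"
    and lm_mult: "\<And>f g c d. lm f c \<Longrightarrow> lm g d \<Longrightarrow> lm (f * g) (c * d)"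
    and min: "min_word n r ws \<nu>"
    and us: "\<And>p. p \<in> base_walks r ws \<Longrightarrow> red_word r (us p) \<and> sprod (us p) = dir p"
    and pt: "pt \<in> base_walks r ws" "folds ws pt = {}"
    and S: "\<And>p. S p \<subseteq> folds ws p"
    and lm_fold: "\<And>p j. p \<in> base_walks r ws \<Longrightarrow> j \<in> folds ws p \<Longrightarrow>
      lm (fold_coeff ws (step_coeff ws \<nu>) p j) (if j \<in> S p then k else 0)"
  shows "\<exists>E. (\<forall>\<kappa>. lm (E_poly r n G (act_word n r ws \<nu>) \<cdot> \<kappa>) (E \<cdot> \<kappa>)) \<and>
    lsmult (Sigma_word n G \<nu> (us pt)) E =
      (\<Sum>p\<in>{p \<in> base_walks r ws. folds ws p \<subseteq> S p}. lsmult (Sigma_word n G \<nu> (us p) * k ^ card (S p))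
        (xpow (scale (int n) (wt p) + perm_act (dir p) \<nu>)))"
proof -
  let ?B = "base_walks r ws" and ?s = "Sigma_word n G \<nu> (us pt)"
  let ?g = "\<lambda>p. (\<Prod>j\<in>folds ws p. fold_coeff ws (step_coeff ws \<nu>) p j)"
  let ?e = "\<lambda>p. scale (int n) (wt p) + perm_act (dir p) \<nu>"
  let ?h = "\<lambda>p. Sigma_word n G \<nu> (us p) * k ^ card (S p)"
  define R where "R = (\<Sum>p\<in>{p \<in> ?B. folds ws p \<subseteq> S p}. lsmult (?h p) (xpow (?e p)))"
  have lm_sum: "lm (sum f A) (sum g A)" if "\<And>a. a \<in> A \<Longrightarrow> lm (f a) (g a)" for f g and A :: "aff list set"
    using that lm_const[of 0] by (induction A rule: infinite_finite_induct) (auto intro: lm_add)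
  have lm_prod: "lm (prod f A) (prod g A)" if "\<And>a. a \<in> A \<Longrightarrow> lm (f a) (g a)" for f g and A :: "nat set"
    using that lm_const[of 1] by (induction A rule: infinite_finite_induct) (auto intro: lm_mult)
  \<comment> \<open>A walk with a fold outside \<open>S\<close> has a factor that tends to 0 and
    drops out.\<close>
  have prod: "(\<Prod>j\<in>folds ws p. if j \<in> S p then k else 0) = (if folds ws p \<subseteq> S p then k ^ card (S p) else 0)" for p
  proof (cases "folds ws p \<subseteq> S p")
    case True
    then have "S p = folds ws p" using S by blast
    then show ?thesis by simp
  next
    case False
    then show ?thesis by (auto intro!: prod_zero)
  qed
  have s: "?s \<noteq> 0" by (rule Sigma_word_nonzero)
  have "lm (E_poly r n G (act_word n r ws \<nu>) \<cdot> \<kappa>) (lsmult (inverse ?s) R \<cdot> \<kappa>)" for \<kappa>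
  proof -
    have "E_poly r n G (act_word n r ws \<nu>) = lsmult (const (inverse ?s)) (EE ws \<nu>)"
      using s by (simp add: E_poly_eq[where us = us, OF min us pt, symmetric] const_inverse)
    also have "EE ws \<nu> = (\<Sum>p\<in>?B. lsmult (?g p * const (Sigma_word n G \<nu> (us p))) (xpow (?e p)))"
      by (intro EE_expand min us)
    finally have E: "E_poly r n G (act_word n r ws \<nu>) \<cdot> \<kappa> =
        const (inverse ?s) * (\<Sum>p\<in>?B. ?g p * const (Sigma_word n G \<nu> (us p)) * const (if \<kappa> = ?e p then 1 else 0))"
      by (simp add: lookup_sum lookup_xpow if_distrib[of const] cong: if_cong)
    have "lm (E_poly r n G (act_word n r ws \<nu>) \<cdot> \<kappa>) (inverse ?s * (\<Sum>p\<in>?B.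
        (if folds ws p \<subseteq> S p then k ^ card (S p) else 0) * Sigma_word n G \<nu> (us p) * (if \<kappa> = ?e p then 1 else 0)))"
      unfolding E prod[symmetric] by (intro lm_mult lm_const lm_sum lm_prod lm_fold)
    moreover have "(\<Sum>p\<in>?B. (if folds ws p \<subseteq> S p then k ^ card (S p) else 0) * Sigma_word n G \<nu> (us p) *
        (if \<kappa> = ?e p then 1 else 0)) = R \<cdot> \<kappa>"
      unfolding R_def lookup_sum using finite_base_walks[of r ws]
      by (intro sum.mono_neutral_cong_right) (auto simp: lookup_xpow mult.commute)
    ultimately show ?thesis by simp
  qed
  moreover have "lsmult ?s (lsmult (inverse ?s) R) = R" using s by simp
  ultimately show ?thesis unfolding R_def by blast
qed

lemma fold_coeff_limits:
  assumes "min_word n r ws \<nu>" "p \<in> base_walks r ws" "j \<in> folds ws p"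
  shows "lim_q_0 (fold_coeff ws (step_coeff ws \<nu>) p j) (if j \<in> pos_folds r ws p then inverse (G 0) - G 0 else 0)"
    and "lim_q_inf (fold_coeff ws (step_coeff ws \<nu>) p j) (if j \<in> neg_folds r ws p then G 0 - inverse (G 0) else 0)"
proof -
  have ws: "set ws \<subseteq> {0..<r}" using assms(1) by (simp add: min_word_def)
  have j: "1 \<le> j" "j \<le> length ws" using folds_le[OF assms(3)] by auto
  define l where "l = j - 1"
  have l: "l < length ws" using j by (simp add: l_def)
  have "drop l ws = ws ! l # drop (Suc l) ws" using l by (simp add: Cons_nth_drop_Suc)
  then have "min_word n r (ws ! l # drop (Suc l) ws) \<nu>"
    using min_word_drop[OF assms(1), of l] by simp
  then have w: "0 < wall_dist n r (ws ! l) (act_word n r (drop (Suc l) ws) \<nu>)"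
    by (rule min_word_wall_dist[OF r2])
  have "ws ! l < r" using ws l nth_mem by fastforce
  note c = cc_limits[OF this w, folded step_coeff_def]
  note iff = pos_folds_iff[OF r2 ws assms(2,3), folded l_def]
  have neg: "j \<in> neg_folds r ws p \<longleftrightarrow> j \<notin> pos_folds r ws p"
    using assms(3) by (simp add: neg_folds_def)
  show "lim_q_0 (fold_coeff ws (step_coeff ws \<nu>) p j) (if j \<in> pos_folds r ws p then inverse (G 0) - G 0 else 0)"
    using lim_q_0_add[OF c(1) lim_q_0_const[of "if j \<in> pos_folds r ws p then 0 else G 0 - inverse (G 0)"]]
    unfolding fold_coeff_def l_def[symmetric] iff kap_def by (cases "descends r (p ! l) (ws ! l)") simp_all
  show "lim_q_inf (fold_coeff ws (step_coeff ws \<nu>) p j) (if j \<in> neg_folds r ws p then G 0 - inverse (G 0) else 0)"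
    using lim_q_inf_add[OF c(2) lim_q_inf_const[of "if j \<in> pos_folds r ws p then 0 else G 0 - inverse (G 0)"]]
    unfolding fold_coeff_def l_def[symmetric] neg iff kap_def by (cases "descends r (p ! l) (ws ! l)") simp_all
qed

end

section \<open>The affine Weyl group\<close>

text \<open>If the coordinates sum to zero, \<beta> is the sum of \<beta>_j (\<epsilon>_j -
  \<epsilon>_1) over j >= 2.\<close>

lemma sum_zero_root_lattice:
  assumes "\<beta> \<in> vecs r" "(\<Sum>j\<in>{1..r}. \<beta> \<cdot> j) = 0" "1 \<le> r"
  shows "\<beta> \<in> root_lattice r"
proof -
  define c where "c \<alpha> = (\<Sum>j\<in>{2..r}. if \<alpha> = eroot j 1 then \<beta> \<cdot> j else 0)" for \<alpha> :: weight
  have "(roots r :: weight set) = (\<lambda>(i, j). eroot i j) ` {(i, j). i \<in> {1..r} \<and> j \<in> {1..r} \<and> i \<noteq> j}"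
    by (auto simp: roots_def)
  moreover have "finite {(i, j). i \<in> {1..r} \<and> j \<in> {1..r} \<and> i \<noteq> j}"
    by (rule finite_subset[of _ "{1..r} \<times> {1..r}"]) auto
  ultimately have fin: "finite (roots r :: weight set)" by simp
  have "(\<Sum>\<alpha>\<in>roots r. scale (c \<alpha>) \<alpha>) = \<beta>"
  proof (rule poly_mapping_eqI)
    fix k
    define \<rho> where "\<rho> j = (eroot j 1 :: weight)" for j
    have "(\<Sum>\<alpha>\<in>roots r. scale (c \<alpha>) \<alpha>) \<cdot> k =
        (\<Sum>\<alpha>\<in>roots r. \<Sum>j\<in>{2..r}. if \<alpha> = \<rho> j then \<beta> \<cdot> j * \<rho> j \<cdot> k else 0)"
      unfolding lookup_sum
      by (intro sum.cong) (auto simp: c_def \<rho>_def sum_distrib_right intro!: sum.cong)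
    also have "\<dots> = (\<Sum>j\<in>{2..r}. \<Sum>\<alpha>\<in>roots r. if \<alpha> = \<rho> j then \<beta> \<cdot> j * \<rho> j \<cdot> k else 0)"
      by (rule sum.swap)
    also have "\<dots> = (\<Sum>j\<in>{2..r}. \<beta> \<cdot> j * eroot j 1 \<cdot> k)"
    proof (intro sum.cong refl)
      fix j assume "j \<in> {2..r}"
      then have "j \<in> {1..r}" "1 \<in> {1..r}" "j \<noteq> 1" by auto
      then have "\<rho> j \<in> roots r" unfolding roots_def \<rho>_def by blast
      then show "(\<Sum>\<alpha>\<in>roots r. if \<alpha> = \<rho> j then \<beta> \<cdot> j * \<rho> j \<cdot> k else 0) = \<beta> \<cdot> j * eroot j 1 \<cdot> k"
        using fin by (simp add: \<rho>_def)
    qed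
    also have "\<dots> = \<beta> \<cdot> k"
    proof (cases "k = 1")
      case True
      have "{1..r} = insert 1 {2..r}" using assms(3) by auto
      then have "\<beta> \<cdot> 1 = - (\<Sum>j\<in>{2..r}. \<beta> \<cdot> j)" using assms(2) by simp
      moreover have "(\<Sum>j\<in>{2..r}. \<beta> \<cdot> j * eroot j 1 \<cdot> k) = (\<Sum>j\<in>{2..r}. - \<beta> \<cdot> j)"
        using True by (intro sum.cong) (auto simp: lookup_eroot)
      ultimately show ?thesis using True by (simp add: sum_negf)
    next
      case False
      have "(\<Sum>j\<in>{2..r}. \<beta> \<cdot> j * eroot j 1 \<cdot> k) = (\<Sum>j\<in>{2..r}. if j = k then \<beta> \<cdot> j else 0)"
        using False by (intro sum.cong) (auto simp: lookup_eroot)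
      then show ?thesis using assms(1) False by (cases "k = 0") (auto simp: vecs_iff)
    qed
    finally show "(\<Sum>\<alpha>\<in>roots r. scale (c \<alpha>) \<alpha>) \<cdot> k = \<beta> \<cdot> k" .
  qed
  then show ?thesis unfolding root_lattice_def by (intro CollectI exI[of _ c]) simp
qed

abbreviation aff_word :: "nat \<Rightarrow> nat \<Rightarrow> nat list \<Rightarrow> aff" where
  "aff_word n r \<equiv> word_prod aff_mult aff_one (aff_gen n r)"

lemma aff_word_Nil: "aff_word n r [] = aff_one"
  and aff_word_Cons: "aff_word n r (i # ws) = aff_mult (aff_gen n r i) (aff_word n r ws)"
  by (simp_all add: word_prod_def)

lemma bij_aff_word: "bij (snd (aff_word n r ws))"
proof (induction ws)
  case Nil
  show ?case unfolding aff_word_Nil unfolding aff_one_def snd_conv by (rule bij_id)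
next
  case (Cons i ws)
  have "snd (aff_mult u u') = snd u \<circ> snd u'" for u u' by (simp add: aff_mult_def)
  then have "bij (snd (aff_word n r (i # ws)))"
    unfolding aff_word_Cons by (simp only: bij_comp[OF Cons bij_aff_gen])
  then show ?case .
qed

lemma aff_act_word: "aff_act (aff_word n r ws) \<nu> = act_word n r ws \<nu>"
proof (induction ws)
  case Nil
  have "aff_act (0, id) \<nu> = \<nu>" by (rule poly_mapping_eqI) (simp add: lookup_aff_act)
  then show ?case unfolding aff_word_Nil unfolding aff_one_def by simp
next
  case (Cons i ws)
  have "aff_act (aff_gen n r i) \<kappa> = gen_act n r i \<kappa>" for \<kappa> :: weight
    unfolding aff_act_def aff_gen_def gen_act_def
    by (rule poly_mapping_eqI) (simp add: lookup_add Poly_Mapping.map.rep_eq when_def)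
  then show ?case
    unfolding aff_word_Cons using Cons by (simp add: aff_act_mult bij_aff_gen bij_aff_word)
qed

text \<open>In the induction the root lattice is replaced by vanishing coordinate sum, which
  permutations and the addition of \<theta> visibly preserve.\<close>

lemma aff_word_aff_weyl:
  assumes "2 \<le> r" "set ws \<subseteq> {0..<r}"
  shows "aff_word n r ws \<in> aff_weyl n r"
proof -
  have "\<exists>\<beta> v. aff_word n r ws = (scale (int n) \<beta>, v) \<and> \<beta> \<in> vecs r \<and> (\<Sum>j\<in>{1..r}. \<beta> \<cdot> j) = 0 \<and> v permutes {1..r}"
    using assms(2)
  proof (induction ws)
    case Nil
    have "aff_word n r [] = (scale (int n) 0, id)"
      unfolding aff_word_Nil unfolding aff_one_def by simp
    moreover have "(0 :: weight) \<in> vecs r" by (simp add: vecs_iff)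
    moreover have "id permutes {1..r}" by (rule permutes_id)
    ultimately show ?case by (intro exI conjI) (assumption | simp)+
  next
    case (Cons i ws)
    then obtain \<beta> v where IH: "aff_word n r ws = (scale (int n) \<beta>, v)" "\<beta> \<in> vecs r"
      "(\<Sum>j\<in>{1..r}. \<beta> \<cdot> j) = 0" "v permutes {1..r}" by auto
    define p where "p = snd (aff_gen n r i)"
    define \<theta> where "\<theta> = (if i = 0 then eroot 1 r else 0 :: weight)"
    have g: "aff_gen n r i = (scale (int n) \<theta>, p)"
      by (simp add: p_def \<theta>_def aff_gen_def)
    have p: "p permutes {1..r}" unfolding p_def using assms(1) Cons.prems by (intro aff_gen_permutes) auto
    have "aff_word n r (i # ws) = (scale (int n) (\<theta> + perm_act p \<beta>), p \<circ> v)"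
      unfolding aff_word_Cons IH(1) g by (simp add: aff_mult_def scale_add perm_act_scale permutes_bij[OF p])
    moreover have "\<theta> + perm_act p \<beta> \<in> vecs r"
      using assms(1) perm_act_vecs[OF p IH(2)] by (intro vecs_add) (auto simp: \<theta>_def vecs_iff lookup_eroot)
    moreover have "(\<Sum>j\<in>{1..r}. (\<theta> + perm_act p \<beta>) \<cdot> j) = 0"
    proof -
      have "(\<Sum>j\<in>{1..r}. perm_act p \<beta> \<cdot> j) = (\<Sum>j\<in>{1..r}. \<beta> \<cdot> inv p j)"
        by (simp add: lookup_perm_act permutes_bij[OF p])
      also have "\<dots> = (\<Sum>j\<in>{1..r}. \<beta> \<cdot> j)"
        by (rule sum.reindex_bij_betw[OF permutes_imp_bij[OF permutes_inv[OF p]]])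
      finally show ?thesis
        using assms(1) IH(3) by (simp add: lookup_add sum.distrib \<theta>_def lookup_eroot sum_subtractf)
    qed
    moreover have "p \<circ> v permutes {1..r}" by (rule permutes_compose[OF IH(4) p])
    ultimately show ?case by blast
  qed
  then show ?thesis
    unfolding aff_weyl_def using sum_zero_root_lattice assms(1) by fastforce
qed

text \<open>A competing word spells an element of the group with the same effect on the starting
  weight. Its length bounds the length of that element from above, and the length of w bounds it
  from below.\<close>

lemma min_word_reduced:
  assumes "2 \<le> r" "minimal_pair r n \<mu> lam w" "aff_reduced n r ws w"
  shows "min_word n r ws lam" "act_word n r ws lam = \<mu>"
proof -
  have ws: "set ws \<subseteq> {0..<r}" "aff_word n r ws = w" "length ws = aff_length n r w"
    using assms(3) by (simp_all add: aff_reduced_def reduced_word_def aff_length_def)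
  have M: "lam \<in> fund_weights r n" "aff_act w lam = \<mu>"
    "\<And>w'. w' \<in> aff_weyl n r \<Longrightarrow> aff_act w' lam = \<mu> \<Longrightarrow> aff_length n r w \<le> aff_length n r w'"
    using assms(2) by (auto simp: minimal_pair_def)
  show \<mu>: "act_word n r ws lam = \<mu>" using M(2) ws(2) by (simp add: aff_act_word[symmetric])
  have "length ws \<le> length ws'" if ws': "set ws' \<subseteq> {0..<r}" "act_word n r ws' lam = \<mu>" for ws'
  proof -
    have "length ws \<le> aff_length n r (aff_word n r ws')"
      unfolding ws(3) using ws' by (intro M(3) aff_word_aff_weyl[OF assms(1)]) (simp_all add: aff_act_word)
    also have "\<dots> \<le> length ws'"
      unfolding aff_length_def word_length_def using ws'(1) by (intro Least_le) blast
    finally show ?thesis .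
  qed
  then show "min_word n r ws lam" using M(1) ws(1) \<mu> by (simp add: min_word_def)
qed

lemma indet_nonzero: "indet v \<noteq> 0"
proof -
  have "Poly_Mapping.single (Poly_Mapping.single v 1) 1 \<noteq> (0 :: ('a \<Rightarrow>\<^sub>0 nat) \<Rightarrow>\<^sub>0 complex)"
    by (metis lookup_single_eq lookup_zero zero_neq_one)
  then show ?thesis by (simp add: indet_def Zero_fract_def eq_fract)
qed

lemma metaplectic_of_params:
  assumes "r \<ge> 2" "n \<ge> 1" "metaplectic_params n e G"
  shows "metaplectic r n G"
proof
  have p: "\<forall>j\<in>{0..(n - 1) div 2}. G (int j) = indet (e j)"
    "\<forall>j. \<not> int n dvd j \<longrightarrow> G j * G (- j) = 1" "\<forall>i j. i mod int n = j mod int n \<longrightarrow> G i = G j"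
    using assms(3) unfolding metaplectic_params_def by blast+
  have "G (int 0) = indet (e 0)" using p(1) by (rule bspec) simp
  then show "G 0 \<noteq> 0" by (simp add: indet_nonzero)
  show "G j * G (- j) = 1" if "\<not> int n dvd j" for j using p(2) that by blast
  show "G i = G j" if "i mod int n = j mod int n" for i j using p(3) that by blast
qed (use assms in auto)

theorem theorem5p2:
  fixes r n :: nat
    and e :: "nat \<Rightarrow> 'v::linorder"
    and G :: "int \<Rightarrow> 'v ratfun"
    and \<mu> lam :: weight
    and w :: aff
    and ws :: "nat list"
    and us :: "aff list \<Rightarrow> nat list"
    and pt :: "aff list"
  assumes "r \<ge> 2" and "n \<ge> 1"
    and "metaplectic_params n e G"
    and "\<mu> \<in> vecs r"
    and "minimal_pair r n \<mu> lam w"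
    and "aff_reduced n r ws w"
    and "\<And>p. p \<in> base_walks r ws \<Longrightarrow> sym_reduced r (us p) (dir p)"
    and "pt \<in> base_walks r ws" and "folds ws pt = {}"
  shows
    "(\<exists>E0. coeff_lim_0 (E_poly r n G \<mu>) E0 \<and>
        lsmult (Sigma_word n G lam (us pt)) E0 =
          (\<Sum>p\<in>pos_walks r ws.
             lsmult (Sigma_word n G lam (us p) * (inverse (G 0) - G 0) ^ card (pos_folds r ws p))
               (xpow (scale (int n) (wt p) + perm_act (dir p) lam)))) \<and>
     (\<exists>Einf. coeff_lim_inf (E_poly r n G \<mu>) Einf \<and>
        lsmult (Sigma_word n G lam (us pt)) Einf =
          (\<Sum>p\<in>neg_walks r ws.
             lsmult (Sigma_word n G lam (us p) * (G 0 - inverse (G 0)) ^ card (neg_folds r ws p))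
               (xpow (scale (int n) (wt p) + perm_act (dir p) lam))))"
proof -
  interpret metaplectic r n G by (rule metaplectic_of_params[OF assms(1-3)])
  note min = min_word_reduced(1)[OF assms(1,5,6)] and \<mu> = min_word_reduced(2)[OF assms(1,5,6)]
  have us: "red_word r (us p) \<and> sprod (us p) = dir p" if "p \<in> base_walks r ws" for p
    using sym_reducedD[OF assms(7)[OF that]] by simp
  have S: "pos_folds r ws p \<subseteq> folds ws p" "neg_folds r ws p \<subseteq> folds ws p" for p
    by (auto simp: pos_folds_def neg_folds_def)
  show ?thesis
    unfolding coeff_lim_0_def coeff_lim_inf_def pos_walks_def neg_walks_def
    using limit_formula[OF lim_q_0_const lim_q_0_add lim_q_0_mult min us assms(8,9) S(1) fold_coeff_limits(1)[OF min]]
      limit_formula[OF lim_q_inf_const lim_q_inf_add lim_q_inf_mult min us assms(8,9) S(2) fold_coeff_limits(2)[OF min]]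
    by (simp add: \<mu>)
qed

end
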